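(* Let $\mathcal{X}$ be a compact Hausdorff space and let $\vec{A} = (A_1, \dots, A_m)$ and $\vec{B} = (B_1, \dots, B_m)$ be abelian families in $C(\mathcal{X}, \mathcal{M}_n)$. Consider the following properties: (1) Assuming $\vec{A}$ and $\vec{B}$ are CSD, $\vec{A} \prec_c \vec{B}$. (2) $\vec{A} \prec_{\mathrm{pt}} \vec{B}$. (3) $\vec{A} \prec_{\mathrm{tr}} \vec{B}$. (4) $\vec{A} \prec_{\mathrm{tr}, \mathrm{pt}} \vec{B}$. (5) Assuming $\vec{A}$ and $\vec{B}$ are CSD, for each $x\in \mathcal{X}$ there exists a unital, trace-preserving, (completely) positive map $\Psi_x : \mathcal{D}_n \to \mathcal{D}_n$ such that if $\Psi : C(\mathcal{X}, \mathcal{D}_n) \to C(\mathcal{X}, \mathcal{D}_n)$ is defined by $\Psi(T)(x) = \Psi_x(T(x))$ for every $T \in C(\mathcal{X}, \mathcal{D}_n)$ and $x \in \mathcal{X}$, then $\Psi$ is well-defined, and there exist unitaries $U, V \in C(\mathcal{X}, \mathcal{M}_n)$ such that $U C^*(A_1,\ldots, A_m) U^* \subseteq C(\mathcal{X}, \mathcal{D}_n)$ and, if $\Phi : C^*(A_1,\ldots, A_m) \to C(\mathcal{X}, \mathcal{M}_n)$ is defined by $\Phi(T) = V^*\Psi(UTU^* )V$ for all $T \in C^*(A_1,\ldots, A_m)$, then $\Phi(A_k) = B_k$ for all $1 \leq k \leq m$ (and $\Phi$ is a unital (completely) positive map that preserves every trace on $C(\mathcal{X}, \mathcal{M}_n)$).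 (6) $\vec{A} \in \mathrm{conv}(\mathcal{U}(\vec{B}))$. (7) $\vec{A} \in \overline{\mathrm{conv}}(\mathcal{U}(\vec{B}))$. Then (6) $\Rightarrow$ (1) $\Leftrightarrow$ (5) $\Rightarrow$ (2), and (6) $\Rightarrow$ (7) $\Rightarrow$ (2) $\Leftrightarrow$ (4) $\Leftrightarrow$ (3).
   Context: $\mathcal{M}_n$ denotes the $n\times n$ complex matrices and $\mathcal{D}_n\subseteq\mathcal{M}_n$ the diagonal matrices; the trace on $\mathcal{M}_n$ and $\mathcal{D}_n$ is the normalized trace $\mathrm{tr}$. $\mathcal{M}_{n\times m}$ denotes the $n\times m$ complex matrices. $C(\mathcal{X},\mathfrak{A})$ denotes the continuous functions from $\mathcal{X}$ to $\mathfrak{A}$. $C^*(A_1,\dots,A_m)$ is the C$^*$-subalgebra generated by $A_1,\dots,A_m$. For a unital C$^*$-algebra $\mathfrak{A}$, an abelian family in $\mathfrak{A}$ is an $m$-tuple $\vec{A}=(A_1,\dots,A_m)\in\mathfrak{A}^m$ of pairwise commuting self-adjoint elements. For continuous $f:\mathbb{R}^m\to\mathbb{R}$, $f(A_1,\dots,A_m)$ is defined by the joint continuous functional calculus. The (joint) unitary orbit is $\mathcal{U}(\vec{A})=\{(U^*A_1U,\dots,U^*A_mU) : U\in\mathfrak{A}\text{ unitary}\}\subseteq\mathfrak{A}^m$; $\mathrm{conv}(\mathcal{U}(\vec{A}))$ is its convex hull and $\overline{\mathrm{conv}}(\mathcal{U}(\vec{A}))$ is the norm closure of this convex hull in $\mathfrak{A}^m$.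 A tracial state on $\mathfrak{A}$ is a unital positive linear functional $\tau$ with $\tau(AB)=\tau(BA)$ for all $A,B\in\mathfrak{A}$. For abelian families in $\mathfrak{A}$, $\vec{A}\prec_{\mathrm{tr}}\vec{B}$ means $\tau(f(A_1,\dots,A_m))\le\tau(f(B_1,\dots,B_m))$ for every tracial state $\tau$ on $\mathfrak{A}$ and every continuous convex $f:\mathbb{R}^m\to\mathbb{R}$. $DS_n$ is the set of doubly stochastic matrices: $n\times n$ matrices with non-negative entries all of whose row sums and column sums equal $1$. If $\vec{A},\vec{B}$ are abelian families in $\mathcal{M}_n$, simultaneously diagonalize: $A_j=U^*D_jU$, $B_j=V^*D_j'V$ with $U,V$ unitary and $D_j,D_j'$ diagonal ($1\le j\le m$). Let $A$ and $B$ be the $n\times m$ matrices whose $j$-th columns are the diagonals of $D_j$ and $D_j'$ respectively. Then $\vec{A}\prec\vec{B}$ means there is $X\in DS_n$ with $XB=A$. For abelian families in $C(\mathcal{X},\mathcal{M}_n)$, write $\vec{A}(x)=(A_1(x),\dots,A_m(x))$. Then $\vec{A}\prec_{\mathrm{pt}}\vec{B}$ means $\vec{A}(x)\prec\vec{B}(x)$ for every $x\in\mathcal{X}$, and $\vec{A}\prec_{\mathrm{tr},\mathrm{pt}}\vec{B}$ means $\vec{A}(x)\prec_{\mathrm{tr}}\vec{B}(x)$ in $\mathcal{M}_n$ for every $x\in\mathcal{X}$. An abelian family $(A_1,\dots,A_m)$ in $C(\mathcal{X},\mathcal{M}_n)$ is continuously simultaneously diagonalizable (CSD) if there are a unitary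 $U\in C(\mathcal{X},\mathcal{M}_n)$ and $D_1,\dots,D_m\in C(\mathcal{X},\mathcal{D}_n)$ with $A_i=UD_iU^*$ for all $i$. For CSD families $\vec{A},\vec{B}$, write $A_j=U^*D_jU$, $B_j=V^*D_j'V$ with $U,V\in C(\mathcal{X},\mathcal{M}_n)$ unitary and $D_j,D_j'\in C(\mathcal{X},\mathcal{D}_n)$, and let $A,B\in C(\mathcal{X},\mathcal{M}_{n\times m})$ have as $j$-th columns the diagonals of $D_j$ and $D_j'$ respectively. Then $\vec{A}\prec_c\vec{B}$ means there is $X\in C(\mathcal{X},DS_n)$ with $XB=A$.
   Formalization: In (5) the roles of A and B are interchanged: U C*(B_1,…,B_m) U* ⊆ C(X,D_n), Φ is defined on C*(B_1,…,B_m), and Φ(B_k)=A_k; as printed (1)⇒(5) fails for X a point, A=I/2, B=diag(1,0). *)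

theory Defs
  imports "HOL-Analysis.Analysis"
begin

section \<open>Unital C*-algebras, given by their operations\<close>

text \<open>
  The notions for a general unital C*-algebra take a record of the operations that the type
  class \<^class>\<open>real_normed_vector\<close> does not supply. Addition and the topology are those of the
  type. The record carries no C*-norm: the norm enters only through closures, and for both
  algebras used below, \<open>mat_alg\<close> and \<open>cont_alg\<close>, the library norm (Frobenius norm, supremum of
  Frobenius norms) is equivalent to the C*-norm, so the closures are the same.
\<close>

record 'a star_alg =
  mul :: "'a \<Rightarrow> 'a \<Rightarrow> 'a"
  unity :: 'a
  star :: "'a \<Rightarrow> 'a"
  cscale :: "complex \<Rightarrow> 'a \<Rightarrow> 'a"

definition unitary_elem :: "'a star_alg \<Rightarrow> 'a \<Rightarrow> bool" where
  "unitary_elem \<AA> U \<longleftrightarrow> mul \<AA> (star \<AA> U) U = unity \<AA> \<and> mul \<AA> U (star \<AA> U) = unity \<AA>"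

definition abelian_family :: "'a star_alg \<Rightarrow> 'a ^ 'm \<Rightarrow> bool" where
  "abelian_family \<AA> A \<longleftrightarrow>
     (\<forall>i. star \<AA> (A $ i) = A $ i) \<and> (\<forall>i j. mul \<AA> (A $ i) (A $ j) = mul \<AA> (A $ j) (A $ i))"

definition unitary_orbit :: "'a star_alg \<Rightarrow> 'a ^ 'm \<Rightarrow> ('a ^ 'm) set" where
  "unitary_orbit \<AA> A = {(\<chi> j. mul \<AA> (mul \<AA> (star \<AA> U) (A $ j)) U) | U. unitary_elem \<AA> U}"

definition unital_cstar_subalgebra :: "'a::real_normed_vector star_alg \<Rightarrow> 'a set \<Rightarrow> bool" where
  "unital_cstar_subalgebra \<AA> S \<longleftrightarrow>
     unity \<AA> \<in> S \<and> (\<forall>a\<in>S. \<forall>b\<in>S. a + b \<in> S) \<and> (\<forall>a\<in>S. \<forall>c. cscale \<AA> c a \<in> S) \<and>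
     (\<forall>a\<in>S. \<forall>b\<in>S. mul \<AA> a b \<in> S) \<and> (\<forall>a\<in>S. star \<AA> a \<in> S) \<and> closed S"

text \<open>The generated C*-subalgebra contains the unit of the ambient algebra.\<close>

definition cstar_gen :: "'a::real_normed_vector star_alg \<Rightarrow> 'a ^ 'm \<Rightarrow> 'a set" where
  "cstar_gen \<AA> A = unital_cstar_subalgebra \<AA> hull (range (\<lambda>j. A $ j))"


subsection \<open>Joint continuous functional calculus\<close>

text \<open>Characters of the subalgebra \<open>S\<close>: unital *-homomorphisms into the complex numbers.\<close>

definition character_on :: "'a::real_normed_vector star_alg \<Rightarrow> 'a set \<Rightarrow> ('a \<Rightarrow> complex) \<Rightarrow> bool" where
  "character_on \<AA> S \<phi> \<longleftrightarrow>
     \<phi> (unity \<AA>) = 1 \<and>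
     (\<forall>a\<in>S. \<forall>b\<in>S. \<phi> (a + b) = \<phi> a + \<phi> b) \<and> (\<forall>a\<in>S. \<forall>c. \<phi> (cscale \<AA> c a) = c * \<phi> a) \<and>
     (\<forall>a\<in>S. \<forall>b\<in>S. \<phi> (mul \<AA> a b) = \<phi> a * \<phi> b) \<and> (\<forall>a\<in>S. \<phi> (star \<AA> a) = cnj (\<phi> a))"

text \<open>
  The element of the commutative C*-algebra generated by \<open>A\<close> whose Gelfand transform is
  \<open>f\<close> composed with the Gelfand transforms of the \<open>A $ j\<close>. The numbers \<open>\<phi> (A $ j)\<close> are real
  because the \<open>A $ j\<close> are self-adjoint.
\<close>

definition joint_calc ::
    "'a::real_normed_vector star_alg \<Rightarrow> (real ^ 'm \<Rightarrow> real) \<Rightarrow> 'a ^ 'm \<Rightarrow> 'a" where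
  "joint_calc \<AA> f A =
     (THE T. T \<in> cstar_gen \<AA> A \<and>
        (\<forall>\<phi>. character_on \<AA> (cstar_gen \<AA> A) \<phi> \<longrightarrow>
             \<phi> T = of_real (f (\<chi> j. Re (\<phi> (A $ j))))))"


subsection \<open>Tracial states and tracial majorization\<close>

definition tracial_state :: "'a::real_normed_vector star_alg \<Rightarrow> ('a \<Rightarrow> complex) \<Rightarrow> bool" where
  "tracial_state \<AA> \<tau> \<longleftrightarrow>
     (\<forall>a b. \<tau> (a + b) = \<tau> a + \<tau> b) \<and> (\<forall>c a. \<tau> (cscale \<AA> c a) = c * \<tau> a) \<and>
     \<tau> (unity \<AA>) = 1 \<and> (\<forall>a. \<tau> (mul \<AA> (star \<AA> a) a) \<in> \<real>\<^sub>\<ge>\<^sub>0) \<and>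
     (\<forall>a b. \<tau> (mul \<AA> a b) = \<tau> (mul \<AA> b a))"

text \<open>\<open>Re\<close> only changes the type: tracial states are real on self-adjoint elements.\<close>

definition tr_majorized :: "'a::real_normed_vector star_alg \<Rightarrow> 'a ^ 'm \<Rightarrow> 'a ^ 'm \<Rightarrow> bool" where
  "tr_majorized \<AA> A B \<longleftrightarrow>
     (\<forall>\<tau> f. tracial_state \<AA> \<tau> \<longrightarrow> continuous_on UNIV f \<longrightarrow> convex_on UNIV f \<longrightarrow>
        Re (\<tau> (joint_calc \<AA> f A)) \<le> Re (\<tau> (joint_calc \<AA> f B)))"


subsection \<open>Positive and completely positive maps between subalgebras\<close>

definition linear_map_on ::
    "'a::real_normed_vector star_alg \<Rightarrow> 'a set \<Rightarrow> 'a set \<Rightarrow> ('a \<Rightarrow> 'a) \<Rightarrow> bool" where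
  "linear_map_on \<AA> S S' F \<longleftrightarrow>
     (\<forall>a\<in>S. F a \<in> S') \<and> (\<forall>a\<in>S. \<forall>b\<in>S. F (a + b) = F a + F b) \<and>
     (\<forall>a\<in>S. \<forall>c. F (cscale \<AA> c a) = cscale \<AA> c (F a))"

definition positive_in :: "'a::real_normed_vector star_alg \<Rightarrow> 'a set \<Rightarrow> 'a \<Rightarrow> bool" where
  "positive_in \<AA> S a \<longleftrightarrow> (\<exists>r\<in>S. a = mul \<AA> (star \<AA> r) r)"

text \<open>
  Positivity in the algebra of \<open>k \<times> k\<close> matrices over \<open>S\<close>, whose elements are represented by
  functions restricted to indices below \<open>k\<close>: \<open>T = R\<^sup>* R\<close> for some such matrix \<open>R\<close>.
\<close>

definition positive_matrix_in ::
    "'a::real_normed_vector star_alg \<Rightarrow> 'a set \<Rightarrow> nat \<Rightarrow> (nat \<Rightarrow> nat \<Rightarrow> 'a) \<Rightarrow> bool" where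
  "positive_matrix_in \<AA> S k T \<longleftrightarrow>
     (\<exists>R. (\<forall>i<k. \<forall>j<k. R i j \<in> S) \<and>
          (\<forall>i<k. \<forall>j<k. T i j = (\<Sum>l<k. mul \<AA> (star \<AA> (R l i)) (R l j))))"

definition positive_map ::
    "'a::real_normed_vector star_alg \<Rightarrow> 'a set \<Rightarrow> 'a set \<Rightarrow> ('a \<Rightarrow> 'a) \<Rightarrow> bool" where
  "positive_map \<AA> S S' F \<longleftrightarrow>
     linear_map_on \<AA> S S' F \<and> (\<forall>a. positive_in \<AA> S a \<longrightarrow> positive_in \<AA> S' (F a))"

definition completely_positive_map ::
    "'a::real_normed_vector star_alg \<Rightarrow> 'a set \<Rightarrow> 'a set \<Rightarrow> ('a \<Rightarrow> 'a) \<Rightarrow> bool" where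
  "completely_positive_map \<AA> S S' F \<longleftrightarrow>
     linear_map_on \<AA> S S' F \<and>
     (\<forall>k T. positive_matrix_in \<AA> S k T \<longrightarrow> positive_matrix_in \<AA> S' k (\<lambda>i j. F (T i j)))"


section \<open>The algebra of complex matrices\<close>

definition mat_adj :: "complex ^ 'n ^ 'n \<Rightarrow> complex ^ 'n ^ 'n" where
  "mat_adj M = (\<chi> i j. cnj (M $ j $ i))"

definition mat_cscale :: "complex \<Rightarrow> complex ^ 'n ^ 'n \<Rightarrow> complex ^ 'n ^ 'n" where
  "mat_cscale c M = (\<chi> i j. c * M $ i $ j)"

definition mat_alg :: "(complex ^ 'n ^ 'n) star_alg" where
  "mat_alg = \<lparr>mul = (**), unity = mat 1, star = mat_adj, cscale = mat_cscale\<rparr>"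

definition norm_trace :: "complex ^ 'n ^ 'n \<Rightarrow> complex" where
  "norm_trace M = trace M / of_nat CARD('n)"

definition diag_mats :: "(complex ^ 'n ^ 'n) set" where
  "diag_mats = {M. \<forall>i j. i \<noteq> j \<longrightarrow> M $ i $ j = 0}"

definition doubly_stochastic :: "(complex ^ 'n ^ 'n) set" where
  "doubly_stochastic =
     {X. (\<forall>i j. X $ i $ j \<in> \<real>\<^sub>\<ge>\<^sub>0) \<and> (\<forall>i. (\<Sum>j\<in>UNIV. X $ i $ j) = 1) \<and>
         (\<forall>j. (\<Sum>i\<in>UNIV. X $ i $ j) = 1)}"

text \<open>The \<open>n \<times> m\<close> matrix whose \<open>j\<close>-th column is the diagonal of \<open>D $ j\<close>.\<close>

definition diag_columns :: "(complex ^ 'n ^ 'n) ^ 'm \<Rightarrow> complex ^ 'm ^ 'n" where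
  "diag_columns D = (\<chi> i j. D $ j $ i $ i)"

text \<open>
  The existence of \<open>X\<close> does not depend on the chosen diagonalizations: two diagonalizations of
  the same family have diagonals related by the doubly stochastic matrix of squared moduli of
  the entries of a unitary. The same remark applies to \<open>c_majorized\<close>.
\<close>

definition majorized :: "(complex ^ 'n ^ 'n) ^ 'm \<Rightarrow> (complex ^ 'n ^ 'n) ^ 'm \<Rightarrow> bool" where
  "majorized A B \<longleftrightarrow>
     (\<exists>U V D D'. unitary_elem mat_alg U \<and> unitary_elem mat_alg V \<and>
        (\<forall>j. D $ j \<in> diag_mats \<and> A $ j = mat_adj U ** D $ j ** U) \<and>
        (\<forall>j. D' $ j \<in> diag_mats \<and> B $ j = mat_adj V ** D' $ j ** V) \<and>
        (\<exists>X\<in>doubly_stochastic. X ** diag_columns D' = diag_columns D))"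


section \<open>The algebra of continuous matrix-valued functions\<close>

text \<open>
  Over a compact space every continuous function is bounded, so \<open>'x \<Rightarrow>\<^sub>C (complex ^ 'n ^ 'n)\<close> is
  the set of all continuous functions, with the supremum norm.
\<close>

definition cont_mul ::
    "('x::topological_space \<Rightarrow>\<^sub>C (complex ^ 'n ^ 'n)) \<Rightarrow> ('x \<Rightarrow>\<^sub>C (complex ^ 'n ^ 'n)) \<Rightarrow> ('x \<Rightarrow>\<^sub>C (complex ^ 'n ^ 'n))"
    (infixl \<open>**\<^sub>C\<close> 70) where
  "F **\<^sub>C G = Bcontfun (\<lambda>x. apply_bcontfun F x ** apply_bcontfun G x)"

definition cont_adj ::
    "('x::topological_space \<Rightarrow>\<^sub>C (complex ^ 'n ^ 'n)) \<Rightarrow> ('x \<Rightarrow>\<^sub>C (complex ^ 'n ^ 'n))" where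
  "cont_adj F = Bcontfun (\<lambda>x. mat_adj (F x))"

definition cont_cscale ::
    "complex \<Rightarrow> ('x::topological_space \<Rightarrow>\<^sub>C (complex ^ 'n ^ 'n)) \<Rightarrow> ('x \<Rightarrow>\<^sub>C (complex ^ 'n ^ 'n))" where
  "cont_cscale c F = Bcontfun (\<lambda>x. mat_cscale c (F x))"

definition cont_alg :: "('x::topological_space \<Rightarrow>\<^sub>C (complex ^ 'n ^ 'n)) star_alg" where
  "cont_alg = \<lparr>mul = (**\<^sub>C), unity = const_bcontfun (mat 1), star = cont_adj,
               cscale = cont_cscale\<rparr>"

lemma norm_vec_le_sum: "norm (v :: 'a::real_normed_vector ^ 'n) \<le> (\<Sum>i\<in>UNIV. norm (v $ i))"
  by (simp add: norm_vec_def L2_set_le_sum)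

lemma apply_cont_mul [simp]:
  fixes F G :: "'x::topological_space \<Rightarrow>\<^sub>C (complex ^ 'n ^ 'n)"
  shows "apply_bcontfun (F **\<^sub>C G) x = F x ** G x"
proof -
  have comp: "bounded (range (\<lambda>x. H x $ i $ j))"
    for H :: "'x \<Rightarrow>\<^sub>C (complex ^ 'n ^ 'n)" and i j
  proof -
    obtain b where b: "\<And>x. norm (H x) \<le> b"
      using bounded_apply_bcontfun[of H] by (auto simp: bounded_iff)
    have "norm (H x $ i $ j) \<le> b" for x
      using Finite_Cartesian_Product.norm_nth_le[of "H x $ i" j]
        Finite_Cartesian_Product.norm_nth_le[of "H x" i] b[of x] by linarith
    then show ?thesis by (auto simp: bounded_iff)
  qed
  have "bounded (range (\<lambda>x. F x ** G x))"
  proof -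
    have "\<exists>b. \<forall>x. norm ((F x ** G x) $ i $ j) \<le> b" for i j
    proof -
      have "\<forall>k. \<exists>b. \<forall>x. norm (F x $ i $ k * G x $ k $ j) \<le> b"
      proof
        fix k
        obtain a where a: "\<And>x. norm (F x $ i $ k) \<le> a"
          using comp[of F i k] by (auto simp: bounded_iff)
        obtain b where b: "\<And>x. norm (G x $ k $ j) \<le> b"
          using comp[of G k j] by (auto simp: bounded_iff)
        have "norm (F x $ i $ k * G x $ k $ j) \<le> a * b" for x
          unfolding norm_mult
          by (intro mult_mono a b order_trans[OF norm_ge_zero a]) auto
        then show "\<exists>b. \<forall>x. norm (F x $ i $ k * G x $ k $ j) \<le> b" by blast
      qed
      then obtain b where b: "\<And>k x. norm (F x $ i $ k * G x $ k $ j) \<le> b k" by metis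
      have "norm ((F x ** G x) $ i $ j) \<le> (\<Sum>k\<in>UNIV. b k)" for x
        unfolding matrix_matrix_mult_def by (simp add: sum_norm_le b)
      then show ?thesis by blast
    qed
    then obtain b where b: "\<And>i j x. norm ((F x ** G x) $ i $ j) \<le> b i j" by metis
    have "norm (F x ** G x) \<le> (\<Sum>i\<in>UNIV. \<Sum>j\<in>UNIV. b i j)" for x
    proof -
      have "norm (F x ** G x) \<le> (\<Sum>i\<in>UNIV. norm ((F x ** G x) $ i))"
        by (rule norm_vec_le_sum)
      also have "\<dots> \<le> (\<Sum>i\<in>UNIV. \<Sum>j\<in>UNIV. norm ((F x ** G x) $ i $ j))"
        by (intro sum_mono norm_vec_le_sum)
      also have "\<dots> \<le> (\<Sum>i\<in>UNIV. \<Sum>j\<in>UNIV. b i j)"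
        by (intro sum_mono b)
      finally show ?thesis .
    qed
    then show ?thesis by (auto simp: bounded_iff)
  qed
  moreover have "continuous_on UNIV (\<lambda>x. F x ** G x)"
    unfolding matrix_matrix_mult_def by (intro continuous_intros) auto
  ultimately show ?thesis
    unfolding cont_mul_def by (subst Bcontfun_inverse) (auto simp: bcontfun_def)
qed

lemma apply_cont_cscale [simp]:
  fixes F :: "'x::topological_space \<Rightarrow>\<^sub>C (complex ^ 'n ^ 'n)"
  shows "apply_bcontfun (cont_cscale c F) x = mat_cscale c (F x)"
proof -
  have eq: "mat_cscale c M = mat c ** M" for M :: "complex ^ 'n ^ 'n"
    by (auto simp: mat_cscale_def matrix_matrix_mult_def mat_def vec_eq_iff if_distrib
        if_distribR cong: if_cong)
  have "(\<lambda>x. mat_cscale c (F x)) = apply_bcontfun (const_bcontfun (mat c) **\<^sub>C F)"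
    by (simp add: fun_eq_iff eq const_bcontfun.rep_eq)
  then show ?thesis
    unfolding cont_cscale_def by (metis apply_bcontfun_inverse)
qed

lemma apply_cont_adj [simp]:
  fixes F :: "'x::topological_space \<Rightarrow>\<^sub>C (complex ^ 'n ^ 'n)"
  shows "apply_bcontfun (cont_adj F) x = mat_adj (F x)"
proof -
  have norm: "norm (mat_adj M) \<le> (\<Sum>i\<in>(UNIV::'n set). \<Sum>j\<in>(UNIV::'n set). norm M)"
    for M :: "complex ^ 'n ^ 'n"
  proof -
    have "norm (mat_adj M) \<le> (\<Sum>i\<in>UNIV. \<Sum>j\<in>UNIV. norm (mat_adj M $ i $ j))"
      by (intro order_trans[OF norm_vec_le_sum] sum_mono norm_vec_le_sum)
    also have "\<dots> \<le> (\<Sum>i\<in>(UNIV::'n set). \<Sum>j\<in>(UNIV::'n set). norm M)"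
    proof (intro sum_mono)
      fix i j
      show "norm (mat_adj M $ i $ j) \<le> norm M"
        using Finite_Cartesian_Product.norm_nth_le[of "M $ j" i]
          Finite_Cartesian_Product.norm_nth_le[of M j]
        by (simp add: mat_adj_def)
    qed
    finally show ?thesis .
  qed
  obtain b where b: "\<And>x. norm (F x) \<le> b"
    using bounded_apply_bcontfun[of F] by (auto simp: bounded_iff)
  have "norm (mat_adj (F x)) \<le> (\<Sum>i\<in>(UNIV::'n set). \<Sum>j\<in>(UNIV::'n set). b)" for x
    by (rule order_trans[OF norm]) (intro sum_mono b)
  then have "bounded (range (\<lambda>x. mat_adj (F x)))"
    by (auto simp: bounded_iff)
  moreover have "continuous_on UNIV (\<lambda>x. mat_adj (F x))"
    unfolding mat_adj_def by (intro continuous_intros) auto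
  ultimately show ?thesis
    unfolding cont_adj_def by (subst Bcontfun_inverse) (auto simp: bcontfun_def)
qed

definition cont_diag :: "('x::topological_space \<Rightarrow>\<^sub>C (complex ^ 'n ^ 'n)) set" where
  "cont_diag = {T. \<forall>x. apply_bcontfun T x \<in> diag_mats}"

definition family_at ::
    "('x::topological_space \<Rightarrow>\<^sub>C (complex ^ 'n ^ 'n)) ^ 'm \<Rightarrow> 'x \<Rightarrow> (complex ^ 'n ^ 'n) ^ 'm" where
  "family_at A x = (\<chi> j. (A $ j) x)"

definition pt_majorized ::
    "('x::topological_space \<Rightarrow>\<^sub>C (complex ^ 'n ^ 'n)) ^ 'm \<Rightarrow>
     ('x \<Rightarrow>\<^sub>C (complex ^ 'n ^ 'n)) ^ 'm \<Rightarrow> bool" where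
  "pt_majorized A B \<longleftrightarrow> (\<forall>x. majorized (family_at A x) (family_at B x))"

definition tr_pt_majorized ::
    "('x::topological_space \<Rightarrow>\<^sub>C (complex ^ 'n ^ 'n)) ^ 'm \<Rightarrow>
     ('x \<Rightarrow>\<^sub>C (complex ^ 'n ^ 'n)) ^ 'm \<Rightarrow> bool" where
  "tr_pt_majorized A B \<longleftrightarrow> (\<forall>x. tr_majorized mat_alg (family_at A x) (family_at B x))"

definition csd :: "('x::topological_space \<Rightarrow>\<^sub>C (complex ^ 'n ^ 'n)) ^ 'm \<Rightarrow> bool" where
  "csd A \<longleftrightarrow>
     (\<exists>U D. unitary_elem cont_alg U \<and>
        (\<forall>i. D $ i \<in> cont_diag \<and> A $ i = U **\<^sub>C D $ i **\<^sub>C cont_adj U))"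

definition c_majorized ::
    "('x::topological_space \<Rightarrow>\<^sub>C (complex ^ 'n ^ 'n)) ^ 'm \<Rightarrow>
     ('x \<Rightarrow>\<^sub>C (complex ^ 'n ^ 'n)) ^ 'm \<Rightarrow> bool" where
  "c_majorized A B \<longleftrightarrow>
     (\<exists>U V D D'. unitary_elem cont_alg U \<and> unitary_elem cont_alg V \<and>
        (\<forall>j. D $ j \<in> cont_diag \<and> A $ j = cont_adj U **\<^sub>C D $ j **\<^sub>C U) \<and>
        (\<forall>j. D' $ j \<in> cont_diag \<and> B $ j = cont_adj V **\<^sub>C D' $ j **\<^sub>C V) \<and>
        (\<exists>X :: 'x \<Rightarrow>\<^sub>C (complex ^ 'n ^ 'n). \<forall>x. X x \<in> doubly_stochastic \<and>
            X x ** diag_columns (family_at D' x) = diag_columns (family_at D x)))"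


subsection \<open>Majorization through fibrewise maps of diagonal matrices\<close>

text \<open>
  \<open>fibre_map \<Psi>\<close> is the map \<open>T \<mapsto> (x \<mapsto> \<Psi> x (T x))\<close>; it is meaningful on \<open>cont_diag\<close> only if
  \<open>fibre_map_well_defined \<Psi>\<close>.
\<close>

definition fibre_map_well_defined ::
    "('x::topological_space \<Rightarrow> complex ^ 'n ^ 'n \<Rightarrow> complex ^ 'n ^ 'n) \<Rightarrow> bool" where
  "fibre_map_well_defined \<Psi> \<longleftrightarrow>
     (\<forall>T\<in>cont_diag. continuous_on UNIV (\<lambda>x. \<Psi> x (apply_bcontfun T x)) \<and>
                    (\<forall>x. \<Psi> x (apply_bcontfun T x) \<in> diag_mats))"

definition fibre_map ::
    "('x::topological_space \<Rightarrow> complex ^ 'n ^ 'n \<Rightarrow> complex ^ 'n ^ 'n) \<Rightarrow>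
     ('x \<Rightarrow>\<^sub>C (complex ^ 'n ^ 'n)) \<Rightarrow> ('x \<Rightarrow>\<^sub>C (complex ^ 'n ^ 'n))" where
  "fibre_map \<Psi> T = Bcontfun (\<lambda>x. \<Psi> x (T x))"

definition conj_fibre_map ::
    "('x::topological_space \<Rightarrow>\<^sub>C (complex ^ 'n ^ 'n)) \<Rightarrow> ('x \<Rightarrow>\<^sub>C (complex ^ 'n ^ 'n)) \<Rightarrow>
     ('x \<Rightarrow> complex ^ 'n ^ 'n \<Rightarrow> complex ^ 'n ^ 'n) \<Rightarrow>
     ('x \<Rightarrow>\<^sub>C (complex ^ 'n ^ 'n)) \<Rightarrow> ('x \<Rightarrow>\<^sub>C (complex ^ 'n ^ 'n))" where
  "conj_fibre_map U V \<Psi> T =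
     cont_adj V **\<^sub>C fibre_map \<Psi> (U **\<^sub>C T **\<^sub>C cont_adj U) **\<^sub>C V"

text \<open>
  The map \<open>\<Phi> = conj_fibre_map U V \<Psi>\<close> is defined on the algebra generated by \<open>B\<close> and sends
  \<open>B $ k\<close> to \<open>A $ k\<close>, so that \<open>A\<close> is the averaged family, as in \<open>X ** B = A\<close>. The source prints
  the condition with \<open>A\<close> and \<open>B\<close> interchanged, which expresses majorization of \<open>B\<close> by \<open>A\<close>:
  over a point, \<open>A = I/2\<close> and \<open>B = diag(1, 0)\<close> satisfy \<open>c_majorized A B\<close>, but no unital linear
  map takes \<open>I/2\<close> to \<open>diag(1, 0)\<close>.

  The source writes ``(completely) positive'' and states the properties of \<open>\<Phi>\<close> in
  parentheses. \<open>map_majorized\<close> is the reading without the parenthesized parts and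
  \<open>cp_map_majorized\<close> is the reading with all of them.
\<close>

definition map_majorized ::
    "('x::topological_space \<Rightarrow>\<^sub>C (complex ^ 'n ^ 'n)) ^ 'm \<Rightarrow>
     ('x \<Rightarrow>\<^sub>C (complex ^ 'n ^ 'n)) ^ 'm \<Rightarrow> bool" where
  "map_majorized A B \<longleftrightarrow>
     (\<exists>\<Psi>. (\<forall>x. positive_map mat_alg diag_mats diag_mats (\<Psi> x) \<and> \<Psi> x (mat 1) = mat 1 \<and>
               (\<forall>T\<in>diag_mats. norm_trace (\<Psi> x T) = norm_trace T)) \<and>
          fibre_map_well_defined \<Psi> \<and>
          (\<exists>U V. unitary_elem cont_alg U \<and> unitary_elem cont_alg V \<and>
             (\<forall>T\<in>cstar_gen cont_alg B. U **\<^sub>C T **\<^sub>C cont_adj U \<in> cont_diag) \<and>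
             (\<forall>k. conj_fibre_map U V \<Psi> (B $ k) = A $ k)))"

definition cp_map_majorized ::
    "('x::topological_space \<Rightarrow>\<^sub>C (complex ^ 'n ^ 'n)) ^ 'm \<Rightarrow>
     ('x \<Rightarrow>\<^sub>C (complex ^ 'n ^ 'n)) ^ 'm \<Rightarrow> bool" where
  "cp_map_majorized A B \<longleftrightarrow>
     (\<exists>\<Psi>. (\<forall>x. completely_positive_map mat_alg diag_mats diag_mats (\<Psi> x) \<and>
               \<Psi> x (mat 1) = mat 1 \<and>
               (\<forall>T\<in>diag_mats. norm_trace (\<Psi> x T) = norm_trace T)) \<and>
          fibre_map_well_defined \<Psi> \<and>
          (\<exists>U V. unitary_elem cont_alg U \<and> unitary_elem cont_alg V \<and>
             (\<forall>T\<in>cstar_gen cont_alg B. U **\<^sub>C T **\<^sub>C cont_adj U \<in> cont_diag) \<and>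
             (\<forall>k. conj_fibre_map U V \<Psi> (B $ k) = A $ k) \<and>
             conj_fibre_map U V \<Psi> (unity cont_alg) = unity cont_alg \<and>
             completely_positive_map cont_alg (cstar_gen cont_alg B) UNIV
               (conj_fibre_map U V \<Psi>) \<and>
             (\<forall>\<tau>. tracial_state cont_alg \<tau> \<longrightarrow>
                (\<forall>T\<in>cstar_gen cont_alg B. \<tau> (conj_fibre_map U V \<Psi> T) = \<tau> T))))"

end

theory Submission
  imports Defs
begin

text \<open>
  Both algebras consist of matrix-valued functions (on one point, and on the given space), and
  everything is reduced to fibres by evaluation. The joint functional calculus is computed
  fibrewise after a simultaneous diagonalization; it stays in the generated C*-algebra by
  Stone--Weierstrass. A tracial state depends only on the pointwise trace and is monotone in it,
  so tracial majorization is a fibrewise notion. On a fibre it says that the joint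
  eigenvalue vectors satisfy \<open>\<Sum> f(a\<^sub>p) \<le> \<Sum> f(b\<^sub>p)\<close> for all convex \<open>f\<close>, which is equivalent to
  \<open>a = X b\<close> with \<open>X\<close> doubly stochastic by Jensen's inequality and a separation argument.
  An average of unitary conjugations of diagonal matrices acts on the diagonals as a doubly stochastic
  matrix, built from the squared moduli of the entries of the unitaries, and fibrewise positive
  unital trace-preserving maps of the diagonal matrices are the same as doubly stochastic matrices. The
  only delicate point is complete positivity, which needs continuous square roots of positive matrices.
\<close>

section \<open>Complex matrices\<close>

text \<open>Without CSD the diagonalizing unitaries of the fibres need not depend continuously on
  the point, so no element of the algebra is assembled from them. Continuity of the functional
  calculus comes from uniform limits of polynomials in the family, with error bounds that are the
  same on all fibres. \<open>joint_calc\<close> prescribes values at all characters of the generated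
  algebra, including those not visibly attached to a fibre. This is why existence rests on a general
  argument about zeros of continuous functions, while uniqueness only uses diagonal entries on
  fibres. Complete positivity is defined through square factors. The image of a k by k Gram matrix
  is naturally a Gram matrix with k n rows, and it must be rewritten with k rows that are still
  continuous; a pointwise choice of factors does not guarantee this, a power series in the matrix
  does. Its argument may have norm 1, so the series is needed on the boundary of its disc of
  convergence.\<close>

lemma mat_alg_simps [simp]:
  "mul mat_alg = (**)" "unity mat_alg = mat 1" "star mat_alg = mat_adj"
  "cscale mat_alg = mat_cscale"
  by (simp_all add: mat_alg_def)

lemma mat_adj_mult: "mat_adj (M ** N) = mat_adj N ** mat_adj M"
  by (simp add: mat_adj_def matrix_matrix_mult_def vec_eq_iff mult.commute)

lemma mat_adj_mat_adj [simp]: "mat_adj (mat_adj M) = M"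
  by (simp add: mat_adj_def vec_eq_iff)

lemma mat_cscale_eq: "mat_cscale c M = mat c ** M"
  by (auto simp: mat_cscale_def matrix_matrix_mult_def mat_def vec_eq_iff if_distrib
      if_distribR cong: if_cong)

lemma mat_cscale_mult_left: "mat_cscale c M ** N = mat_cscale c (M ** N)"
  by (simp add: mat_cscale_eq matrix_mul_assoc)

lemma mat_cscale_mult_right: "M ** mat_cscale c N = mat_cscale c (M ** N)"
  by (simp add: mat_cscale_def matrix_matrix_mult_def vec_eq_iff sum_distrib_left mult.left_commute)

lemma mat_cscale_of_real: "mat_cscale (of_real c) M = c *\<^sub>R M"
  by (simp add: mat_cscale_def vec_eq_iff scaleR_conv_of_real[where 'a = complex])

lemma matrix_mult_scaleR_left: "(c *\<^sub>R M) ** N = c *\<^sub>R (M ** N)" for M :: "complex ^ 'k ^ 'n"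
  by (simp add: matrix_matrix_mult_def vec_eq_iff scaleR_sum_right)

lemma matrix_mult_scaleR_right: "M ** (c *\<^sub>R N) = c *\<^sub>R (M ** N)" for M :: "complex ^ 'k ^ 'n"
  by (simp add: matrix_matrix_mult_def vec_eq_iff scaleR_sum_right)

lemma matrix_add_rdistrib: "(M + N) ** K = M ** K + N ** K" for K :: "complex ^ 'k ^ 'n"
  by (simp add: matrix_matrix_mult_def vec_eq_iff sum.distrib algebra_simps)

lemma matrix_mult_sum_left: "(\<Sum>i\<in>I. f i) ** N = (\<Sum>i\<in>I. f i ** N)"
  for N :: "complex ^ 'k ^ 'n" and f :: "'i \<Rightarrow> complex ^ 'n ^ 'l"
  by (induction I rule: infinite_finite_induct) (simp_all add: matrix_add_rdistrib)

lemma matrix_mult_sum_right: "N ** (\<Sum>i\<in>I. f i) = (\<Sum>i\<in>I. N ** f i)"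
  for N :: "complex ^ 'k ^ 'n" and f :: "'i \<Rightarrow> complex ^ 'l ^ 'k"
  by (induction I rule: infinite_finite_induct) (simp_all add: matrix_add_ldistrib)

lemma norm_entry_le: "norm (M $ i $ j) \<le> norm M" for M :: "complex ^ 'k ^ 'n"
  using Finite_Cartesian_Product.norm_nth_le[of "M $ i" j]
    Finite_Cartesian_Product.norm_nth_le[of M i] by linarith

lemma norm_matrix_le_sum: "norm M \<le> (\<Sum>i\<in>UNIV. \<Sum>j\<in>UNIV. norm (M $ i $ j))"
  for M :: "complex ^ 'k ^ 'n"
  by (intro order_trans[OF norm_vec_le_sum] sum_mono norm_vec_le_sum)

lemma continuous_on_matrix_iff:
  "continuous_on S f \<longleftrightarrow> (\<forall>i j. continuous_on S (\<lambda>x. f x $ i $ j))"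
  for f :: "'x::topological_space \<Rightarrow> complex ^ 'k ^ 'n"
proof
  assume "\<forall>i j. continuous_on S (\<lambda>x. f x $ i $ j)"
  then have "continuous_on S (\<lambda>x. \<chi> i j. f x $ i $ j)"
    by (intro continuous_on_vec_lambda) auto
  then show "continuous_on S f" by simp
qed (intro allI continuous_intros, assumption)

section \<open>Diagonal matrices\<close>

definition diag_mat :: "('n \<Rightarrow> complex) \<Rightarrow> complex ^ 'n ^ 'n" where
  "diag_mat v = (\<chi> i j. if i = j then v i else 0)"

lemma diag_mat_nth: "diag_mat v $ i $ j = (if i = j then v i else 0)"
  by (simp add: diag_mat_def)

lemma diag_mat_in_diag_mats [simp]: "diag_mat v \<in> diag_mats"
  by (simp add: diag_mat_def diag_mats_def)

lemma diag_mats_eq: "M \<in> diag_mats \<Longrightarrow> M = diag_mat (\<lambda>i. M $ i $ i)"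
  by (auto simp: diag_mat_def diag_mats_def vec_eq_iff)

lemma diag_mat_mult_left_nth: "(diag_mat v ** M) $ i $ j = v i * M $ i $ j"
proof -
  have "(diag_mat v ** M) $ i $ j = (\<Sum>k\<in>UNIV. if i = k then v i * M $ k $ j else 0)"
    unfolding matrix_matrix_mult_def vec_lambda_beta by (rule sum.cong) (simp_all add: diag_mat_nth)
  then show ?thesis by simp
qed

lemma diag_mat_mult_right_nth: "(M ** diag_mat v) $ i $ j = M $ i $ j * v j"
proof -
  have "(M ** diag_mat v) $ i $ j = (\<Sum>k\<in>UNIV. if k = j then M $ i $ k * v k else 0)"
    unfolding matrix_matrix_mult_def vec_lambda_beta by (rule sum.cong) (simp_all add: diag_mat_nth)
  then show ?thesis by simp
qed

lemma diag_mat_mult: "diag_mat v ** diag_mat w = diag_mat (\<lambda>i. v i * w i)"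
  by (simp add: vec_eq_iff diag_mat_mult_left_nth diag_mat_nth)

lemma diag_mat_add: "diag_mat v + diag_mat w = diag_mat (\<lambda>i. v i + w i)"
  by (auto simp: diag_mat_def vec_eq_iff)

lemma diag_mat_adj: "mat_adj (diag_mat v) = diag_mat (\<lambda>i. cnj (v i))"
  by (auto simp: diag_mat_def mat_adj_def vec_eq_iff)

lemma diag_mat_cscale: "mat_cscale c (diag_mat v) = diag_mat (\<lambda>i. c * v i)"
  by (auto simp: diag_mat_def mat_cscale_def vec_eq_iff)

lemma diag_mat_sum: "(\<Sum>l\<in>L. diag_mat (v l)) = diag_mat (\<lambda>i. \<Sum>l\<in>L. v l i)"
  by (induction L rule: infinite_finite_induct)
    (simp_all add: diag_mat_add, simp_all add: diag_mat_def vec_eq_iff)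

lemma diag_mats_mult_nth: "M \<in> diag_mats \<Longrightarrow> N \<in> diag_mats \<Longrightarrow> (M ** N) $ i $ i = M $ i $ i * N $ i $ i"
  by (metis (no_types, lifting) diag_mat_mult diag_mat_nth diag_mats_eq)

lemma diag_mats_closed:
  "mat 1 \<in> diag_mats"
  "M \<in> diag_mats \<Longrightarrow> N \<in> diag_mats \<Longrightarrow> M + N \<in> diag_mats"
  "M \<in> diag_mats \<Longrightarrow> N \<in> diag_mats \<Longrightarrow> M ** N \<in> diag_mats"
  "M \<in> diag_mats \<Longrightarrow> mat_cscale c M \<in> diag_mats"
  "M \<in> diag_mats \<Longrightarrow> mat_adj M \<in> diag_mats"
proof -
  show "M \<in> diag_mats \<Longrightarrow> N \<in> diag_mats \<Longrightarrow> M ** N \<in> diag_mats"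
    by (metis diag_mat_in_diag_mats diag_mat_mult diag_mats_eq)
qed (simp_all add: diag_mats_def mat_def mat_cscale_def mat_adj_def)

lemma closed_diag_mats: "closed (diag_mats :: (complex ^ 'n ^ 'n) set)"
proof -
  have eq: "diag_mats = (\<Inter>i. \<Inter>j\<in>{j. i \<noteq> j}. {M :: complex ^ 'n ^ 'n. M $ i $ j = 0})"
    by (auto simp: diag_mats_def)
  show ?thesis
    unfolding eq by (intro closed_INT ballI closed_Collect_eq continuous_intros)
qed

section \<open>Unitary matrices and conjugates of diagonal matrices\<close>

abbreviation unitary :: "complex ^ 'n ^ 'n \<Rightarrow> bool" where
  "unitary \<equiv> unitary_elem mat_alg"

lemma unitaryD: "unitary U \<Longrightarrow> mat_adj U ** U = mat 1" "unitary U \<Longrightarrow> U ** mat_adj U = mat 1"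
  by (simp_all add: unitary_elem_def)

lemma unitary_adj: "unitary U \<Longrightarrow> unitary (mat_adj U)"
  by (simp add: unitary_elem_def)

lemma unitary_mult: "unitary U \<Longrightarrow> unitary V \<Longrightarrow> unitary (U ** V)"
  by (simp add: unitary_elem_def mat_adj_mult)
    (metis matrix_mul_assoc matrix_mul_rid)

lemma unitary_cancel:
  assumes "unitary U"
  shows "mat_adj U ** (U ** M) = M" "U ** (mat_adj U ** M) = M"
    "M ** U ** mat_adj U = M" "M ** mat_adj U ** U = M"
  using unitaryD[OF assms] by (metis matrix_mul_assoc matrix_mul_lid matrix_mul_rid)+

lemma unitary_conj_mult:
  assumes "unitary U"
  shows "U ** (M ** N) ** mat_adj U = (U ** M ** mat_adj U) ** (U ** N ** mat_adj U)"
  using unitary_cancel[OF assms] by (simp add: matrix_mul_assoc)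

lemma unitary_column_sum:
  assumes "unitary U"
  shows "(\<Sum>p\<in>UNIV. (cmod (U $ p $ a))\<^sup>2) = 1"
proof -
  have "complex_of_real (\<Sum>p\<in>UNIV. (cmod (U $ p $ a))\<^sup>2) = (mat_adj U ** U) $ a $ a"
    by (simp add: matrix_matrix_mult_def mat_adj_def complex_norm_square mult.commute del: of_real_power)
  also have "\<dots> = 1" using unitaryD[OF assms] by (simp add: mat_def)
  finally show ?thesis using of_real_eq_1_iff by blast
qed

lemma unitary_row_sum:
  assumes "unitary U"
  shows "(\<Sum>a\<in>UNIV. (cmod (U $ p $ a))\<^sup>2) = 1"
  using unitary_column_sum[OF unitary_adj[OF assms], of p] by (simp add: mat_adj_def)

lemma unitary_entry_le:
  assumes "unitary U"
  shows "cmod (U $ p $ a) \<le> 1"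
proof -
  have "(cmod (U $ p $ a))\<^sup>2 \<le> (\<Sum>p\<in>UNIV. (cmod (U $ p $ a))\<^sup>2)"
    by (rule member_le_sum) auto
  then show ?thesis using unitary_column_sum[OF assms] by (simp add: power_le_one_iff abs_square_le_1)
qed

lemma unitary_conj_diag_nth:
  "(mat_adj U ** diag_mat v ** U) $ a $ b = (\<Sum>p\<in>UNIV. cnj (U $ p $ a) * v p * U $ p $ b)"
  unfolding matrix_matrix_mult_def[of _ U] by (simp add: diag_mat_mult_right_nth mat_adj_def)

lemma unitary_conj_diag_nth_self:
  "(mat_adj U ** diag_mat v ** U) $ a $ a = (\<Sum>p\<in>UNIV. of_real ((cmod (U $ p $ a))\<^sup>2) * v p)"
  unfolding unitary_conj_diag_nth
  by (intro sum.cong refl) (simp add: complex_norm_square mult_ac del: of_real_power)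

text \<open>There are n squared entries, each a sum of n terms of modulus at most \<open>e\<close>,
  hence the cube. What matters is that the bound does not involve \<open>U\<close>, so it is uniform
  over all fibres.\<close>

lemma norm_unitary_conj_diag_le:
  assumes "unitary U" and "\<And>p. cmod (v p) \<le> e"
  shows "norm (mat_adj U ** diag_mat v ** U :: complex ^ 'n ^ 'n) \<le> real CARD('n) ^ 3 * e"
proof -
  have "cmod (cnj (U $ p $ a) * v p * U $ p $ b) \<le> e" for a b p
  proof -
    have "cmod (cnj (U $ p $ a) * v p * U $ p $ b) \<le> 1 * e * 1"
      unfolding norm_mult complex_mod_cnj
      by (intro mult_mono unitary_entry_le assms mult_nonneg_nonneg order_trans[OF norm_ge_zero assms(2)])
        auto
    then show ?thesis by simp
  qed
  then have "norm ((mat_adj U ** diag_mat v ** U) $ a $ b) \<le> real CARD('n) * e" for a b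
    unfolding unitary_conj_diag_nth by (rule order_trans[OF sum_norm_le[of _ _ "\<lambda>_. e"]]) auto
  then have "(\<Sum>a\<in>UNIV. \<Sum>b\<in>UNIV. norm ((mat_adj U ** diag_mat v ** U) $ a $ b))
      \<le> (\<Sum>a\<in>(UNIV::'n set). \<Sum>b\<in>(UNIV::'n set). real CARD('n) * e)"
    by (intro sum_mono)
  then show ?thesis
    using norm_matrix_le_sum[of "mat_adj U ** diag_mat v ** U"] by (simp add: power3_eq_cube mult_ac)
qed

lemma norm_trace_conj: "unitary U \<Longrightarrow> norm_trace (mat_adj U ** M ** U) = norm_trace M"
  unfolding norm_trace_def
  by (metis trace_mul_sym matrix_mul_assoc matrix_mul_lid unitaryD(2))

lemma trace_add: "trace (M + N) = trace M + trace N"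
  by (simp add: trace_def sum.distrib)

lemma norm_trace_diag: "norm_trace (diag_mat v :: complex ^ 'n ^ 'n) = (\<Sum>i\<in>UNIV. v i) / of_nat CARD('n)"
  by (simp add: norm_trace_def trace_def diag_mat_nth)

lemma continuous_on_norm_trace [continuous_intros]:
  "continuous_on S f \<Longrightarrow> continuous_on S (\<lambda>x. norm_trace (f x))"
  unfolding norm_trace_def trace_def by (intro continuous_intros) auto

definition matrix_unit :: "'n \<Rightarrow> 'n \<Rightarrow> complex ^ 'n ^ 'n" where
  "matrix_unit p q = (\<chi> i j. if i = p \<and> j = q then 1 else 0)"

lemma sum_matrix_unit: "(\<Sum>p\<in>UNIV. matrix_unit p p) = (mat 1 :: complex ^ 'n ^ 'n)"
proof -
  have "(\<Sum>p\<in>UNIV. matrix_unit p p $ i $ j) = (mat 1 :: complex ^ 'n ^ 'n) $ i $ j" for i j :: 'n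
  proof -
    have "(\<Sum>p\<in>UNIV. matrix_unit p p $ i $ j) = (\<Sum>p\<in>UNIV. if p = i then mat 1 $ i $ j else 0)"
      by (rule sum.cong) (auto simp: matrix_unit_def mat_def)
    then show ?thesis by simp
  qed
  then show ?thesis by (simp add: vec_eq_iff)
qed

lemma matrix_unit_mult: "matrix_unit p q ** matrix_unit q r = matrix_unit p r"
proof -
  have "(\<Sum>k\<in>UNIV. matrix_unit p q $ i $ k * matrix_unit q r $ k $ j) = matrix_unit p r $ i $ j" for i j
    by (subst sum.remove[of _ q]) (auto simp: matrix_unit_def intro!: sum.neutral)
  then show ?thesis by (simp add: vec_eq_iff matrix_matrix_mult_def)
qed

text \<open>The summand for p, q moves the diagonal entry of \<open>M\<close> at q to the diagonal
  position p, so every diagonal position collects the full trace.\<close>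

lemma sum_matrix_unit_conj:
  "(\<Sum>p\<in>UNIV. \<Sum>q\<in>UNIV. matrix_unit p q ** M ** matrix_unit q p) = mat (trace M)"
proof -
  have sandwich: "(matrix_unit p q ** M ** matrix_unit q p) $ i $ j = (if i = p \<and> j = p then M $ q $ q else 0)"
    for p q i j
  proof -
    have "(matrix_unit p q ** M) $ i $ k = (if i = p then M $ q $ k else 0)" for k
      unfolding matrix_matrix_mult_def by (simp add: matrix_unit_def)
         (subst sum.remove[of _ q]; auto simp: intro!: sum.neutral)
    then show ?thesis
      unfolding matrix_matrix_mult_def[of "matrix_unit p q ** M"]
      by (simp add: matrix_unit_def) (subst sum.remove[of _ q]; auto simp: intro!: sum.neutral)
  qed
  have "(\<Sum>p\<in>UNIV. \<Sum>q\<in>UNIV. matrix_unit p q ** M ** matrix_unit q p) $ i $ j = mat (trace M) $ i $ j" for i j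
  proof (cases "i = j")
    case True
    have "(\<Sum>p\<in>UNIV. \<Sum>q\<in>UNIV. (if i = p \<and> j = p then M $ q $ q else 0))
        = (\<Sum>p\<in>UNIV. if p = j then trace M else 0)"
      by (intro sum.cong refl) (auto simp: True trace_def)
    then show ?thesis by (simp add: sandwich True mat_def)
  qed (auto simp: sandwich mat_def intro!: sum.neutral)
  then show ?thesis by (simp add: vec_eq_iff)
qed

section \<open>Simultaneous diagonalization\<close>

text \<open>Conjugate-linear in the first argument. The real inner product of the type is its real
  part, and self-adjoint matrices have real eigenvalues; the spectral argument can therefore run
  over real subspaces and real dimensions. Only orthonormality has to be complex.\<close>

definition cinner :: "complex ^ 'n \<Rightarrow> complex ^ 'n \<Rightarrow> complex" where
  "cinner v w = (\<Sum>i\<in>UNIV. cnj (v $ i) * w $ i)"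

lemma cinner_add: "cinner u (v + w) = cinner u v + cinner u w"
  by (simp add: cinner_def algebra_simps sum.distrib)

lemma cinner_scaleR: "cinner u (c *\<^sub>R v) = c *\<^sub>R cinner u v"
  by (simp add: cinner_def scaleR_sum_right)

lemma cinner_cnj: "cnj (cinner v w) = cinner w v"
  by (simp add: cinner_def mult.commute)

lemma Re_cinner: "Re (cinner v w) = inner v w"
  by (simp add: cinner_def inner_vec_def inner_complex_def)

lemma cinner_self: "cinner v v = of_real ((norm v)\<^sup>2)"
proof -
  have "Im (cinner v v) = 0"
    using cinner_cnj[of v v] by (metis complex_cnj_cancel_iff Reals_cnj_iff complex_is_Real_iff)
  then show ?thesis by (simp add: complex_eq_iff Re_cinner power2_norm_eq_inner)
qed

lemma cinner_mat_adj: "cinner (mat_adj M *v v) w = cinner v (M *v w)"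
proof -
  have "cinner (mat_adj M *v v) w = (\<Sum>i\<in>UNIV. \<Sum>j\<in>UNIV. M $ j $ i * cnj (v $ j) * w $ i)"
    by (simp add: cinner_def mat_adj_def matrix_vector_mult_def sum_distrib_right)
  also have "\<dots> = (\<Sum>j\<in>UNIV. \<Sum>i\<in>UNIV. M $ j $ i * cnj (v $ j) * w $ i)"
    by (rule sum.swap)
  also have "\<dots> = cinner v (M *v w)"
    by (simp add: cinner_def matrix_vector_mult_def sum_distrib_left mult_ac)
  finally show ?thesis .
qed

lemma matrix_vector_mult_scaleR_complex: "M *v (c *\<^sub>R v) = c *\<^sub>R (M *v v)"
  for M :: "complex ^ 'k ^ 'n"
  by (simp add: matrix_vector_mult_def vec_eq_iff scaleR_sum_right)

text \<open>The maximum of the Rayleigh quotient over the unit sphere of the subspace is an eigenvalue.\<close>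

lemma selfadjoint_eigenvector_in_subspace:
  fixes M :: "complex ^ 'n ^ 'n"
  assumes sa: "mat_adj M = M" and W: "subspace W" and inv: "\<And>w. w \<in> W \<Longrightarrow> M *v w \<in> W"
    and nz: "u \<in> W" "u \<noteq> 0"
  obtains v c where "v \<in> W" "v \<noteq> 0" "M *v v = c *\<^sub>R v"
proof -
  let ?S = "W \<inter> sphere 0 1"
  have comp: "compact ?S" by (simp add: W closed_subspace closed_Int_compact)
  have ne: "u /\<^sub>R norm u \<in> ?S" using nz W by (simp add: subspace_scale)
  have cont: "continuous_on ?S (\<lambda>v. inner v (M *v v))"
    unfolding matrix_vector_mult_def by (intro continuous_intros)
  obtain v where v: "v \<in> ?S" "\<And>w. w \<in> ?S \<Longrightarrow> inner w (M *v w) \<le> inner v (M *v v)"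
    using continuous_attains_sup[OF comp _ cont] ne by blast
  define c where "c = inner v (M *v v)"
  have vW: "v \<in> W" and vv: "inner v v = 1" using v(1) by (auto simp: dot_square_norm)
  \<comment> \<open>The quadratic form of \<open>c\<close> times the identity minus
    \<open>M\<close>: nonnegative on \<open>W\<close> and zero at the maximizer \<open>v\<close>, so
    its first variation at \<open>v\<close> has to vanish.\<close>
  define Q where "Q w = c * inner w w - inner w (M *v w)" for w
  have Q_nonneg: "Q w \<ge> 0" if "w \<in> W" for w
  proof (cases "w = 0")
    case False
    then have "inner (w /\<^sub>R norm w) (M *v (w /\<^sub>R norm w)) \<le> c"
      unfolding c_def using that W by (intro v(2)) (simp add: subspace_scale)
    then have "inner w (M *v w) / (norm w)\<^sup>2 \<le> c"
      by (simp add: matrix_vector_mult_scaleR_complex power2_eq_square divide_simps)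
    then show ?thesis using False by (simp add: Q_def divide_simps power2_norm_eq_inner)
  qed (simp add: Q_def)
  have sym: "inner w (M *v z) = inner z (M *v w)" for w z
    using cinner_mat_adj[of M w z] by (metis Re_cinner sa inner_commute)
  define w where "w = c *\<^sub>R v - M *v v"
  have wW: "w \<in> W" using vW inv W by (simp add: w_def subspace_diff subspace_scale)
  have Q_expand: "Q (v + t *\<^sub>R w) = 2 * t * inner w w + t\<^sup>2 * Q w" for t
  proof -
    have "Q (v + t *\<^sub>R w) = Q v + 2 * t * (c * inner w v - inner w (M *v v)) + t\<^sup>2 * Q w"
      by (simp add: Q_def matrix_vector_right_distrib matrix_vector_mult_scaleR_complex
          inner_add_left inner_add_right algebra_simps power2_eq_square sym[of v w] inner_commute[of v w])
    moreover have "Q v = 0" by (simp add: Q_def c_def vv)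
    moreover have "c * inner w v - inner w (M *v v) = inner w w"
      by (simp add: w_def inner_diff_right)
    ultimately show ?thesis by simp
  qed
  have "inner w w = 0"
  proof (rule ccontr)
    assume "inner w w \<noteq> 0"
    then have pos: "inner w w > 0" by (simp add: order_less_le)
    \<comment> \<open>The minimizer of the quadratic in t would be \<open>- inner w w / Q w\<close>.
      The added 1 avoids division by zero and still gives a negative value.\<close>
    define t where "t = - inner w w / (Q w + 1)"
    have "Q w + 1 > 0" using Q_nonneg[OF wW] by simp
    then have "2 * t * inner w w + t\<^sup>2 * Q w = - (inner w w)\<^sup>2 * (Q w + 2) / (Q w + 1)\<^sup>2"
      by (simp add: t_def power2_eq_square divide_simps) (simp add: algebra_simps)
    also have "\<dots> < 0" using pos \<open>Q w + 1 > 0\<close>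
      by (simp add: divide_neg_pos mult_neg_pos)
    finally show False
      using Q_expand[of t] Q_nonneg[of "v + t *\<^sub>R w"] vW wW W by (simp add: subspace_add subspace_scale)
  qed
  then have "M *v v = c *\<^sub>R v" by (simp add: w_def)
  moreover have "v \<noteq> 0" using vv by auto
  ultimately show ?thesis using that vW by blast
qed

text \<open>An invariant subspace of minimal dimension consists of joint eigenvectors.\<close>

lemma joint_eigenvector_in_subspace:
  fixes M :: "'j \<Rightarrow> complex ^ 'n ^ 'n"
  assumes sa: "\<And>j. mat_adj (M j) = M j" and comm: "\<And>i j. M i ** M j = M j ** M i"
    and W: "subspace W" and inv: "\<And>j w. w \<in> W \<Longrightarrow> M j *v w \<in> W"
    and nz: "u \<in> W" "u \<noteq> 0"
  obtains v c where "v \<in> W" "v \<noteq> 0" "\<And>j. M j *v v = c j *\<^sub>R v"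
proof -
  define good where "good W' \<longleftrightarrow> subspace W' \<and> W' \<subseteq> W \<and> (\<forall>j. \<forall>w\<in>W'. M j *v w \<in> W') \<and> (\<exists>u\<in>W'. u \<noteq> 0)" for W'
  have "good W" using assms by (auto simp: good_def)
  then obtain V where V: "good V" and min: "\<And>V'. good V' \<Longrightarrow> dim V \<le> dim V'"
    using ex_has_least_nat[of good W dim] by blast
  have "\<exists>c. \<forall>v\<in>V. M j *v v = c *\<^sub>R v" for j
  proof -
    obtain v c where vc: "v \<in> V" "v \<noteq> 0" "M j *v v = c *\<^sub>R v"
      using selfadjoint_eigenvector_in_subspace[OF sa[of j], of V] V unfolding good_def by metis
    \<comment> \<open>An eigenspace of one matrix is invariant under the others because they
      commute, so minimality forces it to be all of \<open>V\<close>.\<close>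
    let ?V' = "{v \<in> V. M j *v v = c *\<^sub>R v}"
    have "M j *v (M i *v w) = c *\<^sub>R (M i *v w)" if "M j *v w = c *\<^sub>R w" for i w
      using that by (metis comm matrix_vector_mul_assoc matrix_vector_mult_scaleR_complex)
    moreover have "subspace ?V'"
      using V unfolding good_def subspace_def
      by (auto simp: matrix_vector_right_distrib matrix_vector_mult_scaleR_complex algebra_simps)
    ultimately have "good ?V'" using V vc unfolding good_def by blast
    then have "?V' = V"
      using min[of ?V'] V by (intro subspace_dim_equal) (auto simp: good_def)
    then show ?thesis by blast
  qed
  then obtain c where "\<And>j v. v \<in> V \<Longrightarrow> M j *v v = c j *\<^sub>R v" by metis
  then show ?thesis using V that unfolding good_def by blast
qed

text \<open>A square matrix with a zero row has a nontrivial kernel. The rows at indices in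
  \<open>I\<close> are the conjugates of the given vectors, the remaining rows are zero.\<close>

lemma exists_nonzero_orthogonal:
  fixes e :: "'n \<Rightarrow> complex ^ 'n"
  assumes "I \<noteq> UNIV"
  obtains u where "u \<noteq> 0" "\<And>i. i \<in> I \<Longrightarrow> cinner (e i) u = 0"
proof -
  obtain i0 where i0: "i0 \<notin> I" using assms by auto
  define N :: "complex ^ 'n ^ 'n" where "N = (\<chi> i j. if i \<in> I then cnj (e i $ j) else 0)"
  have "\<nexists>B. B ** N = mat 1"
  proof
    assume "\<exists>B. B ** N = mat 1"
    then obtain B where "N ** B = mat 1" by (metis matrix_left_right_inverse)
    moreover have "(N ** B) $ i0 $ i0 = 0" by (simp add: N_def i0 matrix_matrix_mult_def)
    ultimately show False by (simp add: mat_def)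
  qed
  then obtain u where u: "N *v u = 0" "u \<noteq> 0" by (metis matrix_left_invertible_ker)
  have "cinner (e i) u = 0" if "i \<in> I" for i
  proof -
    have "(N *v u) $ i = cinner (e i) u" using that by (simp add: N_def matrix_vector_mult_def cinner_def)
    then show ?thesis using u by simp
  qed
  then show ?thesis using that u by blast
qed

text \<open>Orthonormal systems of joint eigenvectors are indexed by subsets of \<open>'n\<close>,
  and a largest such subset is taken. As long as an index is free, the orthogonal complement is
  nonzero and invariant and contains a further joint eigenvector. The resulting basis is already
  indexed by the matrix rows.\<close>

lemma joint_orthonormal_eigenbasis:
  fixes M :: "'j \<Rightarrow> complex ^ 'n ^ 'n"
  assumes sa: "\<And>j. mat_adj (M j) = M j" and comm: "\<And>i j. M i ** M j = M j ** M i"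
  obtains e :: "'n \<Rightarrow> complex ^ 'n" and c :: "'n \<Rightarrow> 'j \<Rightarrow> real"
    where "\<And>p q. cinner (e p) (e q) = (if p = q then 1 else 0)" "\<And>p j. M j *v e p = c p j *\<^sub>R e p"
proof -
  define good where "good I \<longleftrightarrow> (\<exists>e c. (\<forall>p\<in>I. \<forall>q\<in>I. cinner (e p) (e q) = (if p = q then 1 else 0)) \<and>
     (\<forall>p\<in>I. \<forall>j. M j *v e p = c p j *\<^sub>R e p))" for I :: "'n set"
  have "\<exists>I. good I \<and> (\<forall>J. good J \<longrightarrow> card J \<le> card I)"
    by (rule ex_has_greatest_nat[where k = "{}" and b = "Suc CARD('n)"])
      (auto simp: good_def less_Suc_eq_le card_mono)
  then obtain I where I: "good I" and max: "\<And>J. good J \<Longrightarrow> card J \<le> card I" by blast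
  have "I = UNIV"
  proof (rule ccontr)
    assume "I \<noteq> UNIV"
    obtain e c where on: "\<And>p q. p \<in> I \<Longrightarrow> q \<in> I \<Longrightarrow> cinner (e p) (e q) = (if p = q then 1 else 0)"
      and eig: "\<And>p j. p \<in> I \<Longrightarrow> M j *v e p = c p j *\<^sub>R e p"
      using I unfolding good_def by blast
    obtain u where u: "u \<noteq> 0" "\<And>i. i \<in> I \<Longrightarrow> cinner (e i) u = 0"
      using exists_nonzero_orthogonal[OF \<open>I \<noteq> UNIV\<close>] by blast
    let ?W = "{w. \<forall>i\<in>I. cinner (e i) w = 0}"
    have sub: "subspace ?W"
      by (auto simp: subspace_def cinner_add cinner_scaleR) (simp add: cinner_def)
    have inv: "M j *v w \<in> ?W" if "w \<in> ?W" for j w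
    proof safe
      fix i assume i: "i \<in> I"
      have "cinner (e i) (M j *v w) = cinner (c i j *\<^sub>R e i) w"
        using cinner_mat_adj[of "M j" "e i" w] eig[OF i] sa by simp
      also have "\<dots> = cnj (cinner w (c i j *\<^sub>R e i))" by (simp add: cinner_cnj)
      also have "\<dots> = c i j *\<^sub>R cinner (e i) w" by (simp add: cinner_scaleR cinner_cnj)
      finally show "cinner (e i) (M j *v w) = 0" using that i by simp
    qed
    obtain v d where v: "v \<in> ?W" "v \<noteq> 0" "\<And>j. M j *v v = d j *\<^sub>R v"
    proof -
      have "u \<in> ?W" using u by simp
      from joint_eigenvector_in_subspace[where M = M, OF sa comm sub inv this u(1)] show ?thesis
        using that by blast
    qed
    define v' where "v' = v /\<^sub>R norm v"
    have v'W: "cinner (e i) v' = 0" if "i \<in> I" for i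
      using that v by (simp add: v'_def cinner_scaleR)
    have v'W': "cinner v' (e i) = 0" if "i \<in> I" for i
      using v'W[OF that] by (metis cinner_cnj complex_cnj_zero)
    have v'1: "cinner v' v' = 1" using v by (simp add: cinner_self v'_def)
    obtain i0 where i0: "i0 \<notin> I" using \<open>I \<noteq> UNIV\<close> by auto
    have "good (insert i0 I)"
      unfolding good_def
    proof (intro exI conjI)
      show "\<forall>p\<in>insert i0 I. \<forall>q\<in>insert i0 I. cinner ((e(i0 := v')) p) ((e(i0 := v')) q) = (if p = q then 1 else 0)"
        using on v'W v'W' v'1 i0 by auto
      show "\<forall>p\<in>insert i0 I. \<forall>j. M j *v (e(i0 := v')) p = (c(i0 := d)) p j *\<^sub>R (e(i0 := v')) p"
        using eig v(3) i0 by (auto simp: v'_def matrix_vector_mult_scaleR_complex)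
    qed
    then show False using max[of "insert i0 I"] i0 by simp
  qed
  then show ?thesis using I that unfolding good_def by blast
qed

text \<open>The vector \<open>d p\<close> is a point of the joint spectrum, repeated according to
  multiplicity. A family is thereby reduced to a list of n points of Euclidean space, on which
  convex functions can be evaluated.\<close>

definition diagonalizes :: "complex ^ 'n ^ 'n \<Rightarrow> ('n \<Rightarrow> real ^ 'm) \<Rightarrow> (complex ^ 'n ^ 'n) ^ 'm \<Rightarrow> bool" where
  "diagonalizes U d A \<longleftrightarrow> unitary U \<and>
     (\<forall>j. A $ j = mat_adj U ** diag_mat (\<lambda>p. of_real (d p $ j)) ** U)"

proposition simultaneous_diagonalization:
  fixes A :: "(complex ^ 'n ^ 'n) ^ 'm"
  assumes "abelian_family mat_alg A"
  obtains U d where "diagonalizes U d A"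
proof -
  have sa: "mat_adj (A $ j) = A $ j" and comm: "A $ i ** A $ j = A $ j ** A $ i" for i j
    using assms by (auto simp: abelian_family_def)
  obtain e :: "'n \<Rightarrow> complex ^ 'n" and c where on: "\<And>p q. cinner (e p) (e q) = (if p = q then 1 else 0)"
    and eig: "\<And>p j. A $ j *v e p = c p j *\<^sub>R e p"
    using joint_orthonormal_eigenbasis[where M = "\<lambda>j. A $ j", OF sa comm] by blast
  \<comment> \<open>The rows are the conjugated eigenvectors, so the columns of
    \<open>mat_adj U\<close> are the eigenvectors themselves.\<close>
  define U :: "complex ^ 'n ^ 'n" where "U = (\<chi> p i. cnj (e p $ i))"
  have "U ** mat_adj U = mat 1"
    using on by (simp add: U_def matrix_matrix_mult_def mat_adj_def vec_eq_iff mat_def cinner_def)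
  then have U: "unitary U"
    by (simp add: unitary_elem_def matrix_left_right_inverse)
  define d :: "'n \<Rightarrow> real ^ 'm" where "d p = (\<chi> j. c p j)" for p
  have "A $ j ** mat_adj U = mat_adj U ** diag_mat (\<lambda>p. of_real (d p $ j))" for j
  proof -
    have "(A $ j ** mat_adj U) $ a $ p = (A $ j *v e p) $ a" for a p
      by (simp add: U_def matrix_matrix_mult_def matrix_vector_mult_def mat_adj_def)
    moreover have "(mat_adj U ** diag_mat (\<lambda>p. of_real (d p $ j))) $ a $ p = (c p j *\<^sub>R e p) $ a" for a p
      by (simp add: diag_mat_mult_right_nth U_def mat_adj_def d_def
          scaleR_conv_of_real[where 'a = complex] mult.commute)
    ultimately show ?thesis by (simp add: vec_eq_iff eig)
  qed
  then have "A $ j = mat_adj U ** diag_mat (\<lambda>p. of_real (d p $ j)) ** U" for j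
    using unitary_cancel[OF U] by metis
  then show ?thesis using U that unfolding diagonalizes_def by blast
qed

section \<open>Joint functional calculus in algebras of matrix-valued functions\<close>

lemma unital_cstar_subalgebra_cstar_gen: "unital_cstar_subalgebra \<AA> (cstar_gen \<AA> A)"
  unfolding cstar_gen_def
  by (rule hull_in) (auto simp: unital_cstar_subalgebra_def)

lemma generator_in_cstar_gen: "A $ j \<in> cstar_gen \<AA> A"
  unfolding cstar_gen_def by (rule hull_inc) simp

lemma cstar_gen_minimal:
  "unital_cstar_subalgebra \<AA> S \<Longrightarrow> (\<And>j. A $ j \<in> S) \<Longrightarrow> cstar_gen \<AA> A \<subseteq> S"
  unfolding cstar_gen_def by (rule hull_minimal) auto

lemma cstar_gen_closed:
  "unity \<AA> \<in> cstar_gen \<AA> A"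
  "a \<in> cstar_gen \<AA> A \<Longrightarrow> b \<in> cstar_gen \<AA> A \<Longrightarrow> a + b \<in> cstar_gen \<AA> A"
  "a \<in> cstar_gen \<AA> A \<Longrightarrow> cscale \<AA> c a \<in> cstar_gen \<AA> A"
  "a \<in> cstar_gen \<AA> A \<Longrightarrow> b \<in> cstar_gen \<AA> A \<Longrightarrow> mul \<AA> a b \<in> cstar_gen \<AA> A"
  "a \<in> cstar_gen \<AA> A \<Longrightarrow> star \<AA> a \<in> cstar_gen \<AA> A"
  "closed (cstar_gen \<AA> A)"
  using unital_cstar_subalgebra_cstar_gen[of \<AA> A] by (auto simp: unital_cstar_subalgebra_def)

definition diag_calc :: "complex ^ 'n ^ 'n \<Rightarrow> ('n \<Rightarrow> real ^ 'm) \<Rightarrow> (real ^ 'm \<Rightarrow> real) \<Rightarrow> complex ^ 'n ^ 'n" where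
  "diag_calc U d g = mat_adj U ** diag_mat (\<lambda>p. of_real (g (d p))) ** U"

lemma diag_calc_add: "diag_calc U d (\<lambda>y. g y + h y) = diag_calc U d g + diag_calc U d h"
  by (simp add: diag_calc_def diag_mat_add[symmetric] matrix_add_ldistrib matrix_add_rdistrib)

lemma diag_calc_mult:
  assumes "unitary U"
  shows "diag_calc U d (\<lambda>y. g y * h y) = diag_calc U d g ** diag_calc U d h"
  using unitary_cancel[OF assms]
  by (simp add: diag_calc_def diag_mat_mult[symmetric] matrix_mul_assoc)

lemma diag_calc_const:
  fixes U :: "complex ^ 'n ^ 'n"
  assumes "unitary U"
  shows "diag_calc U d (\<lambda>y. c) = mat_cscale (of_real c) (mat 1)"
proof -
  have "diag_mat (\<lambda>p. complex_of_real c) = mat_cscale (of_real c) (mat 1 :: complex ^ 'n ^ 'n)"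
    by (simp add: diag_mat_def mat_cscale_def mat_def vec_eq_iff)
  then show ?thesis
    using unitaryD[OF assms] by (simp add: diag_calc_def mat_cscale_mult_right mat_cscale_mult_left)
qed

lemma diag_calc_adj: "mat_adj (diag_calc U d g) = diag_calc U d g"
  by (simp add: diag_calc_def mat_adj_mult diag_mat_adj matrix_mul_assoc)

lemma norm_diag_calc_diff_le:
  assumes "unitary U" and "\<And>p. \<bar>g (d p) - h (d p)\<bar> \<le> e"
  shows "norm (diag_calc U d g - diag_calc U d h :: complex ^ 'n ^ 'n) \<le> real CARD('n) ^ 3 * e"
proof -
  have "diag_calc U d g = diag_calc U d h + diag_calc U d (\<lambda>y. g y - h y)"
    by (simp flip: diag_calc_add)
  then have "diag_calc U d g - diag_calc U d h = mat_adj U ** diag_mat (\<lambda>p. of_real (g (d p) - h (d p))) ** U"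
    by (simp add: diag_calc_def)
  also have "norm \<dots> \<le> real CARD('n) ^ 3 * e"
    by (rule norm_unitary_conj_diag_le[OF assms(1)]) (metis assms(2) norm_of_real)
  finally show ?thesis .
qed

lemma diagonalizes_unitary: "diagonalizes U d A \<Longrightarrow> unitary U"
  by (simp add: diagonalizes_def)

lemma diagonalizes_nth: "diagonalizes U d A \<Longrightarrow> A $ j = diag_calc U d (\<lambda>y. y $ j)"
  by (simp add: diagonalizes_def diag_calc_def)

lemma unitary_conj_diag_calc:
  assumes "unitary U"
  shows "U ** diag_calc U d g ** mat_adj U = diag_mat (\<lambda>p. of_real (g (d p)))"
  using unitary_cancel[OF assms] by (simp add: diag_calc_def matrix_mul_assoc unitaryD[OF assms])

text \<open>Each eigenvalue is a diagonal entry of the conjugated matrix, a double sum of n squared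
  terms bounded by the norm. Since the bound involves neither \<open>U\<close> nor \<open>p\<close>,
  a single ball contains the joint spectra of all fibres.\<close>

lemma diagonalizes_spectrum_le:
  fixes A :: "(complex ^ 'n ^ 'n) ^ 'm"
  assumes "diagonalizes U d A"
  shows "\<bar>d p $ j\<bar> \<le> (real CARD('n))\<^sup>2 * norm (A $ j)"
proof -
  have U: "unitary U" using assms by (rule diagonalizes_unitary)
  have "complex_of_real (d p $ j) = (U ** A $ j ** mat_adj U) $ p $ p"
    by (simp add: diagonalizes_nth[OF assms] unitary_conj_diag_calc[OF U] diag_mat_nth)
  also have "\<dots> = (\<Sum>b\<in>UNIV. \<Sum>a\<in>UNIV. U $ p $ a * A $ j $ a $ b * cnj (U $ p $ b))"
    by (simp add: matrix_matrix_mult_def mat_adj_def sum_distrib_right)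
  finally have "\<bar>d p $ j\<bar> = norm (\<Sum>b\<in>UNIV. \<Sum>a\<in>UNIV. U $ p $ a * A $ j $ a $ b * cnj (U $ p $ b))"
    by (metis norm_of_real)
  also have "\<dots> \<le> (\<Sum>b\<in>(UNIV::'n set). \<Sum>a\<in>(UNIV::'n set). norm (A $ j))"
  proof (intro sum_norm_le)
    fix a b
    have "norm (U $ p $ a * A $ j $ a $ b * cnj (U $ p $ b)) \<le> 1 * norm (A $ j) * 1"
      unfolding norm_mult complex_mod_cnj
      by (intro mult_mono unitary_entry_le[OF U] norm_entry_le) auto
    then show "norm (U $ p $ a * A $ j $ a $ b * cnj (U $ p $ b)) \<le> norm (A $ j)" by simp
  qed
  finally show ?thesis by (simp add: power2_eq_square)
qed

text \<open>\<open>ev i\<close> is evaluation at the point \<open>i\<close> of the underlying space.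
  \<open>ev_limit\<close> replaces any mention of continuity: a matrix-valued function of the point
  comes from the algebra as soon as it is a uniform limit of evaluated elements.
  \<open>ex_constant\<close> supplies the matrix units.\<close>

locale matrix_function_algebra =
  fixes \<AA> :: "'a::real_normed_vector star_alg" and ev :: "'i \<Rightarrow> 'a \<Rightarrow> complex ^ 'n ^ 'n"
  assumes linear_ev: "linear (ev i)"
    and norm_ev_le: "norm (ev i a) \<le> norm a"
    and ev_mul: "ev i (mul \<AA> a b) = ev i a ** ev i b"
    and ev_unity: "ev i (unity \<AA>) = mat 1"
    and ev_star: "ev i (star \<AA> a) = mat_adj (ev i a)"
    and ev_cscale: "ev i (cscale \<AA> c a) = mat_cscale c (ev i a)"
    and ev_eqI: "(\<And>i. ev i a = ev i b) \<Longrightarrow> a = b"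
    and ev_limit: "uniform_limit UNIV (\<lambda>k i. ev i (F k)) G sequentially \<Longrightarrow>
      \<exists>a. F \<longlonglongrightarrow> a \<and> (\<forall>i. ev i a = G i)"
    and ex_constant: "\<exists>a. \<forall>i. ev i a = M"
begin

lemma ev_add: "ev i (a + b) = ev i a + ev i b"
  using linear_ev by (simp add: linear_add)

lemma ev_zero: "ev i 0 = 0"
  using linear_ev by (simp add: linear_0)

lemmas ev_simps = ev_add ev_zero ev_mul ev_unity ev_star ev_cscale

context
  notes ev_simps [simp]
begin

lemma ev_sum: "ev i (sum f S) = (\<Sum>s\<in>S. ev i (f s))"
  using linear_ev by (simp add: linear_sum)

lemma bounded_linear_ev: "bounded_linear (ev i)"
  using linear_ev[of i] norm_ev_le
  by (intro bounded_linear_intro[of _ 1]) (simp_all add: linear_cmul)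

lemma continuous_on_ev: "continuous_on S f \<Longrightarrow> continuous_on S (\<lambda>x. ev i (f x))"
  by (rule bounded_linear.continuous_on[OF bounded_linear_ev])

text \<open>The unitaries may vary arbitrarily from fibre to fibre: the set is an intersection over
  fibres of preimages under continuous maps, and every algebraic condition is checked
  fibrewise.\<close>

lemma unital_cstar_subalgebra_diagonalized:
  assumes U: "\<And>i. unitary (U i)"
  shows "unital_cstar_subalgebra \<AA> {T. \<forall>i. U i ** ev i T ** mat_adj (U i) \<in> diag_mats}"
proof -
  have "closed {T. \<forall>i. U i ** ev i T ** mat_adj (U i) \<in> diag_mats}"
  proof -
    have eq: "{T. \<forall>i. U i ** ev i T ** mat_adj (U i) \<in> diag_mats}
        = (\<Inter>i. (\<lambda>T. U i ** ev i T ** mat_adj (U i)) -` diag_mats)" by auto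
    have "continuous_on UNIV (\<lambda>T. U i ** ev i T ** mat_adj (U i))" for i
      unfolding matrix_matrix_mult_def by (intro continuous_intros continuous_on_ev)
    then show ?thesis
      unfolding eq by (intro closed_INT ballI closed_vimage[OF closed_diag_mats])
  qed
  moreover have "U i ** mat_adj M ** mat_adj (U i) = mat_adj (U i ** M ** mat_adj (U i))" for i M
    by (simp add: mat_adj_mult matrix_mul_assoc)
  ultimately show ?thesis
    unfolding unital_cstar_subalgebra_def
    by (simp add: matrix_add_ldistrib matrix_add_rdistrib mat_cscale_mult_left mat_cscale_mult_right
        diag_mats_closed unitaryD[OF U] unitary_conj_mult[OF U])
qed

lemma cstar_gen_diagonalized:
  assumes "\<And>i. unitary (U i)" and "\<And>i j. U i ** ev i (A $ j) ** mat_adj (U i) \<in> diag_mats"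
    and "T \<in> cstar_gen \<AA> A"
  shows "U i ** ev i T ** mat_adj (U i) \<in> diag_mats"
  using cstar_gen_minimal[OF unital_cstar_subalgebra_diagonalized[of U, OF assms(1)], of A] assms(2,3)
  by auto

context
  fixes A :: "'a ^ 'm" and U :: "'i \<Rightarrow> complex ^ 'n ^ 'n" and d :: "'i \<Rightarrow> 'n \<Rightarrow> real ^ 'm"
  assumes diag: "\<And>i. diagonalizes (U i) (d i) (\<chi> j. ev i (A $ j))"
begin

lemma unitary_U: "unitary (U i)"
  using diag by (rule diagonalizes_unitary)

lemma ev_generator: "ev i (A $ j) = diag_calc (U i) (d i) (\<lambda>y. y $ j)"
  using diagonalizes_nth[OF diag, of i j] by simp

lemma polynomial_calc_in_cstar_gen:
  assumes "real_polynomial_function g"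
  shows "\<exists>F\<in>cstar_gen \<AA> A. \<forall>i. ev i F = diag_calc (U i) (d i) g"
  using assms
proof induction
  case (const c)
  show ?case
    by (rule bexI[of _ "cscale \<AA> (of_real c) (unity \<AA>)"])
      (simp_all add: cstar_gen_closed diag_calc_const unitary_U)
next
  case (linear h)
  define F where "F S = (\<Sum>j\<in>S. cscale \<AA> (of_real (h (axis j 1))) (A $ j))" for S
  have "F S \<in> cstar_gen \<AA> A" if "finite S" for S
    using that
  proof induction
    case empty
    \<comment> \<open>The closure properties of a subalgebra do not list zero; it is the zero
      multiple of the unit.\<close>
    have "cscale \<AA> 0 (unity \<AA>) = 0"
      by (rule ev_eqI) (simp add: mat_cscale_def vec_eq_iff)
    then show ?case using cstar_gen_closed(3)[OF cstar_gen_closed(1), of \<AA> 0] by (simp add: F_def)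
  qed (simp add: F_def cstar_gen_closed generator_in_cstar_gen)
  moreover have "ev i (F UNIV) = diag_calc (U i) (d i) h" for i
  proof -
    have h_expand: "h y = (\<Sum>j\<in>UNIV. h (axis j 1) * y $ j)" for y
    proof -
      have "h y = h (\<Sum>j\<in>UNIV. y $ j *\<^sub>R axis j 1)"
        by (simp add: basis_expansion[of y, unfolded scalar_mult_eq_scaleR])
      also have "\<dots> = (\<Sum>j\<in>UNIV. h (axis j 1) * y $ j)"
        using bounded_linear.linear[OF linear] by (simp add: linear_sum linear_cmul mult.commute)
      finally show ?thesis .
    qed
    have h: "diag_calc (U i) (d i) h = diag_calc (U i) (d i) (\<lambda>y. \<Sum>j\<in>UNIV. h (axis j 1) * y $ j)"
      by (rule arg_cong[OF ext[of h, OF h_expand]])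
    have "diag_calc (U i) (d i) (\<lambda>y. \<Sum>j\<in>S. h (axis j 1) * y $ j) = ev i (F S)" if "finite S" for S
      using that
    proof induction
      case empty
      show ?case
        using diag_calc_const[OF unitary_U, of i "d i" 0] by (simp add: F_def mat_cscale_def vec_eq_iff)
    next
      case (insert j S)
      then show ?case
        by (simp add: F_def diag_calc_add diag_calc_mult[OF unitary_U] diag_calc_const[OF unitary_U]
            ev_generator mat_cscale_mult_left)
    qed
    then show ?thesis using h by simp
  qed
  ultimately show ?case by (metis finite)
next
  case (add g h)
  then obtain F G where "F \<in> cstar_gen \<AA> A" "\<forall>i. ev i F = diag_calc (U i) (d i) g"
    and "G \<in> cstar_gen \<AA> A" "\<forall>i. ev i G = diag_calc (U i) (d i) h" by blast
  then show ?case
    by (intro bexI[of _ "F + G"]) (simp_all add: cstar_gen_closed diag_calc_add)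
next
  case (mult g h)
  then obtain F G where "F \<in> cstar_gen \<AA> A" "\<forall>i. ev i F = diag_calc (U i) (d i) g"
    and "G \<in> cstar_gen \<AA> A" "\<forall>i. ev i G = diag_calc (U i) (d i) h" by blast
  then show ?case
    by (intro bexI[of _ "mul \<AA> F G"]) (simp_all add: cstar_gen_closed diag_calc_mult[OF unitary_U])
qed

text \<open>On a ball containing the joint spectra of all fibres, \<open>g\<close> is a uniform
  limit of polynomials. The fibre-independent factor n cubed carries this over to a uniform limit of
  matrix functions, whose limit lies in the closed generated algebra although \<open>U\<close> and
  \<open>d\<close> carry no continuity.\<close>

lemma calc_in_cstar_gen:
  assumes g: "continuous_on UNIV g"
  shows "\<exists>F\<in>cstar_gen \<AA> A. \<forall>i. ev i F = diag_calc (U i) (d i) g"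
proof -
  define R where "R = (\<Sum>j\<in>UNIV. (real CARD('n))\<^sup>2 * norm (A $ j))"
  have spec: "d i p \<in> cball 0 R" for i p
  proof -
    have "norm (d i p) \<le> (\<Sum>j\<in>UNIV. norm (d i p $ j))" by (rule norm_vec_le_sum)
    also have "\<dots> \<le> R"
      unfolding R_def
    proof (rule sum_mono)
      fix j
      have "\<bar>d i p $ j\<bar> \<le> (real CARD('n))\<^sup>2 * norm (ev i (A $ j))"
        using diagonalizes_spectrum_le[OF diag, of i p j] by simp
      also have "\<dots> \<le> (real CARD('n))\<^sup>2 * norm (A $ j)"
        by (intro mult_left_mono norm_ev_le) simp
      finally show "norm (d i p $ j) \<le> (real CARD('n))\<^sup>2 * norm (A $ j)" by simp
    qed
    finally show ?thesis by simp
  qed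
  have "\<exists>P. real_polynomial_function P \<and> (\<forall>y\<in>cball 0 R. \<bar>g y - P y\<bar> < inverse (real (Suc k)))" for k
  proof -
    have "continuous_on (cball 0 R) g" using g continuous_on_subset by blast
    then obtain P where "real_polynomial_function P" "\<And>y. y \<in> cball 0 R \<Longrightarrow> \<bar>g y - P y\<bar> < inverse (real (Suc k))"
      using Stone_Weierstrass_real_polynomial_function[of "cball 0 R" g "inverse (real (Suc k))"] by auto
    then show ?thesis by blast
  qed
  then obtain P where P: "\<And>k. real_polynomial_function (P k)"
    and approx: "\<And>k y. y \<in> cball 0 R \<Longrightarrow> \<bar>g y - P k y\<bar> < inverse (real (Suc k))" by metis
  obtain F where F: "\<And>k. F k \<in> cstar_gen \<AA> A" "\<And>k i. ev i (F k) = diag_calc (U i) (d i) (P k)"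
    using polynomial_calc_in_cstar_gen[OF P] by metis
  have "uniform_limit UNIV (\<lambda>k i. ev i (F k)) (\<lambda>i. diag_calc (U i) (d i) g) sequentially"
  proof (rule uniform_limitI)
    fix e :: real assume "e > 0"
    have "(\<lambda>k. real CARD('n) ^ 3 * inverse (real (Suc k))) \<longlonglongrightarrow> 0"
      by (rule tendsto_mult_right_zero[OF LIMSEQ_inverse_real_of_nat])
    from order_tendstoD(2)[OF this \<open>e > 0\<close>]
    show "\<forall>\<^sub>F k in sequentially. \<forall>i\<in>UNIV. dist (ev i (F k)) (diag_calc (U i) (d i) g) < e"
    proof (rule eventually_mono, intro ballI)
      fix k i
      assume "real CARD('n) ^ 3 * inverse (real (Suc k)) < e"
      moreover have "norm (diag_calc (U i) (d i) g - diag_calc (U i) (d i) (P k))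
          \<le> real CARD('n) ^ 3 * inverse (real (Suc k))"
        by (intro norm_diag_calc_diff_le unitary_U less_imp_le approx spec)
      ultimately show "dist (ev i (F k)) (diag_calc (U i) (d i) g) < e"
        by (simp add: F dist_norm norm_minus_commute)
    qed
  qed
  then obtain a where a: "F \<longlonglongrightarrow> a" "\<forall>i. ev i a = diag_calc (U i) (d i) g"
    using ev_limit by blast
  have "a \<in> cstar_gen \<AA> A"
    using closed_sequentially[OF cstar_gen_closed(6) _ a(1)] F(1) by blast
  then show ?thesis using a by blast
qed

text \<open>
  A character turns the calculus into a ring homomorphism from the continuous functions on the
  Euclidean space into the reals. Such a homomorphism is a point evaluation: if it maps \<open>g\<close> to
  \<open>\<theta>\<close> and the coordinates to \<open>a\<close>, then it kills \<open>(g - \<theta>)\<^sup>2 + \<Sum>\<^sub>j (y\<^sub>j - a\<^sub>j)\<^sup>2\<close>, which therefore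
  is not invertible, that is, has a zero.
\<close>

lemma character_calc:
  assumes \<phi>: "character_on \<AA> (cstar_gen \<AA> A) \<phi>" and g: "continuous_on UNIV g"
    and F: "F \<in> cstar_gen \<AA> A" "\<And>i. ev i F = diag_calc (U i) (d i) g"
  shows "\<phi> F = of_real (g (\<chi> j. Re (\<phi> (A $ j))))"
proof -
  let ?C = "cstar_gen \<AA> A"
  define H where "H h = (SOME F. F \<in> ?C \<and> (\<forall>i. ev i F = diag_calc (U i) (d i) h))" for h
  have H: "H h \<in> ?C" "ev i (H h) = diag_calc (U i) (d i) h" if "continuous_on UNIV h" for h i
    using someI_ex[of "\<lambda>F. F \<in> ?C \<and> (\<forall>i. ev i F = diag_calc (U i) (d i) h)"]
      calc_in_cstar_gen[OF that] unfolding H_def by blast+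
  have \<phi>_hom: "\<phi> (unity \<AA>) = 1" "\<And>a b. a \<in> ?C \<Longrightarrow> b \<in> ?C \<Longrightarrow> \<phi> (a + b) = \<phi> a + \<phi> b"
    "\<And>a c. a \<in> ?C \<Longrightarrow> \<phi> (cscale \<AA> c a) = c * \<phi> a"
    "\<And>a b. a \<in> ?C \<Longrightarrow> b \<in> ?C \<Longrightarrow> \<phi> (mul \<AA> a b) = \<phi> a * \<phi> b"
    "\<And>a. a \<in> ?C \<Longrightarrow> \<phi> (star \<AA> a) = cnj (\<phi> a)"
    using \<phi> by (auto simp: character_on_def)
  define \<psi> where "\<psi> h = Re (\<phi> (H h))" for h
  have \<psi>: "\<phi> (H h) = of_real (\<psi> h)" if "continuous_on UNIV h" for h
  proof -
    have "star \<AA> (H h) = H h" by (rule ev_eqI) (simp add: H that diag_calc_adj)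
    then have "cnj (\<phi> (H h)) = \<phi> (H h)" using \<phi>_hom(5)[OF H(1)[OF that]] by simp
    then show ?thesis by (simp add: \<psi>_def Reals_cnj_iff)
  qed
  have \<psi>_eq: "\<phi> F = of_real (\<psi> h)"
    if "continuous_on UNIV h" "\<And>i. ev i F = diag_calc (U i) (d i) h" for F h
  proof -
    have "F = H h" by (rule ev_eqI) (simp add: H that)
    then show ?thesis using \<psi>[OF that(1)] by simp
  qed
  have \<psi>_add: "\<psi> (\<lambda>y. h y + k y) = \<psi> h + \<psi> k"
    if h: "continuous_on UNIV h" and k: "continuous_on UNIV k" for h k
  proof -
    have "\<phi> (H h + H k) = of_real (\<psi> (\<lambda>y. h y + k y))"
      by (rule \<psi>_eq) (simp_all add: H h k diag_calc_add continuous_on_add)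
    then show ?thesis
      unfolding \<phi>_hom(2)[OF H(1)[OF h] H(1)[OF k]] \<psi>[OF h] \<psi>[OF k] by (metis of_real_add of_real_eq_iff)
  qed
  have \<psi>_mult: "\<psi> (\<lambda>y. h y * k y) = \<psi> h * \<psi> k"
    if h: "continuous_on UNIV h" and k: "continuous_on UNIV k" for h k
  proof -
    have "\<phi> (mul \<AA> (H h) (H k)) = of_real (\<psi> (\<lambda>y. h y * k y))"
      by (rule \<psi>_eq) (simp_all add: H h k diag_calc_mult[OF unitary_U] continuous_on_mult)
    then show ?thesis
      unfolding \<phi>_hom(4)[OF H(1)[OF h] H(1)[OF k]] \<psi>[OF h] \<psi>[OF k] by (metis of_real_mult of_real_eq_iff)
  qed
  have \<psi>_const: "\<psi> (\<lambda>y. c) = c" for c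
  proof -
    have "\<phi> (cscale \<AA> (of_real c) (unity \<AA>)) = of_real (\<psi> (\<lambda>y. c))"
      by (rule \<psi>_eq) (simp_all add: diag_calc_const[OF unitary_U])
    then show ?thesis by (simp add: \<phi>_hom(1) \<phi>_hom(3)[OF cstar_gen_closed(1)])
  qed
  define a :: "real ^ 'm" where "a = (\<chi> j. Re (\<phi> (A $ j)))"
  have \<psi>_coord: "\<psi> (\<lambda>y. y $ j) = a $ j" for j
  proof -
    have "\<phi> (A $ j) = of_real (\<psi> (\<lambda>y. y $ j))"
      by (rule \<psi>_eq) (simp_all add: ev_generator continuous_on_component)
    then show ?thesis by (simp add: a_def)
  qed
  define \<theta> where "\<theta> = \<psi> g"
  have \<psi>_sq: "\<psi> (\<lambda>y. (h y - c)\<^sup>2) = 0" if "continuous_on UNIV h" "\<psi> h = c" for h c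
  proof -
    have c: "continuous_on UNIV (\<lambda>y. h y + - c)" by (intro continuous_intros that)
    have "\<psi> (\<lambda>y. h y + - c) = 0"
      using \<psi>_add[OF that(1) continuous_on_const, of "- c"] by (simp only: \<psi>_const that(2) add.right_inverse)
    then show ?thesis using \<psi>_mult[OF c c] by (simp add: power2_eq_square)
  qed
  have sum_c: "continuous_on UNIV (\<lambda>y. \<Sum>j\<in>S. (y $ j - a $ j)\<^sup>2)" for S
    by (intro continuous_intros)
  have \<psi>_sum: "\<psi> (\<lambda>y. \<Sum>j\<in>S. (y $ j - a $ j)\<^sup>2) = 0" if "finite S" for S
    using that
  proof induction
    case (insert j S)
    have "\<psi> (\<lambda>y. (y $ j - a $ j)\<^sup>2 + (\<Sum>j\<in>S. (y $ j - a $ j)\<^sup>2)) = 0"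
      by (subst \<psi>_add) (use sum_c insert in \<open>auto intro!: continuous_intros \<psi>_sq simp: \<psi>_coord\<close>)
    then show ?case using insert by simp
  qed (simp add: \<psi>_const)
  define w where "w y = (g y - \<theta>)\<^sup>2 + (\<Sum>j\<in>UNIV. (y $ j - a $ j)\<^sup>2)" for y
  have w_cont: "continuous_on UNIV w"
    unfolding w_def by (intro continuous_intros g)
  have \<psi>_w: "\<psi> w = 0"
  proof -
    have "\<psi> (\<lambda>y. (g y - \<theta>)\<^sup>2 + (\<Sum>j\<in>UNIV. (y $ j - a $ j)\<^sup>2)) = 0"
      by (subst \<psi>_add) (auto intro!: continuous_intros g \<psi>_sq simp: \<psi>_sum \<theta>_def)
    then show ?thesis by (simp add: w_def[abs_def])
  qed
  have "\<exists>y. w y = 0"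
  proof (rule ccontr)
    assume nz: "\<nexists>y. w y = 0"
    have "continuous_on UNIV (\<lambda>y. inverse (w y))"
      using nz by (intro continuous_intros w_cont) auto
    from \<psi>_mult[OF w_cont this] have "\<psi> (\<lambda>y. w y * inverse (w y)) = 0" by (simp add: \<psi>_w)
    moreover have "(\<lambda>y. w y * inverse (w y)) = (\<lambda>y. 1)" using nz by auto
    ultimately show False using \<psi>_const[of 1] by simp
  qed
  then obtain y where "w y = 0" ..
  then have "g y = \<theta>" "y = a"
    unfolding w_def by (auto simp: add_nonneg_eq_0_iff sum_nonneg sum_nonneg_eq_0_iff vec_eq_iff)
  then show ?thesis using \<psi>_eq[OF g F(2)] by (simp add: \<theta>_def a_def)
qed

text \<open>Conjugation by \<open>U i\<close> makes the whole generated algebra diagonal on this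
  fibre, and a diagonal entry is multiplicative on diagonal matrices.\<close>

lemma diagonal_entry_character:
  "character_on \<AA> (cstar_gen \<AA> A) (\<lambda>T. (U i ** ev i T ** mat_adj (U i)) $ p $ p)"
proof -
  have "U i ** ev i (A $ j) ** mat_adj (U i) \<in> diag_mats" for i j
    by (simp add: ev_generator unitary_conj_diag_calc[OF unitary_U])
  then have "U i ** ev i T ** mat_adj (U i) \<in> diag_mats" if "T \<in> cstar_gen \<AA> A" for T
    using cstar_gen_diagonalized[of U, OF unitary_U _ that] by blast
  moreover have "U i ** mat_adj M ** mat_adj (U i) = mat_adj (U i ** M ** mat_adj (U i))" for M
    by (simp add: mat_adj_mult matrix_mul_assoc)
  moreover have "(mat 1 :: complex ^ 'n ^ 'n) $ p $ p = 1"
    by (simp add: mat_def)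
  moreover have "mat_adj M $ p $ p = cnj (M $ p $ p)" "mat_cscale c M $ p $ p = c * M $ p $ p"
    for c and M :: "complex ^ 'n ^ 'n"
    by (simp_all add: mat_adj_def mat_cscale_def)
  ultimately show ?thesis
    unfolding character_on_def
    by (simp add: unitaryD[OF unitary_U] matrix_add_ldistrib matrix_add_rdistrib
        mat_cscale_mult_left mat_cscale_mult_right unitary_conj_mult[OF unitary_U] diag_mats_mult_nth)
qed

text \<open>Existence asks for the right value at every character, which is
  \<open>character_calc\<close>. For uniqueness the diagonal entries over all fibres suffice: an
  element of the generated algebra is diagonal after conjugation, so these entries determine it on
  every fibre.\<close>

lemma ev_joint_calc_aux:
  assumes g: "continuous_on UNIV g"
  shows "ev i (joint_calc \<AA> g A) = diag_calc (U i) (d i) g"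
proof -
  obtain F where F: "F \<in> cstar_gen \<AA> A" "\<And>i. ev i F = diag_calc (U i) (d i) g"
    using calc_in_cstar_gen[OF g] by blast
  have "joint_calc \<AA> g A = F"
    unfolding joint_calc_def
  proof (rule the_equality)
    fix T
    assume T: "T \<in> cstar_gen \<AA> A \<and> (\<forall>\<phi>. character_on \<AA> (cstar_gen \<AA> A) \<phi> \<longrightarrow>
        \<phi> T = of_real (g (\<chi> j. Re (\<phi> (A $ j)))))"
    show "T = F"
    proof (rule ev_eqI)
      fix i
      let ?D = "\<lambda>T. U i ** ev i T ** mat_adj (U i)"
      have "?D T $ p $ p = ?D F $ p $ p" for p
      proof -
        let ?y = "\<chi> j. Re (?D (A $ j) $ p $ p)"
        have "?D T $ p $ p = of_real (g ?y)"
          using T diagonal_entry_character[of i p] by blast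
        moreover have "?D F $ p $ p = of_real (g ?y)"
          by (rule character_calc[OF diagonal_entry_character g F])
        ultimately show ?thesis by simp
      qed
      moreover have "?D S \<in> diag_mats" if "S \<in> cstar_gen \<AA> A" for S
        by (rule cstar_gen_diagonalized[of U, OF unitary_U _ that])
          (simp add: ev_generator unitary_conj_diag_calc[OF unitary_U])
      ultimately have "?D T = ?D F" using diag_mats_eq[of "?D T"] diag_mats_eq[of "?D F"] T F(1) by simp
      then have "mat_adj (U i) ** ?D T ** U i = mat_adj (U i) ** ?D F ** U i" by simp
      then show "ev i T = ev i F"
        by (simp add: matrix_mul_assoc unitaryD[OF unitary_U] unitary_cancel[OF unitary_U])
    qed
  qed (use F character_calc[OF _ g] in auto)
  then show ?thesis by (simp add: F)
qed

end

lemma abelian_family_ev: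
  "abelian_family \<AA> A \<Longrightarrow> abelian_family mat_alg (\<chi> j. ev i (A $ j))"
  by (simp add: abelian_family_def flip: ev_mul ev_star)

proposition ev_joint_calc:
  assumes "abelian_family \<AA> A" and "diagonalizes V c (\<chi> j. ev i (A $ j))" and "continuous_on UNIV g"
  shows "ev i (joint_calc \<AA> g A) = diag_calc V c g"
proof -
  have "\<forall>k. \<exists>U d. diagonalizes U d (\<chi> j. ev k (A $ j))"
    using simultaneous_diagonalization[OF abelian_family_ev[OF assms(1)]] by metis
  then obtain U d where "\<And>k. diagonalizes (U k) (d k) (\<chi> j. ev k (A $ j))" by metis
  \<comment> \<open>The fibrewise formula presupposes diagonalizations of all fibres. Those away
    from \<open>i\<close> are arbitrary choices, and the one at \<open>i\<close> is overwritten by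
    the given one.\<close>
  then have "diagonalizes ((U(i := V)) k) ((d(i := c)) k) (\<chi> j. ev k (A $ j))" for k
    using assms(2) by simp
  from ev_joint_calc_aux[of "U(i := V)" "d(i := c)", OF this assms(3), of i] show ?thesis by simp
qed

section \<open>Tracial states\<close>

text \<open>
  Averaging over the matrix units, \<open>n \<tau>(a) = \<tau>(\<Sum>\<^sub>p\<^sub>q e\<^sub>p\<^sub>q a e\<^sub>q\<^sub>p)\<close>, and the sum is the
  pointwise trace of \<open>a\<close> times the unit.
\<close>

lemma tracial_state_eq_if_trace_eq:
  assumes \<tau>: "tracial_state \<AA> \<tau>" and eq: "\<And>i. norm_trace (ev i a) = norm_trace (ev i b)"
  shows "\<tau> a = \<tau> b"
proof -
  have "\<forall>p q. \<exists>a. \<forall>i. ev i a = matrix_unit p q"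
    by (intro allI ex_constant)
  then obtain E where E: "\<And>i p q. ev i (E p q) = matrix_unit p q"
    by metis
  have add: "\<tau> (x + y) = \<tau> x + \<tau> y" and tracial: "\<tau> (mul \<AA> x y) = \<tau> (mul \<AA> y x)" for x y
    using \<tau> by (auto simp: tracial_state_def)
  have zero: "\<tau> 0 = 0" using add[of 0 0] by simp
  have \<tau>_sum: "\<tau> (sum f S) = (\<Sum>s\<in>S. \<tau> (f s))" for f :: "'s \<Rightarrow> 'a" and S
    by (induction S rule: infinite_finite_induct) (simp_all add: zero add)
  define av where "av x = (\<Sum>p\<in>UNIV. \<Sum>q\<in>UNIV. mul \<AA> (mul \<AA> (E p q) x) (E q p))" for x
  have \<tau>_av: "\<tau> (av x) = of_nat CARD('n) * \<tau> x" for x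
  proof -
    have "\<tau> (mul \<AA> (mul \<AA> (E p q) x) (E q p)) = \<tau> (mul \<AA> (E q q) x)" for p q
    proof -
      have "\<tau> (mul \<AA> (mul \<AA> (E p q) x) (E q p)) = \<tau> (mul \<AA> (E q p) (mul \<AA> (E p q) x))"
        by (rule tracial)
      also have "mul \<AA> (E q p) (mul \<AA> (E p q) x) = mul \<AA> (E q q) x"
        by (rule ev_eqI) (simp add: E matrix_mul_assoc matrix_unit_mult)
      finally show ?thesis .
    qed
    moreover have "(\<Sum>q\<in>UNIV. \<tau> (mul \<AA> (E q q) x)) = \<tau> x"
    proof -
      have "(\<Sum>q\<in>UNIV. mul \<AA> (E q q) x) = x"
        by (rule ev_eqI) (simp add: ev_sum E sum_matrix_unit flip: matrix_mult_sum_left)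
      then show ?thesis by (simp flip: \<tau>_sum)
    qed
    ultimately show ?thesis by (simp add: av_def \<tau>_sum)
  qed
  have "av a = av b"
  proof (rule ev_eqI)
    fix i
    have "trace (ev i a) = trace (ev i b)" using eq[of i] by (simp add: norm_trace_def)
    then show "ev i (av a) = ev i (av b)"
      by (simp add: av_def ev_sum E sum_matrix_unit_conj)
  qed
  then show ?thesis using \<tau>_av[of a] \<tau>_av[of b] by simp
qed

lemma tracial_state_ev:
  assumes "tracial_state mat_alg \<tau>"
  shows "tracial_state \<AA> (\<lambda>a. \<tau> (ev i a))"
  using assms
  unfolding tracial_state_def ev_add ev_mul ev_star ev_cscale ev_unity mat_alg_simps by blast

end

end

section \<open>Continuous square roots of Gram matrices\<close>

text \<open>The Taylor coefficients at 0 of sqrt(1 - t).\<close>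

definition sqrt_coeff :: "nat \<Rightarrow> real" where
  "sqrt_coeff n = (1/2 gchoose n) * (- 1) ^ n"

text \<open>Dividing sqrt(1 - t) by 1 - t turns coefficients into partial sums, and the quotient is
  the binomial series of (1 - t) to the power -1/2.\<close>

lemma sqrt_coeff_partial_sums: "(\<Sum>k\<le>m. sqrt_coeff k) = (- 1) ^ m * (- 1/2 gchoose m)"
  unfolding sqrt_coeff_def gbinomial_sum_lower_neg by simp

lemma neg_half_gbinomial_nonneg: "(- 1) ^ m * (- 1/2 gchoose m) \<ge> (0::real)"
proof (induction m)
  case (Suc m)
  have "(- 1/2 gchoose Suc m) = (- 1/2 - real m) / real (Suc m) * (- 1/2 gchoose m)"
    using gbinomial_mult_1[of "- 1/2 :: real" m] by (simp add: field_simps)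
  then have "(- 1) ^ Suc m * (- 1/2 gchoose Suc m)
      = (- 1) ^ Suc m * ((- 1/2 - real m) / real (Suc m) * (- 1/2 gchoose m))" by (simp only:)
  also have "\<dots> = (1/2 + real m) / real (Suc m) * ((- 1) ^ m * (- 1/2 gchoose m))"
    by (simp add: field_simps)
  also have "\<dots> \<ge> 0" by (intro mult_nonneg_nonneg Suc.IH) auto
  finally show ?case .
qed simp

lemma sqrt_coeff_Suc_nonpos: "sqrt_coeff (Suc n) \<le> 0"
proof -
  have "sqrt_coeff (Suc n) = - (1/2) / real (Suc n) * ((- 1) ^ n * (- 1/2 gchoose n))"
    using gbinomial_absorption[of n "1/2 :: real"]
    by (simp add: sqrt_coeff_def field_simps)
  also have "\<dots> \<le> 0" using neg_half_gbinomial_nonneg[of n] by (intro mult_nonpos_nonneg) auto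
  finally show ?thesis .
qed

text \<open>All coefficients after the first are nonpositive, so the sum of their absolute values is
  1 minus a partial sum of the series, and partial sums are nonnegative. This is absolute
  convergence on the closed unit disc, which contractions of norm exactly 1 require.\<close>

lemma summable_abs_sqrt_coeff: "summable (\<lambda>n. \<bar>sqrt_coeff n\<bar>)"
proof -
  have "summable (\<lambda>n. \<bar>sqrt_coeff (Suc n)\<bar>)"
  proof (rule summableI_nonneg_bounded)
    fix n
    have "(\<Sum>i<n. \<bar>sqrt_coeff (Suc i)\<bar>) = 1 - (\<Sum>k\<le>n. sqrt_coeff k)"
      using sqrt_coeff_Suc_nonpos by (induction n) (simp_all add: sqrt_coeff_def)
    also have "\<dots> \<le> 1"
      unfolding sqrt_coeff_partial_sums using neg_half_gbinomial_nonneg[of n] by simp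
    finally show "(\<Sum>i<n. \<bar>sqrt_coeff (Suc i)\<bar>) \<le> 1" .
  qed simp
  then show ?thesis by (subst summable_Suc_iff[symmetric])
qed

text \<open>The square of the series is 1 - t: Vandermonde's identity for 1/2 + 1/2 = 1 leaves the
  coefficients of a polynomial of degree one.\<close>

lemma sqrt_coeff_convolution:
  "(\<Sum>m\<le>N. sqrt_coeff m * sqrt_coeff (N - m)) = (if N = 0 then 1 else if N = 1 then - 1 else 0)"
proof -
  have "sqrt_coeff m * sqrt_coeff (N - m) = (- 1) ^ N * ((1/2 gchoose m) * (1/2 gchoose (N - m)))"
    if "m \<le> N" for m
  proof -
    have "(- 1 :: real) ^ N = (- 1) ^ m * (- 1) ^ (N - m)"
      using that by (simp flip: power_add)
    then show ?thesis by (simp add: sqrt_coeff_def)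
  qed
  then have "(\<Sum>m\<le>N. sqrt_coeff m * sqrt_coeff (N - m))
      = (- 1) ^ N * (\<Sum>m\<in>{0..N}. (1/2 gchoose m) * (1/2 gchoose (N - m)))"
    by (simp add: sum_distrib_left atLeast0AtMost)
  also have "\<dots> = (- 1) ^ N * (1 gchoose N)"
    unfolding gbinomial_Vandermonde by simp
  also have "(1 gchoose N :: real) = of_nat (1 choose N)"
    by (simp add: binomial_gbinomial)
  also have "(- 1) ^ N * real (1 choose N) = (if N = 0 then 1 else if N = 1 then - 1 else 0)"
    by (auto simp: binomial_eq_0)
  finally show ?thesis .
qed

section \<open>Contractions and their powers over finite index sets\<close>

lemma cmod_sum_mult_sq_le:
  fixes f g :: "'l \<Rightarrow> complex"
  shows "(cmod (\<Sum>l\<in>L. f l * g l))\<^sup>2 \<le> (\<Sum>l\<in>L. (cmod (f l))\<^sup>2) * (\<Sum>l\<in>L. (cmod (g l))\<^sup>2)"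
proof -
  have "cmod (\<Sum>l\<in>L. f l * g l) \<le> (\<Sum>l\<in>L. cmod (f l) * cmod (g l))"
    by (rule order_trans[OF norm_sum]) (simp add: norm_mult)
  then have "(cmod (\<Sum>l\<in>L. f l * g l))\<^sup>2 \<le> (\<Sum>l\<in>L. cmod (f l) * cmod (g l))\<^sup>2"
    by (rule power_mono) simp
  also have "\<dots> \<le> (\<Sum>l\<in>L. (cmod (f l))\<^sup>2) * (\<Sum>l\<in>L. (cmod (g l))\<^sup>2)"
    by (rule Cauchy_Schwarz_ineq_sum)
  finally show ?thesis .
qed

text \<open>Let R be the matrix with entries \<open>r\<close> and P its Gram matrix. In the proof
  \<open>w\<close> is R v, \<open>u\<close> is P v, and \<open>T\<close> is the squared norm of R v,
  which is also the inner product of v with P v. The bound on the squared Frobenius norm of R makes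
  the squared norm of P v at most \<open>c * T\<close>. In the expansion of the squared norm of v -
  P v / c, the cross term \<open>- 2 / c * T\<close> therefore outweighs the last term, which is at
  most \<open>T / c\<close>.\<close>

lemma gram_complement_contraction:
  fixes r :: "'l \<Rightarrow> 'i \<Rightarrow> complex"
  assumes fin: "finite I" and c: "c > 0" "(\<Sum>l\<in>L. \<Sum>i\<in>I. (cmod (r l i))\<^sup>2) \<le> c"
    and Q: "\<And>i j. Q i j = (if i = j then 1 else 0) - (\<Sum>l\<in>L. cnj (r l i) * r l j) / of_real c"
  shows "(\<Sum>i\<in>I. (cmod (\<Sum>j\<in>I. Q i j * v j))\<^sup>2) \<le> (\<Sum>i\<in>I. (cmod (v i))\<^sup>2)"
proof -
  define w where "w l = (\<Sum>j\<in>I. r l j * v j)" for l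
  define u where "u i = (\<Sum>l\<in>L. cnj (r l i) * w l)" for i
  define T where "T = (\<Sum>l\<in>L. (cmod (w l))\<^sup>2)"
  have T0: "T \<ge> 0" by (simp add: T_def sum_nonneg)
  have Qv: "(\<Sum>j\<in>I. Q i j * v j) = v i - u i / of_real c" if "i \<in> I" for i
  proof -
    have "(\<Sum>j\<in>I. Q i j * v j)
        = (\<Sum>j\<in>I. if j = i then v i else 0) - (\<Sum>j\<in>I. (\<Sum>l\<in>L. cnj (r l i) * r l j) * v j / of_real c)"
      unfolding sum_subtractf[symmetric] Q by (rule sum.cong) (auto simp: algebra_simps)
    also have "(\<Sum>j\<in>I. (\<Sum>l\<in>L. cnj (r l i) * r l j) * v j / of_real c) = u i / of_real c"
      unfolding u_def w_def sum_divide_distrib[symmetric] sum_distrib_left sum_distrib_right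
      by (subst sum.swap) (simp add: mult.assoc)
    finally show ?thesis using that fin by simp
  qed
  have cross: "(\<Sum>i\<in>I. Re (cnj (v i) * u i)) = T"
  proof -
    have "(\<Sum>i\<in>I. cnj (v i) * u i) = (\<Sum>l\<in>L. cnj (w l) * w l)"
    proof -
      have "(\<Sum>i\<in>I. cnj (v i) * u i) = (\<Sum>i\<in>I. \<Sum>l\<in>L. cnj (r l i) * cnj (v i) * w l)"
        unfolding u_def sum_distrib_left by (intro sum.cong refl) (simp add: mult_ac)
      also have "\<dots> = (\<Sum>l\<in>L. \<Sum>i\<in>I. cnj (r l i) * cnj (v i) * w l)" by (rule sum.swap)
      also have "\<dots> = (\<Sum>l\<in>L. cnj (w l) * w l)"
        by (intro sum.cong refl) (simp add: w_def sum_distrib_right[symmetric])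
      finally show ?thesis .
    qed
    also have "\<dots> = of_real T"
      unfolding T_def of_real_sum
      by (intro sum.cong refl) (simp only: complex_norm_square mult.commute)
    finally have "Re (\<Sum>i\<in>I. cnj (v i) * u i) = T" by simp
    then show ?thesis by (simp only: Re_sum)
  qed
  have usq: "(\<Sum>i\<in>I. (cmod (u i))\<^sup>2) \<le> c * T"
  proof -
    have "(\<Sum>i\<in>I. (cmod (u i))\<^sup>2) \<le> (\<Sum>i\<in>I. (\<Sum>l\<in>L. (cmod (r l i))\<^sup>2) * T)"
      unfolding u_def T_def
      by (rule sum_mono) (rule order_trans[OF cmod_sum_mult_sq_le], simp)
    also have "\<dots> = (\<Sum>l\<in>L. \<Sum>i\<in>I. (cmod (r l i))\<^sup>2) * T"
      unfolding sum_distrib_right[symmetric] by (subst sum.swap) simp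
    also have "\<dots> \<le> c * T" by (rule mult_right_mono[OF c(2) T0])
    finally show ?thesis .
  qed
  have expand: "(cmod (v i - u i / of_real c))\<^sup>2
      = (cmod (v i))\<^sup>2 - 2 / c * Re (cnj (v i) * u i) + (cmod (u i))\<^sup>2 / c\<^sup>2" for i
    using c(1) unfolding cmod_power2 by (simp add: power2_eq_square field_simps)
  have "(\<Sum>i\<in>I. (cmod (\<Sum>j\<in>I. Q i j * v j))\<^sup>2) = (\<Sum>i\<in>I. (cmod (v i - u i / of_real c))\<^sup>2)"
    by (intro sum.cong refl) (simp add: Qv)
  also have "\<dots> = (\<Sum>i\<in>I. (cmod (v i))\<^sup>2) - 2 / c * T + (\<Sum>i\<in>I. (cmod (u i))\<^sup>2) / c\<^sup>2"
    unfolding expand sum.distrib sum_subtractf sum_distrib_left[symmetric] cross sum_divide_distrib ..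
  also have "\<dots> \<le> (\<Sum>i\<in>I. (cmod (v i))\<^sup>2) - 2 / c * T + c * T / c\<^sup>2"
    using usq by (simp add: divide_right_mono)
  also have "\<dots> = (\<Sum>i\<in>I. (cmod (v i))\<^sup>2) - T / c"
    using c(1) by (simp add: power2_eq_square field_simps)
  also have "\<dots> \<le> (\<Sum>i\<in>I. (cmod (v i))\<^sup>2)" using c(1) T0 by simp
  finally show ?thesis .
qed

text \<open>Matrix powers over an index set rather than an index type, because the sizes k in the
  definition of complete positivity vary.\<close>

primrec fun_power :: "'i set \<Rightarrow> ('i \<Rightarrow> 'i \<Rightarrow> complex) \<Rightarrow> nat \<Rightarrow> 'i \<Rightarrow> 'i \<Rightarrow> complex" where
  "fun_power I Q 0 = (\<lambda>i j. if i = j then 1 else 0)"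
| "fun_power I Q (Suc n) = (\<lambda>i j. \<Sum>k\<in>I. Q i k * fun_power I Q n k j)"

lemma fun_power_add:
  assumes "finite I" "i \<in> I"
  shows "fun_power I Q (m + n) i j = (\<Sum>k\<in>I. fun_power I Q m i k * fun_power I Q n k j)"
  using assms(2)
proof (induction m arbitrary: i)
  case 0
  have "(\<Sum>k\<in>I. fun_power I Q 0 i k * fun_power I Q n k j) = (\<Sum>k\<in>I. if k = i then fun_power I Q n i j else 0)"
    by (rule sum.cong) auto
  then show ?case using assms(1) 0 by simp
next
  case (Suc m)
  have "fun_power I Q (Suc m + n) i j = (\<Sum>k\<in>I. Q i k * (\<Sum>l\<in>I. fun_power I Q m k l * fun_power I Q n l j))"
    by (simp add: Suc.IH)
  also have "\<dots> = (\<Sum>k\<in>I. \<Sum>l\<in>I. Q i k * fun_power I Q m k l * fun_power I Q n l j)"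
    by (simp add: sum_distrib_left mult.assoc)
  also have "\<dots> = (\<Sum>l\<in>I. \<Sum>k\<in>I. Q i k * fun_power I Q m k l * fun_power I Q n l j)"
    by (rule sum.swap)
  also have "\<dots> = (\<Sum>l\<in>I. fun_power I Q (Suc m) i l * fun_power I Q n l j)"
    by (simp add: sum_distrib_right)
  finally show ?case .
qed

lemma fun_power_one:
  assumes "finite I" "j \<in> I"
  shows "fun_power I Q (Suc 0) i j = Q i j"
proof -
  have "fun_power I Q (Suc 0) i j = (\<Sum>k\<in>I. if k = j then Q i j else 0)"
    unfolding fun_power.simps by (rule sum.cong) auto
  then show ?thesis using assms by simp
qed

lemma fun_power_hermitian:
  assumes "finite I" "\<And>i j. cnj (Q i j) = Q j i" "i \<in> I" "j \<in> I"
  shows "cnj (fun_power I Q n i j) = fun_power I Q n j i"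
  using assms(3,4)
proof (induction n arbitrary: i j)
  case (Suc n)
  have "fun_power I Q (Suc n) i j = (\<Sum>k\<in>I. fun_power I Q n i k * fun_power I Q (Suc 0) k j)"
    using fun_power_add[OF assms(1), of i Q n "Suc 0" j] Suc.prems by simp
  also have "\<dots> = (\<Sum>k\<in>I. fun_power I Q n i k * Q k j)"
    by (intro sum.cong refl) (metis fun_power_one assms(1) Suc.prems(2))
  finally have "cnj (fun_power I Q (Suc n) i j) = (\<Sum>k\<in>I. Q j k * fun_power I Q n k i)"
    using Suc.IH Suc.prems by (simp add: assms(2) mult.commute)
  then show ?case by simp
qed simp

text \<open>Column \<open>j\<close> of a power is the image of a unit vector under repeated
  contractions, so its Euclidean norm stays at most 1 and bounds each entry.\<close>

lemma cmod_fun_power_le: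
  assumes "finite I" "i \<in> I" "j \<in> I"
    and contr: "\<And>v. (\<Sum>i\<in>I. (cmod (\<Sum>j\<in>I. Q i j * v j))\<^sup>2) \<le> (\<Sum>i\<in>I. (cmod (v i))\<^sup>2)"
  shows "cmod (fun_power I Q n i j) \<le> 1"
proof -
  have "(\<Sum>i\<in>I. (cmod (fun_power I Q n i j))\<^sup>2) \<le> 1"
  proof (induction n)
    case 0
    have "(\<Sum>i\<in>I. (cmod (fun_power I Q 0 i j))\<^sup>2) = (\<Sum>i\<in>I. if i = j then 1 else 0)"
      by (rule sum.cong) auto
    then show ?case using assms by simp
  next
    case (Suc n)
    then show ?case using contr[of "\<lambda>k. fun_power I Q n k j"] by simp
  qed
  moreover have "(cmod (fun_power I Q n i j))\<^sup>2 \<le> (\<Sum>i\<in>I. (cmod (fun_power I Q n i j))\<^sup>2)"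
    using assms by (intro member_le_sum) auto
  ultimately have "(cmod (fun_power I Q n i j))\<^sup>2 \<le> 1" by linarith
  then show ?thesis by (simp add: abs_square_le_1)
qed

text \<open>
  The square root of \<open>P = R\<^sup>* R\<close> is \<open>\<surd>c\<close> times the binomial series of \<open>\<surd>(1 - Q)\<close> at
  \<open>Q = 1 - P/c\<close>, which converges uniformly because its coefficients are absolutely summable.
\<close>

proposition continuous_gram_square_root:
  fixes r :: "'x::topological_space \<Rightarrow> 'l \<Rightarrow> 'i \<Rightarrow> complex"
  assumes fin: "finite L" "finite I"
    and cont: "\<And>l i. l \<in> L \<Longrightarrow> i \<in> I \<Longrightarrow> continuous_on UNIV (\<lambda>x. r x l i)"
    and bound: "\<And>x l i. l \<in> L \<Longrightarrow> i \<in> I \<Longrightarrow> cmod (r x l i) \<le> b"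
  obtains s :: "'x \<Rightarrow> 'i \<Rightarrow> 'i \<Rightarrow> complex"
  where "\<And>i j. i \<in> I \<Longrightarrow> j \<in> I \<Longrightarrow> continuous_on UNIV (\<lambda>x. s x i j)"
    and "\<And>x i j. i \<in> I \<Longrightarrow> j \<in> I \<Longrightarrow>
      (\<Sum>k\<in>I. cnj (s x k i) * s x k j) = (\<Sum>l\<in>L. cnj (r x l i) * r x l j)"
proof -
  \<comment> \<open>This dominates the squared Frobenius norm at all points at once; the summand 1
    keeps it positive when an index set is empty or \<open>b\<close> is 0.\<close>
  define c where "c = real (card L) * (real (card I) * b\<^sup>2) + 1"
  have c: "c > 0" by (simp add: c_def add_nonneg_pos)
  have c_bound: "(\<Sum>l\<in>L. \<Sum>i\<in>I. (cmod (r x l i))\<^sup>2) \<le> c" for x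
  proof -
    have "(\<Sum>l\<in>L. \<Sum>i\<in>I. (cmod (r x l i))\<^sup>2) \<le> (\<Sum>l\<in>L. \<Sum>i\<in>I. b\<^sup>2)"
      by (intro sum_mono power_mono bound) auto
    then show ?thesis by (simp add: c_def)
  qed
  define P where "P x i j = (\<Sum>l\<in>L. cnj (r x l i) * r x l j)" for x i j
  define Q where "Q x i j = (if i = j then 1 else 0) - P x i j / of_real c" for x i j
  define tm where "tm n x i j = of_real (sqrt_coeff n) * fun_power I (Q x) n i j" for n x i j
  define S where "S x i j = (\<Sum>n. tm n x i j)" for x i j
  have herm: "cnj (Q x i j) = Q x j i" for x i j
    by (simp add: Q_def P_def mult.commute)
  have fp_le: "cmod (fun_power I (Q x) n i j) \<le> 1" if "i \<in> I" "j \<in> I" for x n i j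
    by (rule cmod_fun_power_le[OF fin(2) that])
      (rule gram_complement_contraction[OF fin(2) c c_bound[of x]], simp add: Q_def P_def)
  have tm_le: "cmod (tm n x i j) \<le> \<bar>sqrt_coeff n\<bar>" if "i \<in> I" "j \<in> I" for n x i j
    using mult_left_mono[OF fp_le[OF that, of x n], of "\<bar>sqrt_coeff n\<bar>"] by (simp add: tm_def norm_mult)
  have tm_summable: "summable (\<lambda>n. cmod (tm n x i j))" if "i \<in> I" "j \<in> I" for x i j
    by (rule summable_comparison_test'[OF summable_abs_sqrt_coeff, of 0]) (simp add: tm_le that)
  have S_cont: "continuous_on UNIV (\<lambda>x. S x i j)" if ij: "i \<in> I" "j \<in> I" for i j
  proof -
    have Q_cont: "continuous_on UNIV (\<lambda>x. Q x i j)" if "i \<in> I" "j \<in> I" for i j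
      unfolding Q_def P_def using that c by (intro continuous_intros cont) auto
    have "continuous_on UNIV (\<lambda>x. fun_power I (Q x) n i j)" if "i \<in> I" for n i
      using that ij by (induction n arbitrary: i) (auto intro!: continuous_intros Q_cont)
    then have "continuous_on UNIV (\<lambda>x. \<Sum>n<N. tm n x i j)" for N
      unfolding tm_def using ij by (intro continuous_intros) auto
    moreover have "uniform_limit UNIV (\<lambda>N x. \<Sum>n<N. tm n x i j) (\<lambda>x. S x i j) sequentially"
      unfolding S_def by (rule Weierstrass_m_test[OF tm_le[OF ij] summable_abs_sqrt_coeff])
    ultimately show ?thesis
      by (intro uniform_limit_theorem[where F = sequentially]) auto
  qed
  have S_herm: "cnj (S x i j) = S x j i" if "i \<in> I" "j \<in> I" for x i j
  proof -
    have "cnj (S x i j) = (\<Sum>n. cnj (tm n x i j))"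
      unfolding S_def using summable_norm_cancel[OF tm_summable[OF that]]
      by (metis bounded_linear.suminf bounded_linear_cnj)
    then show ?thesis
      by (simp add: S_def tm_def fun_power_hermitian[OF fin(2) herm that])
  qed
  have S_sq: "(\<Sum>k\<in>I. S x i k * S x k j) = P x i j / of_real c" if ij: "i \<in> I" "j \<in> I" for x i j
  proof -
    have "(\<lambda>N. \<Sum>k\<in>I. \<Sum>m\<le>N. tm m x i k * tm (N - m) x k j) sums (\<Sum>k\<in>I. S x i k * S x k j)"
      unfolding S_def by (intro sums_sum Cauchy_product_sums tm_summable ij)
    moreover have "(\<Sum>k\<in>I. \<Sum>m\<le>N. tm m x i k * tm (N - m) x k j)
        = of_real (if N = 0 then 1 else if N = 1 then - 1 else 0) * fun_power I (Q x) N i j" for N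
    proof -
      have "(\<Sum>k\<in>I. \<Sum>m\<le>N. tm m x i k * tm (N - m) x k j)
          = (\<Sum>m\<le>N. of_real (sqrt_coeff m * sqrt_coeff (N - m)) *
              (\<Sum>k\<in>I. fun_power I (Q x) m i k * fun_power I (Q x) (N - m) k j))"
        by (subst sum.swap) (simp add: tm_def sum_distrib_left mult_ac)
      also have "\<dots> = (\<Sum>m\<le>N. of_real (sqrt_coeff m * sqrt_coeff (N - m)) * fun_power I (Q x) N i j)"
        by (intro sum.cong refl) (simp flip: fun_power_add[OF fin(2) ij(1)])
      also have "\<dots> = of_real (\<Sum>m\<le>N. sqrt_coeff m * sqrt_coeff (N - m)) * fun_power I (Q x) N i j"
        by (simp add: sum_distrib_right)
      finally show ?thesis unfolding sqrt_coeff_convolution .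
    qed
    \<comment> \<open>In the Cauchy product only the orders 0 and 1 survive. They give 1 - Q, that
      is P / c.\<close>
    moreover have "(\<lambda>N. of_real (if N = 0 then 1 else if N = 1 then - 1 else 0) * fun_power I (Q x) N i j)
        sums (\<Sum>N\<in>{0, 1}. of_real (if N = 0 then 1 else if N = 1 then - 1 else 0) * fun_power I (Q x) N i j)"
      by (rule sums_finite) auto
    ultimately have "(\<Sum>k\<in>I. S x i k * S x k j)
        = (\<Sum>N\<in>{0, 1}. of_real (if N = 0 then 1 else if N = 1 then - 1 else 0) * fun_power I (Q x) N i j)"
      by (simp only: sums_unique2)
    also have "\<dots> = P x i j / of_real c"
      using fun_power_one[OF fin(2) ij(2), of "Q x" i] by (simp add: Q_def)
    finally show ?thesis .
  qed
  show ?thesis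
  proof (rule that[of "\<lambda>x i j. of_real (sqrt c) * S x i j"])
    fix x i j assume ij: "i \<in> I" "j \<in> I"
    have "(\<Sum>k\<in>I. cnj (of_real (sqrt c) * S x k i) * (of_real (sqrt c) * S x k j))
        = (\<Sum>k\<in>I. (of_real (sqrt c) * of_real (sqrt c)) * (S x i k * S x k j))"
      by (intro sum.cong refl) (simp add: S_herm[OF _ ij(1)] mult_ac)
    also have "\<dots> = of_real c * (\<Sum>k\<in>I. S x i k * S x k j)"
      using c by (simp add: sum_distrib_left flip: of_real_mult)
    also have "\<dots> = P x i j" using c by (simp add: S_sq[OF ij])
    finally show "(\<Sum>k\<in>I. cnj (of_real (sqrt c) * S x k i) * (of_real (sqrt c) * S x k j))
        = (\<Sum>l\<in>L. cnj (r x l i) * r x l j)" by (simp add: P_def)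
  qed (auto intro!: continuous_intros S_cont)
qed

section \<open>The two algebras\<close>

interpretation mat: matrix_function_algebra mat_alg "\<lambda>_ :: unit. \<lambda>M :: complex ^ 'n ^ 'n. M"
proof
  fix F :: "nat \<Rightarrow> complex ^ 'n ^ 'n" and G :: "unit \<Rightarrow> complex ^ 'n ^ 'n"
  assume "uniform_limit UNIV (\<lambda>k _. F k) G sequentially"
  from tendsto_uniform_limitI[OF this UNIV_I, of "()"]
  show "\<exists>a. F \<longlonglongrightarrow> a \<and> (\<forall>i::unit. a = G i)" by auto
qed (auto intro: linearI)

lemma cont_alg_simps [simp]:
  "mul cont_alg = (**\<^sub>C)" "unity cont_alg = const_bcontfun (mat 1)" "star cont_alg = cont_adj"
  "cscale cont_alg = cont_cscale"
  by (simp_all add: cont_alg_def)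

interpretation cont: matrix_function_algebra
  "cont_alg :: ('x::topological_space \<Rightarrow>\<^sub>C (complex ^ 'n ^ 'n)) star_alg" "\<lambda>x F. apply_bcontfun F x"
proof (rule matrix_function_algebra.intro)
  fix F :: "nat \<Rightarrow> 'x \<Rightarrow>\<^sub>C (complex ^ 'n ^ 'n)" and G
  assume "uniform_limit UNIV (\<lambda>k x. apply_bcontfun (F k) x) G sequentially"
  from uniform_limit_bcontfunE[OF this sequentially_bot]
  show "\<exists>a. F \<longlonglongrightarrow> a \<and> (\<forall>x. apply_bcontfun a x = G x)" by metis
next
  show "\<exists>a. \<forall>x. apply_bcontfun a x = M" for M :: "complex ^ 'n ^ 'n"
    by (rule exI[of _ "const_bcontfun M"]) simp
next
  show "linear (\<lambda>F :: 'x \<Rightarrow>\<^sub>C (complex ^ 'n ^ 'n). apply_bcontfun F x)" for x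
    by (rule linearI) simp_all
next
  show "a = b" if "\<And>x. apply_bcontfun a x = apply_bcontfun b x" for a b :: "'x \<Rightarrow>\<^sub>C (complex ^ 'n ^ 'n)"
    using that by (rule bcontfun_eqI)
qed (simp_all add: norm_bounded)

lemma unitary_cont_alg_iff:
  fixes U :: "'x::topological_space \<Rightarrow>\<^sub>C (complex ^ 'n ^ 'n)"
  shows "unitary_elem cont_alg U \<longleftrightarrow> (\<forall>x. unitary (apply_bcontfun U x))"
proof -
  have "F = G \<longleftrightarrow> (\<forall>x. apply_bcontfun F x = apply_bcontfun G x)"
    for F G :: "'x \<Rightarrow>\<^sub>C (complex ^ 'n ^ 'n)"
    by (auto intro: bcontfun_eqI)
  then show ?thesis by (auto simp: unitary_elem_def)
qed

lemma family_at_nth [simp]: "family_at A x $ j = apply_bcontfun (A $ j) x"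
  by (simp add: family_at_def)

lemma abelian_family_at: "abelian_family cont_alg A \<Longrightarrow> abelian_family mat_alg (family_at A x)"
  unfolding family_at_def by (rule cont.abelian_family_ev)

lemma joint_calc_mat_alg:
  assumes "abelian_family mat_alg A" "diagonalizes U d A" "continuous_on UNIV g"
  shows "joint_calc mat_alg g A = diag_calc U d g"
  using mat.ev_joint_calc[of A U d g] assms by simp

lemma joint_calc_cont_alg:
  assumes A: "abelian_family cont_alg A" and g: "continuous_on UNIV g"
  shows "apply_bcontfun (joint_calc cont_alg g A) x = joint_calc mat_alg g (family_at A x)"
proof -
  obtain U d where Ud: "diagonalizes U d (family_at A x)"
    using simultaneous_diagonalization[OF abelian_family_at[OF A]] by blast
  then show ?thesis
    using cont.ev_joint_calc[OF A _ g, of U d x] joint_calc_mat_alg[OF abelian_family_at[OF A] Ud g]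
    by (simp add: family_at_def)
qed

lemma apply_Bcontfun_compact:
  fixes f :: "'x::topological_space \<Rightarrow> 'b::metric_space"
  assumes "compact (UNIV :: 'x set)" and "continuous_on UNIV f"
  shows "apply_bcontfun (Bcontfun f) = f"
proof -
  have "bounded (range f)"
    using compact_imp_bounded[OF compact_continuous_image[OF assms(2,1)]] .
  then show ?thesis using assms(2) by (intro Bcontfun_inverse) (auto simp: bcontfun_def)
qed

section \<open>Tracial states on matrices and on matrix functions\<close>

lemma norm_trace_linear:
  "norm_trace (M + N) = norm_trace M + norm_trace N"
  "norm_trace (mat_cscale c M) = c * norm_trace M"
  by (simp_all add: norm_trace_def trace_add add_divide_distrib)
    (simp add: trace_def mat_cscale_def sum_distrib_left)

lemma norm_trace_one: "norm_trace (mat 1) = 1"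
  by (simp add: norm_trace_def trace_def mat_def)

lemma norm_trace_adj_mult:
  "norm_trace (mat_adj M ** M :: complex ^ 'n ^ 'n)
    = of_real ((\<Sum>i\<in>UNIV. \<Sum>k\<in>UNIV. (cmod (M $ k $ i))\<^sup>2) / real CARD('n))"
proof -
  have "trace (mat_adj M ** M) = of_real (\<Sum>i\<in>UNIV. \<Sum>k\<in>UNIV. (cmod (M $ k $ i))\<^sup>2)"
    unfolding trace_def matrix_matrix_mult_def mat_adj_def vec_lambda_beta of_real_sum
    by (intro sum.cong refl) (simp only: complex_norm_square mult.commute)
  then show ?thesis by (simp add: norm_trace_def)
qed

lemma tracial_state_norm_trace: "tracial_state mat_alg norm_trace"
proof -
  have "norm_trace (mat_adj M ** M) \<in> \<real>\<^sub>\<ge>\<^sub>0" for M :: "complex ^ 'n ^ 'n"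
    unfolding norm_trace_adj_mult by (subst nonneg_Reals_of_real_iff, intro divide_nonneg_nonneg sum_nonneg) auto
  moreover have "norm_trace (M ** N) = norm_trace (N ** M)" for M N :: "complex ^ 'n ^ 'n"
    unfolding norm_trace_def by (subst trace_mul_sym) simp
  ultimately show ?thesis
    unfolding tracial_state_def mat_alg_simps using norm_trace_linear norm_trace_one by blast
qed

text \<open>A matrix has the same trace as its normalized trace times the unit, so a tracial state
  takes the same value on both.\<close>

lemma tracial_state_mat_alg_eq:
  assumes "tracial_state mat_alg \<tau>"
  shows "\<tau> M = norm_trace M"
proof -
  have "\<tau> M = \<tau> (mat_cscale (norm_trace M) (mat 1))"
    by (rule mat.tracial_state_eq_if_trace_eq[OF assms]) (simp add: norm_trace_linear norm_trace_one)
  also have "\<dots> = norm_trace M"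
    using assms by (simp add: tracial_state_def)
  finally show ?thesis .
qed

text \<open>The gap between the pointwise traces is the pointwise trace of S* S for a scalar
  function S, the square root of the gap. Positivity of \<tau> then gives the inequality without an
  integral representation of \<tau>; compactness makes S bounded.\<close>

lemma tracial_state_cont_mono:
  fixes F G :: "'x::topological_space \<Rightarrow>\<^sub>C (complex ^ 'n ^ 'n)"
  assumes X: "compact (UNIV :: 'x set)" and \<tau>: "tracial_state cont_alg \<tau>"
    and real: "\<And>x. norm_trace (F x) \<in> \<real>" "\<And>x. norm_trace (G x) \<in> \<real>"
    and le: "\<And>x. Re (norm_trace (F x)) \<le> Re (norm_trace (G x))"
  shows "Re (\<tau> F) \<le> Re (\<tau> G)"
proof -
  define h where "h x = sqrt (Re (norm_trace (G x)) - Re (norm_trace (F x)))" for x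
  define S where "S = Bcontfun (\<lambda>x. mat_cscale (of_real (h x)) (mat 1) :: complex ^ 'n ^ 'n)"
  have "continuous_on UNIV (\<lambda>x. mat_cscale (of_real (h x)) (mat 1) :: complex ^ 'n ^ 'n)"
    unfolding mat_cscale_of_real h_def by (intro continuous_intros) simp_all
  then have S: "apply_bcontfun S x = mat_cscale (of_real (h x)) (mat 1)" for x
    unfolding S_def by (simp add: apply_Bcontfun_compact[OF X])
  have "norm_trace (G x) = norm_trace (apply_bcontfun (F + cont_adj S **\<^sub>C S) x)" for x
  proof -
    have "mat_adj (mat_cscale (of_real (h x)) (mat 1)) = mat_cscale (of_real (h x)) (mat 1 :: complex ^ 'n ^ 'n)"
      by (simp add: mat_adj_def mat_cscale_def mat_def vec_eq_iff)
    then have "norm_trace (apply_bcontfun (F + cont_adj S **\<^sub>C S) x) = norm_trace (F x) + of_real ((h x)\<^sup>2)"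
      by (simp add: S norm_trace_linear norm_trace_one mat_cscale_mult_left power2_eq_square)
    also have "(h x)\<^sup>2 = Re (norm_trace (G x)) - Re (norm_trace (F x))"
      unfolding h_def using le[of x] by simp
    finally show ?thesis using real[of x] by (simp add: complex_eq_iff complex_is_Real_iff)
  qed
  then have "\<tau> G = \<tau> (F + cont_adj S **\<^sub>C S)"
    by (rule cont.tracial_state_eq_if_trace_eq[OF \<tau>])
  also have "\<dots> = \<tau> F + \<tau> (cont_adj S **\<^sub>C S)"
    using \<tau> by (simp add: tracial_state_def)
  finally have "\<tau> G = \<tau> F + \<tau> (cont_adj S **\<^sub>C S)" .
  moreover have "\<tau> (cont_adj S **\<^sub>C S) \<in> \<real>\<^sub>\<ge>\<^sub>0"
    using \<tau> unfolding tracial_state_def cont_alg_simps by blast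
  ultimately show ?thesis by (simp add: complex_nonneg_Reals_iff)
qed

lemma norm_trace_diag_calc:
  fixes U :: "complex ^ 'n ^ 'n"
  assumes "unitary U"
  shows "norm_trace (diag_calc U d g) = of_real ((\<Sum>p\<in>UNIV. g (d p)) / real CARD('n))"
  by (simp add: diag_calc_def norm_trace_conj[OF assms] norm_trace_diag)

lemma norm_trace_joint_calc_real:
  assumes "abelian_family mat_alg A" "continuous_on UNIV g"
  shows "norm_trace (joint_calc mat_alg g A) \<in> \<real>"
proof -
  obtain U d where Ud: "diagonalizes U d A"
    using simultaneous_diagonalization[OF assms(1)] by blast
  show ?thesis
    unfolding joint_calc_mat_alg[OF assms(1) Ud assms(2)]
      norm_trace_diag_calc[OF diagonalizes_unitary[OF Ud]] by simp
qed

text \<open>Convex functions on Euclidean space are continuous, so both sides range over the same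
  functions, and \<open>norm_trace\<close> is the only tracial state on the matrices.\<close>

lemma tr_majorized_mat_alg_iff:
  fixes A B :: "(complex ^ 'n ^ 'n) ^ 'm"
  assumes A: "abelian_family mat_alg A" "diagonalizes U d A"
    and B: "abelian_family mat_alg B" "diagonalizes V e B"
  shows "tr_majorized mat_alg A B \<longleftrightarrow>
    (\<forall>f. convex_on UNIV f \<longrightarrow> (\<Sum>p\<in>UNIV. f (d p)) \<le> (\<Sum>p\<in>UNIV. f (e p)))"
proof -
  have "Re (\<tau> (joint_calc mat_alg f A)) \<le> Re (\<tau> (joint_calc mat_alg f B)) \<longleftrightarrow>
      (\<Sum>p\<in>UNIV. f (d p)) \<le> (\<Sum>p\<in>UNIV. f (e p))"
    if "tracial_state mat_alg \<tau>" "continuous_on UNIV f" for \<tau> f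
    by (simp add: joint_calc_mat_alg[OF A that(2)] joint_calc_mat_alg[OF B that(2)]
        tracial_state_mat_alg_eq[OF that(1)] divide_le_cancel
        norm_trace_diag_calc[OF diagonalizes_unitary[OF A(2)]]
        norm_trace_diag_calc[OF diagonalizes_unitary[OF B(2)]])
  moreover have "continuous_on UNIV f" if "convex_on UNIV f" for f :: "real ^ 'm \<Rightarrow> real"
    using that by (intro convex_on_continuous) auto
  ultimately show ?thesis
    unfolding tr_majorized_def using tracial_state_norm_trace by blast
qed

proposition tr_pt_majorized_iff_tr_majorized:
  fixes A B :: "('x::topological_space \<Rightarrow>\<^sub>C (complex ^ 'n ^ 'n)) ^ 'm"
  assumes X: "compact (UNIV :: 'x set)"
    and A: "abelian_family cont_alg A" and B: "abelian_family cont_alg B"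
  shows "tr_pt_majorized A B \<longleftrightarrow> tr_majorized cont_alg A B"
proof
  assume pt: "tr_pt_majorized A B"
  show "tr_majorized cont_alg A B"
    unfolding tr_majorized_def
  proof (intro allI impI)
    fix \<tau> :: "('x \<Rightarrow>\<^sub>C (complex ^ 'n ^ 'n)) \<Rightarrow> complex" and f :: "real ^ 'm \<Rightarrow> real"
    assume \<tau>: "tracial_state cont_alg \<tau>" and f: "continuous_on UNIV f" "convex_on UNIV f"
    show "Re (\<tau> (joint_calc cont_alg f A)) \<le> Re (\<tau> (joint_calc cont_alg f B))"
    proof (rule tracial_state_cont_mono[OF X \<tau>])
      fix x
      show "Re (norm_trace (joint_calc cont_alg f A x)) \<le> Re (norm_trace (joint_calc cont_alg f B x))"
        unfolding joint_calc_cont_alg[OF A f(1)] joint_calc_cont_alg[OF B f(1)]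
        using pt f tracial_state_norm_trace unfolding tr_pt_majorized_def tr_majorized_def by blast
    qed (simp_all add: joint_calc_cont_alg A B f(1) norm_trace_joint_calc_real abelian_family_at)
  qed
next
  assume tr: "tr_majorized cont_alg A B"
  show "tr_pt_majorized A B"
    unfolding tr_pt_majorized_def tr_majorized_def
  proof (intro allI impI)
    fix x and \<tau> :: "complex ^ 'n ^ 'n \<Rightarrow> complex" and f :: "real ^ 'm \<Rightarrow> real"
    assume \<tau>: "tracial_state mat_alg \<tau>" and f: "continuous_on UNIV f" "convex_on UNIV f"
    \<comment> \<open>Evaluation at \<open>x\<close> followed by \<tau> is a tracial state on the
      function algebra.\<close>
    show "Re (\<tau> (joint_calc mat_alg f (family_at A x))) \<le> Re (\<tau> (joint_calc mat_alg f (family_at B x)))"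
      using tr cont.tracial_state_ev[OF \<tau>, of x] f
      unfolding tr_majorized_def joint_calc_cont_alg[OF A f(1), symmetric]
        joint_calc_cont_alg[OF B f(1), symmetric] by blast
  qed
qed

section \<open>Majorization of matrices\<close>

text \<open>
  If \<open>a\<close> is not of the form \<open>X b\<close> with \<open>X\<close> doubly stochastic, then \<open>(a, 1)\<close> is separated by some
  \<open>(c, v)\<close> from the compact convex set of all pairs \<open>(X b, column sums of X)\<close> with \<open>X\<close> row-stochastic.
  With \<open>u\<^sub>p = max\<^sub>q (c\<^sub>p \<bullet> b\<^sub>q + v\<^sub>q)\<close>, the convex function \<open>y \<mapsto> max\<^sub>p (c\<^sub>p \<bullet> y - u\<^sub>p)\<close> is at most
  \<open>- v\<^sub>q\<close> at \<open>b\<^sub>q\<close> and at least \<open>c\<^sub>p \<bullet> a\<^sub>p - u\<^sub>p\<close> at \<open>a\<^sub>p\<close>.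
\<close>

proposition stochastic_of_convex_sums_le:
  fixes a b :: "'n::finite \<Rightarrow> real ^ 'm"
  assumes le: "\<And>f. convex_on UNIV f \<Longrightarrow> (\<Sum>p\<in>UNIV. f (a p)) \<le> (\<Sum>p\<in>UNIV. f (b p))"
  obtains X :: "real ^ 'n ^ 'n" where "\<And>p q. 0 \<le> X $ p $ q"
    "\<And>p. (\<Sum>q\<in>UNIV. X $ p $ q) = 1" "\<And>q. (\<Sum>p\<in>UNIV. X $ p $ q) = 1"
    "\<And>p. a p = (\<Sum>q\<in>UNIV. X $ p $ q *\<^sub>R b q)"
proof -
  \<comment> \<open>Only row sums are imposed here, while the column sums become a component of
    \<open>T\<close>. A linear functional can then be maximized over each row separately.\<close>
  define R :: "(real ^ 'n ^ 'n) set" where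
    "R = {X. (\<forall>p q. 0 \<le> X $ p $ q) \<and> (\<forall>p. (\<Sum>q\<in>UNIV. X $ p $ q) = 1)}"
  define T :: "real ^ 'n ^ 'n \<Rightarrow> (real ^ 'm ^ 'n) \<times> (real ^ 'n)" where
    "T X = ((\<chi> p. \<Sum>q\<in>UNIV. X $ p $ q *\<^sub>R b q), (\<chi> q. \<Sum>p\<in>UNIV. X $ p $ q))" for X
  define z :: "(real ^ 'm ^ 'n) \<times> (real ^ 'n)" where "z = ((\<chi> p. a p), (\<chi> q. 1))"
  have linT: "linear T"
    by (rule linearI) (simp_all add: T_def vec_eq_iff sum.distrib scaleR_left_distrib
        scaleR_sum_right sum_distrib_left)
  have "convex R"
    unfolding R_def convex_def
    by (auto simp: sum.distrib sum_distrib_left[symmetric])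
  have closed_R: "closed R"
  proof -
    have eq: "R = (\<Inter>p. \<Inter>q. {X. 0 \<le> X $ p $ q}) \<inter> (\<Inter>p. {X. (\<Sum>q\<in>UNIV. X $ p $ q) = 1})"
      by (auto simp: R_def)
    show ?thesis
      unfolding eq by (intro closed_Int closed_INT ballI closed_Collect_le closed_Collect_eq continuous_intros)
  qed
  have "bounded R"
  proof -
    have "norm X \<le> real CARD('n)" if "X \<in> R" for X
    proof -
      have "norm X \<le> (\<Sum>p\<in>UNIV. norm (X $ p))" by (rule norm_vec_le_sum)
      also have "\<dots> \<le> (\<Sum>p\<in>UNIV. \<Sum>q\<in>UNIV. norm (X $ p $ q))"
        by (intro sum_mono norm_vec_le_sum)
      also have "\<dots> = (\<Sum>p\<in>(UNIV::'n set). 1)"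
        using that by (intro sum.cong refl) (simp add: R_def)
      finally show ?thesis by simp
    qed
    then show ?thesis by (auto simp: bounded_iff)
  qed
  then have "compact R" using closed_R by (simp add: compact_eq_bounded_closed)
  have closed_TR: "closed (T ` R)"
    using \<open>compact R\<close> linT by (intro compact_imp_closed compact_continuous_image linear_continuous_on)
      (simp add: linear_conv_bounded_linear)
  have "z \<in> T ` R"
  proof (rule ccontr)
    assume "z \<notin> T ` R"
    then obtain w \<beta> where sep: "inner w z < \<beta>" "\<And>X. X \<in> R \<Longrightarrow> \<beta> < inner w (T X)"
      using separating_hyperplane_closed_point[OF convex_linear_image[OF linT \<open>convex R\<close>] closed_TR]
      by blast
    \<comment> \<open>The separating functional is smaller at \<open>z\<close> than on the image;
      the sign change turns minima over \<open>R\<close> into maxima.\<close>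
    define c where "c p = - (fst w $ p)" for p
    define v where "v q = - (snd w $ q)" for q
    have "\<exists>s. \<forall>q. inner (c p) (b q) + v q \<le> inner (c p) (b s) + v s" for p
    proof -
      let ?h = "\<lambda>q. inner (c p) (b q) + v q"
      have "Max (range ?h) \<in> range ?h" by (intro Max_in) auto
      then obtain s where s: "Max (range ?h) = ?h s" by blast
      have "?h q \<le> ?h s" for q unfolding s[symmetric] by (intro Max_ge) auto
      then show ?thesis by blast
    qed
    then obtain \<sigma> where \<sigma>: "\<And>p q. inner (c p) (b q) + v q \<le> inner (c p) (b (\<sigma> p)) + v (\<sigma> p)"
      by metis
    define u where "u p = inner (c p) (b (\<sigma> p)) + v (\<sigma> p)" for p
    \<comment> \<open>Each row puts its whole mass on a maximizing index, so this matrix attains the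
      maximum over \<open>R\<close>, the sum of the \<open>u p\<close>.\<close>
    define X0 :: "real ^ 'n ^ 'n" where "X0 = (\<chi> p q. if q = \<sigma> p then 1 else 0)"
    have "X0 \<in> R" by (simp add: R_def X0_def)
    have wz: "inner w z = - (\<Sum>p\<in>UNIV. inner (c p) (a p)) - (\<Sum>q\<in>UNIV. v q)"
      by (simp add: z_def inner_prod_def inner_vec_def c_def v_def sum_negf)
    have "inner w (T X0) = - (\<Sum>p\<in>UNIV. u p)"
    proof -
      have "fst (T X0) $ p = b (\<sigma> p)" for p
      proof -
        have "fst (T X0) $ p = (\<Sum>q\<in>UNIV. if q = \<sigma> p then b q else 0)"
          unfolding T_def X0_def fst_conv vec_lambda_beta by (rule sum.cong) auto
        then show ?thesis by simp
      qed
      then have 1: "inner (fst w) (fst (T X0)) = - (\<Sum>p\<in>UNIV. inner (c p) (b (\<sigma> p)))"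
        by (simp add: inner_vec_def[of "fst w"] c_def sum_negf)
      have "inner (snd w) (snd (T X0)) = (\<Sum>q\<in>UNIV. \<Sum>p\<in>UNIV. snd w $ q * X0 $ p $ q)"
        by (simp add: T_def inner_vec_def sum_distrib_left)
      also have "\<dots> = (\<Sum>p\<in>UNIV. \<Sum>q\<in>UNIV. snd w $ q * X0 $ p $ q)" by (rule sum.swap)
      also have "\<dots> = (\<Sum>p\<in>UNIV. \<Sum>q\<in>UNIV. if q = \<sigma> p then snd w $ q else 0)"
        by (intro sum.cong refl) (simp add: X0_def)
      also have "\<dots> = - (\<Sum>p\<in>UNIV. v (\<sigma> p))" by (simp add: v_def sum_negf)
      finally show ?thesis using 1 by (simp add: inner_prod_def u_def sum.distrib)
    qed
    then have strict: "(\<Sum>p\<in>UNIV. u p) < (\<Sum>p\<in>UNIV. inner (c p) (a p)) + (\<Sum>q\<in>UNIV. v q)"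
      using sep(1) sep(2)[OF \<open>X0 \<in> R\<close>] wz by linarith
    define f where "f y = Max (range (\<lambda>p. inner (c p) y - u p))" for y
    have f_ge: "inner (c p) y - u p \<le> f y" for p y
      unfolding f_def by (intro Max_ge) auto
    have f_le: "f y \<le> k" if "\<And>p. inner (c p) y - u p \<le> k" for y k
      unfolding f_def using that by (intro Max.boundedI) auto
    have "convex_on UNIV f"
    proof (rule convex_onI)
      fix t x y assume t: "0 < (t::real)" "t < 1"
      show "f ((1 - t) *\<^sub>R x + t *\<^sub>R y) \<le> (1 - t) * f x + t * f y"
      proof (rule f_le)
        fix p
        have "inner (c p) ((1 - t) *\<^sub>R x + t *\<^sub>R y) - u p
            = (1 - t) * (inner (c p) x - u p) + t * (inner (c p) y - u p)"
          by (simp add: inner_add_right algebra_simps)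
        also have "\<dots> \<le> (1 - t) * f x + t * f y"
          using t by (intro add_mono mult_left_mono f_ge) auto
        finally show "inner (c p) ((1 - t) *\<^sub>R x + t *\<^sub>R y) - u p \<le> (1 - t) * f x + t * f y" .
      qed
    qed simp
    have "(\<Sum>p\<in>UNIV. inner (c p) (a p) - u p) \<le> (\<Sum>p\<in>UNIV. f (a p))"
      by (intro sum_mono f_ge)
    also have "\<dots> \<le> (\<Sum>q\<in>UNIV. f (b q))" by (rule le[OF \<open>convex_on UNIV f\<close>])
    also have "\<dots> \<le> (\<Sum>q\<in>UNIV. - v q)"
      using \<sigma> by (intro sum_mono f_le) (simp add: u_def algebra_simps)
    finally show False using strict by (simp add: sum_subtractf sum_negf)
  qed
  then obtain X where "X \<in> R" "z = T X" by blast
  then show ?thesis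
    by (intro that[of X]) (auto simp: R_def z_def T_def vec_eq_iff)
qed

text \<open>Each \<open>D $ j\<close> is a unitary conjugate of a self-adjoint matrix, hence has
  real diagonal entries. This passes from the complex diagonalizations in \<open>majorized\<close>
  to real joint eigenvalues.\<close>

lemma diagonalizes_of_diag_mats:
  assumes A: "abelian_family mat_alg A" and U: "unitary U"
    and D: "\<And>j. D $ j \<in> diag_mats" "\<And>j. A $ j = mat_adj U ** D $ j ** U"
  shows "diagonalizes U (\<lambda>p. \<chi> j. Re (D $ j $ p $ p)) A"
    and "D $ j $ p $ p = of_real (Re (D $ j $ p $ p))"
proof -
  have D_eq: "D $ j = U ** A $ j ** mat_adj U" for j
    by (simp add: D(2) matrix_mul_assoc unitaryD[OF U] unitary_cancel[OF U])
  have "mat_adj (D $ j) = D $ j" for j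
    using A unfolding D_eq abelian_family_def by (simp add: mat_adj_mult matrix_mul_assoc)
  then have "cnj (D $ j $ p $ p) = D $ j $ p $ p" for j p
    by (metis (no_types, lifting) mat_adj_def vec_lambda_beta)
  then show real: "D $ j $ p $ p = of_real (Re (D $ j $ p $ p))" for j p
    by (metis Reals_cnj_iff of_real_Re)
  have "D $ j = diag_mat (\<lambda>p. of_real (Re (D $ j $ p $ p)))" for j
    using diag_mats_eq[OF D(1)] by (simp flip: real)
  then show "diagonalizes U (\<lambda>p. \<chi> j. Re (D $ j $ p $ p)) A"
    unfolding diagonalizes_def using U D(2) by simp
qed

proposition majorized_iff_tr_majorized:
  fixes A B :: "(complex ^ 'n ^ 'n) ^ 'm"
  assumes A: "abelian_family mat_alg A" and B: "abelian_family mat_alg B"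
  shows "majorized A B \<longleftrightarrow> tr_majorized mat_alg A B"
proof
  assume "majorized A B"
  then obtain U V D D' X where U: "unitary U" and V: "unitary V"
    and D: "\<And>j. D $ j \<in> diag_mats" "\<And>j. A $ j = mat_adj U ** D $ j ** U"
    and D': "\<And>j. D' $ j \<in> diag_mats" "\<And>j. B $ j = mat_adj V ** D' $ j ** V"
    and X: "X \<in> doubly_stochastic" "X ** diag_columns D' = diag_columns D"
    unfolding majorized_def by blast
  define d e where "d p = (\<chi> j. Re (D $ j $ p $ p))" and "e p = (\<chi> j. Re (D' $ j $ p $ p))" for p
  have diag: "diagonalizes U d A" "diagonalizes V e B"
    unfolding d_def e_def
    using diagonalizes_of_diag_mats(1)[OF A U D] diagonalizes_of_diag_mats(1)[OF B V D'] by auto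
  define x where "x p q = Re (X $ p $ q)" for p q
  have X_x: "X $ p $ q = of_real (x p q)" and x0: "0 \<le> x p q" for p q
    using X(1) by (auto simp: x_def doubly_stochastic_def complex_nonneg_Reals_iff complex_eq_iff)
  have rows: "(\<Sum>q\<in>UNIV. x p q) = 1" and cols: "(\<Sum>p\<in>UNIV. x p q) = 1" for p q
    using X(1) unfolding x_def doubly_stochastic_def by (simp_all flip: Re_sum)
  have d_eq: "d p = (\<Sum>q\<in>UNIV. x p q *\<^sub>R e q)" for p
  proof -
    have "D $ j $ p $ p = (\<Sum>q\<in>UNIV. X $ p $ q * D' $ j $ q $ q)" for j
      using X(2) by (simp add: vec_eq_iff matrix_matrix_mult_def diag_columns_def)
    then show ?thesis by (simp add: d_def e_def vec_eq_iff X_x)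
  qed
  have "(\<Sum>p\<in>UNIV. f (d p)) \<le> (\<Sum>p\<in>UNIV. f (e p))" if f: "convex_on UNIV f" for f
  proof -
    \<comment> \<open>Jensen's inequality uses nonnegativity and the row sums; the column sums enter
      after the exchange of summation.\<close>
    have "(\<Sum>p\<in>UNIV. f (d p)) \<le> (\<Sum>p\<in>UNIV. \<Sum>q\<in>UNIV. x p q * f (e q))"
      unfolding d_eq by (intro sum_mono convex_on_sum[OF _ _ f]) (auto simp: rows x0)
    also have "\<dots> = (\<Sum>q\<in>UNIV. (\<Sum>p\<in>UNIV. x p q) * f (e q))"
      by (subst sum.swap) (simp add: sum_distrib_right)
    finally show ?thesis by (simp add: cols)
  qed
  then show "tr_majorized mat_alg A B"
    unfolding tr_majorized_mat_alg_iff[OF A diag(1) B diag(2)] by blast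
next
  assume tr: "tr_majorized mat_alg A B"
  obtain U d where U: "diagonalizes U d A" using simultaneous_diagonalization[OF A] .
  obtain V e where V: "diagonalizes V e B" using simultaneous_diagonalization[OF B] .
  obtain x :: "real ^ 'n ^ 'n" where x: "\<And>p q. 0 \<le> x $ p $ q" "\<And>p. (\<Sum>q\<in>UNIV. x $ p $ q) = 1"
    "\<And>q. (\<Sum>p\<in>UNIV. x $ p $ q) = 1" and d: "\<And>p. d p = (\<Sum>q\<in>UNIV. x $ p $ q *\<^sub>R e q)"
    using stochastic_of_convex_sums_le[of d e] tr unfolding tr_majorized_mat_alg_iff[OF A U B V] by blast
  define D D' where "D = (\<chi> j. diag_mat (\<lambda>p. complex_of_real (d p $ j)))"
    and "D' = (\<chi> j. diag_mat (\<lambda>p. complex_of_real (e p $ j)))"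
  define X :: "complex ^ 'n ^ 'n" where "X = (\<chi> p q. of_real (x $ p $ q))"
  have "X \<in> doubly_stochastic"
    using x by (simp add: X_def doubly_stochastic_def flip: of_real_sum)
  moreover have "X ** diag_columns D' = diag_columns D"
    by (simp add: vec_eq_iff matrix_matrix_mult_def diag_columns_def X_def D_def D'_def diag_mat_nth d)
  moreover have "D $ j \<in> diag_mats" "A $ j = mat_adj U ** D $ j ** U"
    "D' $ j \<in> diag_mats" "B $ j = mat_adj V ** D' $ j ** V" for j
    using U V by (simp_all add: D_def D'_def diagonalizes_def)
  ultimately show "majorized A B"
    unfolding majorized_def using diagonalizes_unitary[OF U] diagonalizes_unitary[OF V]
    by (intro exI[of _ U] exI[of _ V] exI[of _ D] exI[of _ D'] conjI allI bexI[of _ X])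
qed

section \<open>Doubly stochastic matrices\<close>

lemma doubly_stochasticD:
  assumes "X \<in> doubly_stochastic"
  shows "X $ p $ q = of_real (Re (X $ p $ q))" "0 \<le> Re (X $ p $ q)"
    "(\<Sum>q\<in>UNIV. X $ p $ q) = 1" "(\<Sum>p\<in>UNIV. X $ p $ q) = 1"
  using assms by (auto simp: doubly_stochastic_def complex_nonneg_Reals_iff complex_eq_iff)

lemma doubly_stochastic_entry_le:
  assumes "X \<in> doubly_stochastic"
  shows "Re (X $ p $ q) \<le> 1" "cmod (X $ p $ q) \<le> 1"
proof -
  have "Re (X $ p $ q) \<le> (\<Sum>q\<in>UNIV. Re (X $ p $ q))"
    by (rule member_le_sum) (auto simp: doubly_stochasticD(2)[OF assms])
  also have "\<dots> = 1"
    using doubly_stochasticD(3)[OF assms, of p] by (simp flip: Re_sum)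
  finally show *: "Re (X $ p $ q) \<le> 1" .
  then show "cmod (X $ p $ q) \<le> 1"
    using doubly_stochasticD(1,2)[OF assms, of p q] by (metis norm_of_real abs_of_nonneg)
qed

lemma convex_doubly_stochastic: "convex (doubly_stochastic :: (complex ^ 'n ^ 'n) set)"
proof (rule convexI)
  fix X Y :: "complex ^ 'n ^ 'n" and u v :: real
  assume X: "X \<in> doubly_stochastic" and Y: "Y \<in> doubly_stochastic" and uv: "0 \<le> u" "0 \<le> v" "u + v = 1"
  have "of_real u + of_real v = (1 :: complex)" using uv(3) by (metis of_real_add of_real_1)
  then show "u *\<^sub>R X + v *\<^sub>R Y \<in> doubly_stochastic"
    using X Y uv
    by (simp add: doubly_stochastic_def complex_nonneg_Reals_iff sum.distrib scaleR_sum_right[symmetric]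
        scaleR_conv_of_real[where 'a = complex] sum_distrib_left[symmetric])
qed

text \<open>Compactness serves to make linear images of this set closed, so that pointwise
  majorization survives norm limits.\<close>

lemma compact_doubly_stochastic: "compact (doubly_stochastic :: (complex ^ 'n ^ 'n) set)"
proof -
  have eq: "(doubly_stochastic :: (complex ^ 'n ^ 'n) set) =
      (\<Inter>i. \<Inter>j. (\<lambda>X. X $ i $ j) -` \<real>\<^sub>\<ge>\<^sub>0) \<inter> (\<Inter>i. {X. (\<Sum>j\<in>UNIV. X $ i $ j) = 1}) \<inter>
      (\<Inter>j. {X. (\<Sum>i\<in>UNIV. X $ i $ j) = 1})"
    by (auto simp: doubly_stochastic_def)
  have "closed (doubly_stochastic :: (complex ^ 'n ^ 'n) set)"
    unfolding eq
    by (intro closed_Int closed_INT ballI closed_Collect_eq closed_vimage closed_nonneg_Reals_complex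
        continuous_intros)
  moreover have "norm X \<le> (\<Sum>i\<in>(UNIV::'n set). \<Sum>j\<in>(UNIV::'n set). 1)"
    if "X \<in> doubly_stochastic" for X :: "complex ^ 'n ^ 'n"
    by (rule order_trans[OF norm_matrix_le_sum]) (intro sum_mono doubly_stochastic_entry_le that)
  ultimately show ?thesis
    unfolding compact_eq_bounded_closed bounded_iff by blast
qed

lemma diag_mats_adj_mult_nth:
  assumes "M \<in> diag_mats" "N \<in> diag_mats"
  shows "(mat_adj M ** N) $ i $ i = cnj (M $ i $ i) * N $ i $ i"
  unfolding diag_mats_mult_nth[OF diag_mats_closed(5)[OF assms(1)] assms(2)] by (simp add: mat_adj_def)

text \<open>The indices are transposed so that the entry at p, q is the weight of the diagonal entry
  of D at q in the diagonal entry of Z* D Z at p.\<close>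

definition unistochastic :: "complex ^ 'n ^ 'n \<Rightarrow> complex ^ 'n ^ 'n" where
  "unistochastic Z = (\<chi> p q. of_real ((cmod (Z $ q $ p))\<^sup>2))"

lemma unistochastic_doubly_stochastic:
  assumes "unitary Z"
  shows "unistochastic Z \<in> doubly_stochastic"
  using unitary_column_sum[OF assms] unitary_row_sum[OF assms]
  by (simp add: unistochastic_def doubly_stochastic_def del: of_real_power flip: of_real_sum)

text \<open>An orbit element W* B W with B = V* D V, read in the frame of \<open>U\<close>, is Z* D
  Z for Z = V W U*. It need not be diagonal in that frame, but its diagonal is a doubly stochastic
  average of the diagonal of D.\<close>

lemma diagonal_of_unitary_conj:
  assumes U: "unitary U" and V: "unitary V" and W: "unitary W" and D: "D \<in> diag_mats"
  shows "(U ** (mat_adj W ** (mat_adj V ** D ** V) ** W) ** mat_adj U) $ p $ p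
    = (\<Sum>q\<in>UNIV. unistochastic (V ** W ** mat_adj U) $ p $ q * D $ q $ q)"
proof -
  have "U ** (mat_adj W ** (mat_adj V ** D ** V) ** W) ** mat_adj U
      = mat_adj (V ** W ** mat_adj U) ** diag_mat (\<lambda>q. D $ q $ q) ** (V ** W ** mat_adj U)"
    using diag_mats_eq[OF D] by (simp add: mat_adj_mult matrix_mul_assoc)
  then show ?thesis
    by (simp only: unitary_conj_diag_nth_self) (simp add: unistochastic_def)
qed

section \<open>Maps of diagonal matrices induced by doubly stochastic matrices\<close>

definition stochastic_map :: "complex ^ 'n ^ 'n \<Rightarrow> complex ^ 'n ^ 'n \<Rightarrow> complex ^ 'n ^ 'n" where
  "stochastic_map X T = diag_mat (\<lambda>p. \<Sum>q\<in>UNIV. X $ p $ q * T $ q $ q)"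

lemma stochastic_map_diag [simp]: "stochastic_map X T \<in> diag_mats"
  by (simp add: stochastic_map_def)

lemma stochastic_map_add: "stochastic_map X (S + T) = stochastic_map X S + stochastic_map X T"
  by (simp add: stochastic_map_def diag_mat_add sum.distrib algebra_simps)

lemma stochastic_map_cscale: "stochastic_map X (mat_cscale c T) = mat_cscale c (stochastic_map X T)"
  by (simp add: stochastic_map_def diag_mat_cscale sum_distrib_left mat_cscale_def[of c T] mult.left_commute)

lemma stochastic_map_one:
  assumes "X \<in> doubly_stochastic"
  shows "stochastic_map X (mat 1) = mat 1"
  using doubly_stochasticD(3)[OF assms] by (simp add: stochastic_map_def mat_def diag_mat_def)

lemma norm_trace_stochastic_map:
  assumes "X \<in> doubly_stochastic"
  shows "norm_trace (stochastic_map X T) = norm_trace T"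
proof -
  have "(\<Sum>p\<in>UNIV. \<Sum>q\<in>UNIV. X $ p $ q * T $ q $ q) = (\<Sum>q\<in>UNIV. (\<Sum>p\<in>UNIV. X $ p $ q) * T $ q $ q)"
    by (subst sum.swap) (simp add: sum_distrib_right)
  then show ?thesis
    by (simp add: stochastic_map_def norm_trace_diag doubly_stochasticD(4)[OF assms]) (simp add: norm_trace_def trace_def)
qed

lemma continuous_on_stochastic_map:
  assumes "continuous_on S X" "continuous_on S T"
  shows "continuous_on S (\<lambda>x. stochastic_map (X x) (T x))"
proof -
  have "continuous_on S (\<lambda>x. if i = j then \<Sum>q\<in>UNIV. X x $ i $ q * T x $ q $ q else 0)" for i j
    using assms by (cases "i = j") (auto intro!: continuous_intros)
  then show ?thesis by (simp add: continuous_on_matrix_iff stochastic_map_def diag_mat_nth)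
qed

text \<open>
  The \<open>p\<close>-th diagonal entries of the image form the Gram matrix of the vectors
  \<open>\<surd>X\<^sub>p\<^sub>q R\<^sub>l\<^sub>i(q)\<close> indexed by the pairs \<open>(l, q)\<close>; its square root has only \<open>k\<close> rows.
\<close>

lemma stochastic_map_gram_factor:
  fixes X :: "'x::topological_space \<Rightarrow> complex ^ 'n ^ 'n"
    and R :: "'x \<Rightarrow> nat \<Rightarrow> nat \<Rightarrow> complex ^ 'n ^ 'n"
  assumes X: "\<And>x. X x \<in> doubly_stochastic" "continuous_on UNIV X"
    and R: "\<And>x l i. l < k \<Longrightarrow> i < k \<Longrightarrow> R x l i \<in> diag_mats"
      "\<And>l i. l < k \<Longrightarrow> i < k \<Longrightarrow> continuous_on UNIV (\<lambda>x. R x l i)"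
      "\<And>x l i. l < k \<Longrightarrow> i < k \<Longrightarrow> norm (R x l i) \<le> b"
  obtains S :: "'x \<Rightarrow> nat \<Rightarrow> nat \<Rightarrow> complex ^ 'n ^ 'n"
  where "\<And>x l i. S x l i \<in> diag_mats"
    "\<And>l i. l < k \<Longrightarrow> i < k \<Longrightarrow> continuous_on UNIV (\<lambda>x. S x l i)"
    "\<And>x i j. i < k \<Longrightarrow> j < k \<Longrightarrow> (\<Sum>l<k. mat_adj (S x l i) ** S x l j)
      = stochastic_map (X x) (\<Sum>l<k. mat_adj (R x l i) ** R x l j)"
proof -
  define r where "r p x lq i = of_real (sqrt (Re (X x $ p $ snd lq))) * R x (fst lq) i $ snd lq $ snd lq"
    for p x and lq :: "nat \<times> 'n" and i
  let ?L = "{..<k} \<times> (UNIV :: 'n set)"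
  have cont_r: "continuous_on UNIV (\<lambda>x. r p x lq i)" if "lq \<in> ?L" "i \<in> {..<k}" for p lq i
    unfolding r_def using that X(2) R(2) by (intro continuous_intros) auto
  have bound_r: "cmod (r p x lq i) \<le> b" if "lq \<in> ?L" "i \<in> {..<k}" for p x lq i
  proof -
    have "cmod (r p x lq i) \<le> 1 * b"
      unfolding r_def norm_mult
      using that doubly_stochasticD(2)[OF X(1)] doubly_stochastic_entry_le(1)[OF X(1)]
      by (intro mult_mono order_trans[OF norm_entry_le R(3)]) auto
    then show ?thesis by simp
  qed
  define factor where "factor p s \<longleftrightarrow> (\<forall>i j. i < k \<longrightarrow> j < k \<longrightarrow> continuous_on UNIV (\<lambda>x. s x i j)) \<and>
      (\<forall>x i j. i < k \<longrightarrow> j < k \<longrightarrow> (\<Sum>l<k. cnj (s x l i) * s x l j)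
        = (\<Sum>lq\<in>?L. cnj (r p x lq i) * r p x lq j))" for p s
  have "\<exists>s. factor p s" for p
  proof -
    obtain s where s: "\<And>i j. i \<in> {..<k} \<Longrightarrow> j \<in> {..<k} \<Longrightarrow> continuous_on UNIV (\<lambda>x. s x i j)"
      "\<And>x i j. i \<in> {..<k} \<Longrightarrow> j \<in> {..<k} \<Longrightarrow> (\<Sum>l\<in>{..<k}. cnj (s x l i) * s x l j)
        = (\<Sum>lq\<in>?L. cnj (r p x lq i) * r p x lq j)"
    proof (rule continuous_gram_square_root[where L = ?L and I = "{..<k}" and r = "r p" and b = b])
      show "continuous_on UNIV (\<lambda>x. r p x lq i)" if "lq \<in> ?L" "i \<in> {..<k}" for lq i
        using that by (rule cont_r)
      show "cmod (r p x lq i) \<le> b" if "lq \<in> ?L" "i \<in> {..<k}" for x lq i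
        using that by (rule bound_r)
    qed (simp_all, blast)
    then have "factor p s" unfolding factor_def by simp
    then show ?thesis by blast
  qed
  then obtain s where "\<And>p. factor p (s p)" by metis
  then have s_cont: "continuous_on UNIV (\<lambda>x. s p x i j)"
    and s: "(\<Sum>l<k. cnj (s p x l i) * s p x l j) = (\<Sum>lq\<in>?L. cnj (r p x lq i) * r p x lq j)"
    if "i < k" "j < k" for p x i j
    using that unfolding factor_def by blast+
  define S where "S x l i = diag_mat (\<lambda>p. s p x l i)" for x l i
  show ?thesis
  proof (rule that)
    fix x i j assume ij: "i < k" "j < k"
    have entry: "(\<Sum>lq\<in>?L. cnj (r p x lq i) * r p x lq j)
        = (\<Sum>q\<in>UNIV. X x $ p $ q * (\<Sum>l<k. mat_adj (R x l i) ** R x l j) $ q $ q)" for p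
    proof -
      have "cnj (r p x (l, q) i) * r p x (l, q) j = X x $ p $ q * (mat_adj (R x l i) ** R x l j) $ q $ q"
        if "l < k" for l q
      proof -
        have "(mat_adj (R x l i) ** R x l j) $ q $ q = cnj (R x l i $ q $ q) * R x l j $ q $ q"
          using that ij by (intro diag_mats_adj_mult_nth R)
        moreover have "complex_of_real (sqrt (Re (X x $ p $ q))) * of_real (sqrt (Re (X x $ p $ q))) = X x $ p $ q"
          unfolding of_real_mult[symmetric] real_sqrt_mult_self
          using doubly_stochasticD(1,2)[OF X(1), of x p q] by simp
        ultimately show ?thesis by (simp add: r_def)
      qed
      then have "(\<Sum>lq\<in>?L. cnj (r p x lq i) * r p x lq j)
          = (\<Sum>l<k. \<Sum>q\<in>UNIV. X x $ p $ q * (mat_adj (R x l i) ** R x l j) $ q $ q)"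
        by (simp add: sum.cartesian_product')
      also have "\<dots> = (\<Sum>q\<in>UNIV. X x $ p $ q * (\<Sum>l<k. (mat_adj (R x l i) ** R x l j) $ q $ q))"
        by (subst sum.swap) (simp add: sum_distrib_left)
      finally show ?thesis by simp
    qed
    have "(\<Sum>l<k. mat_adj (S x l i) ** S x l j) = diag_mat (\<lambda>p. \<Sum>l<k. cnj (s p x l i) * s p x l j)"
      by (simp add: S_def diag_mat_adj diag_mat_mult diag_mat_sum)
    then show "(\<Sum>l<k. mat_adj (S x l i) ** S x l j)
        = stochastic_map (X x) (\<Sum>l<k. mat_adj (R x l i) ** R x l j)"
      unfolding stochastic_map_def s[OF ij] entry .
  next
    fix l i assume "l < k" "i < k"
    then have "continuous_on UNIV (\<lambda>x. if p = q then s p x l i else 0)" for p q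
      by (cases "p = q") (auto intro: s_cont)
    then show "continuous_on UNIV (\<lambda>x. S x l i)"
      by (simp add: continuous_on_matrix_iff S_def diag_mat_nth)
  qed (simp add: S_def)
qed

lemma completely_positive_stochastic_map:
  fixes X :: "complex ^ 'n ^ 'n"
  assumes X: "X \<in> doubly_stochastic"
  shows "completely_positive_map mat_alg diag_mats diag_mats (stochastic_map X)"
  unfolding completely_positive_map_def
proof (intro conjI allI impI)
  show "linear_map_on mat_alg diag_mats diag_mats (stochastic_map X)"
    by (simp add: linear_map_on_def stochastic_map_add stochastic_map_cscale)
next
  fix k and T :: "nat \<Rightarrow> nat \<Rightarrow> complex ^ 'n ^ 'n"
  assume "positive_matrix_in mat_alg diag_mats k T"
  then obtain R where R: "\<And>i j. i < k \<Longrightarrow> j < k \<Longrightarrow> R i j \<in> diag_mats"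
    and T: "\<And>i j. i < k \<Longrightarrow> j < k \<Longrightarrow> T i j = (\<Sum>l<k. mat_adj (R l i) ** R l j)"
    unfolding positive_matrix_in_def mat_alg_simps by blast
  have bound: "norm (R l i) \<le> (\<Sum>l<k. \<Sum>i<k. norm (R l i))" if "l < k" "i < k" for l i
  proof -
    have "norm (R l i) \<le> (\<Sum>i<k. norm (R l i))" using that by (intro member_le_sum) auto
    also have "\<dots> \<le> (\<Sum>l<k. \<Sum>i<k. norm (R l i))"
      using that by (intro member_le_sum) (auto intro: sum_nonneg)
    finally show ?thesis .
  qed
  \<comment> \<open>The factorization for functions is applied to constant functions on the real
    line, an arbitrary parameter space, and evaluated at 0 below.\<close>
  obtain S :: "real \<Rightarrow> nat \<Rightarrow> nat \<Rightarrow> complex ^ 'n ^ 'n" where S: "\<And>x l i. S x l i \<in> diag_mats"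
    "\<And>l i. l < k \<Longrightarrow> i < k \<Longrightarrow> continuous_on UNIV (\<lambda>x. S x l i)"
    "\<And>x i j. i < k \<Longrightarrow> j < k \<Longrightarrow> (\<Sum>l<k. mat_adj (S x l i) ** S x l j)
      = stochastic_map X (\<Sum>l<k. mat_adj (R l i) ** R l j)"
  proof (rule stochastic_map_gram_factor[where X = "\<lambda>_ :: real. X" and k = k and R = "\<lambda>_. R"])
    show "norm (R l i) \<le> (\<Sum>l<k. \<Sum>i<k. norm (R l i))" if "l < k" "i < k" for l i
      by (rule bound[OF that])
  qed (use X R in simp_all, blast)
  then show "positive_matrix_in mat_alg diag_mats k (\<lambda>i j. stochastic_map X (T i j))"
    unfolding positive_matrix_in_def mat_alg_simps by (intro exI[of _ "S 0"]) (simp add: T)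
qed

section \<open>Continuous and pointwise majorization\<close>

lemma mult_diag_columns_nth: "(X ** diag_columns D) $ p $ j = (\<Sum>q\<in>UNIV. X $ p $ q * D $ j $ q $ q)"
  by (simp add: matrix_matrix_mult_def diag_columns_def)

text \<open>\<open>csd\<close> conjugates by a unitary in the order U D U*, the majorization
  relations in the order U* D U; replacing \<open>U\<close> by its adjoint translates between
  them.\<close>

lemma csd_iff:
  "csd A \<longleftrightarrow> (\<exists>U D. unitary_elem cont_alg U \<and>
     (\<forall>j. D $ j \<in> cont_diag \<and> A $ j = cont_adj U **\<^sub>C D $ j **\<^sub>C U))"
  (is "_ \<longleftrightarrow> ?rhs")
proof -
  have [simp]: "cont_adj (cont_adj U) = U" for U :: "'a \<Rightarrow>\<^sub>C (complex ^ 'b ^ 'b)"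
    by (rule bcontfun_eqI) simp
  have [simp]: "unitary_elem cont_alg (cont_adj U) = unitary_elem cont_alg U"
    for U :: "'a \<Rightarrow>\<^sub>C (complex ^ 'b ^ 'b)"
    by (auto simp: unitary_elem_def)
  show ?thesis
  proof
    assume "csd A"
    then obtain U D where "unitary_elem cont_alg U"
      "\<forall>j. D $ j \<in> cont_diag \<and> A $ j = U **\<^sub>C D $ j **\<^sub>C cont_adj U"
      unfolding csd_def by blast
    then show ?rhs by (intro exI[of _ "cont_adj U"] exI[of _ D]) simp
  next
    assume ?rhs
    then obtain U D where "unitary_elem cont_alg U"
      "\<forall>j. D $ j \<in> cont_diag \<and> A $ j = cont_adj U **\<^sub>C D $ j **\<^sub>C U" by blast
    then show "csd A"
      unfolding csd_def by (intro exI[of _ "cont_adj U"] exI[of _ D]) simp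
  qed
qed

lemma unitary_cont: "unitary_elem cont_alg U \<Longrightarrow> unitary (apply_bcontfun U x)"
  by (simp add: unitary_cont_alg_iff)

lemma cont_diagD: "D \<in> cont_diag \<Longrightarrow> apply_bcontfun D x \<in> diag_mats"
  by (simp add: cont_diag_def)

text \<open>\<open>L\<close> reads off the diagonals in the diagonalizing frame of \<open>A\<close>,
  and \<open>K\<close> consists of the families for which this readout is a continuous doubly
  stochastic average of the diagonals of \<open>B\<close>. The readout is linear, so
  \<open>K\<close> is convex, and it contains the orbit. Norm limits are another matter: compactness
  on each fibre does not make the averaging matrices converge uniformly.\<close>

lemma c_majorized_of_convex_hull:
  fixes A B :: "('x::topological_space \<Rightarrow>\<^sub>C (complex ^ 'n ^ 'n)) ^ 'm"
  assumes X: "compact (UNIV :: 'x set)" and csd: "csd A" "csd B"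
    and hull: "A \<in> convex hull (unitary_orbit cont_alg B)"
  shows "c_majorized A B"
proof -
  obtain U D where U: "unitary_elem cont_alg U"
    and D: "\<And>j. D $ j \<in> cont_diag" "\<And>j. A $ j = cont_adj U **\<^sub>C D $ j **\<^sub>C U"
    using csd(1) unfolding csd_iff by blast
  obtain V D' where V: "unitary_elem cont_alg V"
    and D': "\<And>j. D' $ j \<in> cont_diag" "\<And>j. B $ j = cont_adj V **\<^sub>C D' $ j **\<^sub>C V"
    using csd(2) unfolding csd_iff by blast
  define L :: "('x \<Rightarrow>\<^sub>C (complex ^ 'n ^ 'n)) ^ 'm \<Rightarrow> 'x \<Rightarrow> complex ^ 'm ^ 'n" where
    "L C x = (\<chi> p j. (U x ** (C $ j) x ** mat_adj (U x)) $ p $ p)" for C x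
  define K where "K = {C. \<exists>Y :: 'x \<Rightarrow>\<^sub>C (complex ^ 'n ^ 'n). \<forall>x. Y x \<in> doubly_stochastic \<and>
      Y x ** diag_columns (family_at D' x) = L C x}"
  have "convex K"
  proof (rule convexI)
    fix C C' and s t :: real assume C: "C \<in> K" "C' \<in> K" and st: "0 \<le> s" "0 \<le> t" "s + t = 1"
    obtain Y Y' :: "'x \<Rightarrow>\<^sub>C (complex ^ 'n ^ 'n)"
      where Y: "\<And>x. Y x \<in> doubly_stochastic" "\<And>x. Y x ** diag_columns (family_at D' x) = L C x"
        "\<And>x. Y' x \<in> doubly_stochastic" "\<And>x. Y' x ** diag_columns (family_at D' x) = L C' x"
      using C unfolding K_def by blast
    have "L (s *\<^sub>R C + t *\<^sub>R C') x = s *\<^sub>R L C x + t *\<^sub>R L C' x" for x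
      by (simp add: L_def vec_eq_iff matrix_add_ldistrib matrix_add_rdistrib
          matrix_mult_scaleR_left matrix_mult_scaleR_right)
    then show "s *\<^sub>R C + t *\<^sub>R C' \<in> K"
      unfolding K_def using Y st
      by (intro CollectI exI[of _ "s *\<^sub>R Y + t *\<^sub>R Y'"])
        (simp add: matrix_add_rdistrib matrix_mult_scaleR_left convexD[OF convex_doubly_stochastic])
  qed
  moreover have "unitary_orbit cont_alg B \<subseteq> K"
  proof
    fix C assume "C \<in> unitary_orbit cont_alg B"
    then obtain W where W: "unitary_elem cont_alg W" and C: "\<And>j. C $ j = cont_adj W **\<^sub>C B $ j **\<^sub>C W"
      unfolding unitary_orbit_def by auto
    define Y where "Y = Bcontfun (\<lambda>x. unistochastic (V x ** W x ** mat_adj (U x)))"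
    have "continuous_on UNIV (\<lambda>x. unistochastic ((V **\<^sub>C W **\<^sub>C cont_adj U) x))"
      unfolding unistochastic_def by (intro continuous_intros continuous_on_apply_bcontfun)
    then have Y: "Y x = unistochastic (V x ** W x ** mat_adj (U x))" for x
      by (simp add: Y_def apply_Bcontfun_compact[OF X])
    have "Y x \<in> doubly_stochastic" for x
      unfolding Y by (intro unistochastic_doubly_stochastic unitary_mult unitary_adj unitary_cont U V W)
    moreover have "Y x ** diag_columns (family_at D' x) = L C x" for x
    proof -
      have "(Y x ** diag_columns (family_at D' x)) $ p $ j = L C x $ p $ j" for p j
        by (simp add: L_def C D'(2) Y mult_diag_columns_nth diagonal_of_unitary_conj[OF unitary_cont[OF U]
            unitary_cont[OF V] unitary_cont[OF W] cont_diagD[OF D'(1)]])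
      then show ?thesis by (simp only: vec_eq_iff) simp
    qed
    ultimately show "C \<in> K" unfolding K_def by blast
  qed
  ultimately have "A \<in> K" using hull hull_minimal by blast
  then obtain Y :: "'x \<Rightarrow>\<^sub>C (complex ^ 'n ^ 'n)" where Y: "\<And>x. Y x \<in> doubly_stochastic"
    "\<And>x. Y x ** diag_columns (family_at D' x) = L A x" unfolding K_def by blast
  have "L A x = diag_columns (family_at D x)" for x
  proof -
    have "U x ** (mat_adj (U x) ** M ** U x) ** mat_adj (U x) = M" for M
      using unitary_cont[OF U] by (simp add: matrix_mul_assoc unitaryD unitary_cancel)
    then show ?thesis by (simp add: L_def D(2) diag_columns_def vec_eq_iff)
  qed
  then show ?thesis
    unfolding c_majorized_def using U V D D' Y
    by (intro exI[of _ U] exI[of _ V] exI[of _ D] exI[of _ D'] exI[of _ Y] conjI allI) simp_all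
qed

text \<open>The readout argument at a single point, where diagonalizations exist without CSD. There
  the admissible diagonals form the linear image of a compact set, so the corresponding set of
  families is closed as well as convex.\<close>

lemma pt_majorized_of_closure_convex_hull:
  fixes A B :: "('x::topological_space \<Rightarrow>\<^sub>C (complex ^ 'n ^ 'n)) ^ 'm"
  assumes A: "abelian_family cont_alg A" and B: "abelian_family cont_alg B"
    and closure: "A \<in> closure (convex hull (unitary_orbit cont_alg B))"
  shows "pt_majorized A B"
  unfolding pt_majorized_def
proof
  fix x
  obtain U d where U: "diagonalizes U d (family_at A x)"
    using simultaneous_diagonalization[OF abelian_family_at[OF A]] .
  obtain V e where V: "diagonalizes V e (family_at B x)"
    using simultaneous_diagonalization[OF abelian_family_at[OF B]] .
  have uU: "unitary U" and uV: "unitary V" using U V by (auto dest: diagonalizes_unitary)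
  define D D' where "D = (\<chi> j. diag_mat (\<lambda>p. complex_of_real (d p $ j)))"
    and "D' = (\<chi> j. diag_mat (\<lambda>p. complex_of_real (e p $ j)))"
  have A_eq: "family_at A x $ j = mat_adj U ** D $ j ** U"
    and B_eq: "family_at B x $ j = mat_adj V ** D' $ j ** V" for j
    using U V unfolding diagonalizes_def by (simp_all add: D_def D'_def)
  define L :: "('x \<Rightarrow>\<^sub>C (complex ^ 'n ^ 'n)) ^ 'm \<Rightarrow> complex ^ 'm ^ 'n" where
    "L C = (\<chi> p j. (U ** (C $ j) x ** mat_adj U) $ p $ p)" for C
  define K where "K = L -` ((\<lambda>Y. Y ** diag_columns D') ` doubly_stochastic)"
  have "linear L"
    by (rule linearI) (simp_all add: L_def vec_eq_iff matrix_add_ldistrib matrix_add_rdistrib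
          matrix_mult_scaleR_left matrix_mult_scaleR_right)
  moreover have lin: "linear (\<lambda>Y :: complex ^ 'n ^ 'n. Y ** diag_columns D')"
    by (rule linearI) (simp_all add: matrix_add_rdistrib matrix_mult_scaleR_left)
  ultimately have "convex K"
    unfolding K_def by (intro convex_linear_vimage convex_linear_image convex_doubly_stochastic)
  moreover have "closed K"
    unfolding K_def
  proof (rule closed_vimage)
    show "closed ((\<lambda>Y. Y ** diag_columns D') ` doubly_stochastic)"
      using lin by (intro compact_imp_closed compact_continuous_image compact_doubly_stochastic
          linear_continuous_on) (simp add: linear_conv_bounded_linear)
    show "continuous_on UNIV L"
      unfolding L_def matrix_matrix_mult_def by (intro continuous_intros cont.continuous_on_ev)
  qed
  moreover have "unitary_orbit cont_alg B \<subseteq> K"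
  proof
    fix C assume "C \<in> unitary_orbit cont_alg B"
    then obtain W where W: "unitary_elem cont_alg W" and C: "\<And>j. C $ j = cont_adj W **\<^sub>C B $ j **\<^sub>C W"
      unfolding unitary_orbit_def by auto
    have C_x: "(C $ j) x = mat_adj (W x) ** (mat_adj V ** D' $ j ** V) ** W x" for j
      using B_eq[of j] by (simp add: C)
    have D'_diag: "D' $ j \<in> diag_mats" for j by (simp add: D'_def)
    have "L C $ p $ j = (unistochastic (V ** W x ** mat_adj U) ** diag_columns D') $ p $ j" for p j
      by (simp add: L_def C_x mult_diag_columns_nth
          diagonal_of_unitary_conj[OF uU uV unitary_cont[OF W] D'_diag])
    then have "L C = unistochastic (V ** W x ** mat_adj U) ** diag_columns D'"
      by (simp only: vec_eq_iff) simp
    moreover have "unistochastic (V ** W x ** mat_adj U) \<in> doubly_stochastic"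
      by (intro unistochastic_doubly_stochastic unitary_mult unitary_adj unitary_cont uU uV W)
    ultimately show "C \<in> K" unfolding K_def by blast
  qed
  ultimately have "A \<in> K"
    using closure closure_minimal[of "convex hull (unitary_orbit cont_alg B)" K]
      hull_minimal[of "unitary_orbit cont_alg B" K convex] by blast
  then obtain Y where Y: "Y \<in> doubly_stochastic" "L A = Y ** diag_columns D'" unfolding K_def by blast
  have cancel: "U ** (mat_adj U ** M ** U) ** mat_adj U = M" for M
    using uU by (simp add: matrix_mul_assoc unitaryD unitary_cancel)
  have "(A $ j) x = mat_adj U ** D $ j ** U" for j
    using A_eq[of j] by simp
  then have "L A = diag_columns D"
    by (simp add: L_def diag_columns_def cancel)
  then show "majorized (family_at A x) (family_at B x)"
    unfolding majorized_def using uU uV Y A_eq B_eq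
    by (intro exI[of _ U] exI[of _ V] exI[of _ D] exI[of _ D'] conjI allI bexI[of _ Y])
      (simp_all add: D_def D'_def)
qed

lemma pt_majorized_of_c_majorized:
  assumes "c_majorized A B"
  shows "pt_majorized A B"
  unfolding pt_majorized_def
proof
  fix x
  obtain U V D D' X where U: "unitary_elem cont_alg U" and V: "unitary_elem cont_alg V"
    and D: "\<And>j. D $ j \<in> cont_diag" "\<And>j. A $ j = cont_adj U **\<^sub>C D $ j **\<^sub>C U"
    and D': "\<And>j. D' $ j \<in> cont_diag" "\<And>j. B $ j = cont_adj V **\<^sub>C D' $ j **\<^sub>C V"
    and X: "\<And>x. apply_bcontfun X x \<in> doubly_stochastic"
      "\<And>x. apply_bcontfun X x ** diag_columns (family_at D' x) = diag_columns (family_at D x)"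
    using assms unfolding c_majorized_def by blast
  show "majorized (family_at A x) (family_at B x)"
    unfolding majorized_def
    by (intro exI[of _ "U x"] exI[of _ "V x"] exI[of _ "family_at D x"] exI[of _ "family_at D' x"]
        conjI allI bexI[of _ "X x"] unitary_cont U V X)
      (simp_all add: D(2) D'(2) cont_diagD D(1) D'(1))
qed

section \<open>Majorization through fibrewise maps\<close>

text \<open>\<open>Bcontfun\<close> is faithful only on bounded continuous functions: continuity is
  the well-definedness of the fibre map, boundedness comes from compactness.\<close>

lemma apply_conj_fibre_map:
  fixes U V T :: "'x::topological_space \<Rightarrow>\<^sub>C (complex ^ 'n ^ 'n)"
  assumes "compact (UNIV :: 'x set)" and "fibre_map_well_defined \<Psi>"
    and "U **\<^sub>C T **\<^sub>C cont_adj U \<in> cont_diag"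
  shows "apply_bcontfun (conj_fibre_map U V \<Psi> T) x
    = mat_adj (V x) ** \<Psi> x (U x ** T x ** mat_adj (U x)) ** V x"
proof -
  have "continuous_on UNIV (\<lambda>x. \<Psi> x (U x ** T x ** mat_adj (U x)))"
    using assms(2,3) unfolding fibre_map_well_defined_def by fastforce
  then show ?thesis
    by (simp add: conj_fibre_map_def fibre_map_def apply_Bcontfun_compact[OF assms(1)])
qed

lemma positive_map_of_completely_positive_map:
  assumes "completely_positive_map \<AA> S S' F"
  shows "positive_map \<AA> S S' F"
  unfolding positive_map_def
proof (intro conjI allI impI)
  fix a assume "positive_in \<AA> S a"
  then obtain r where "r \<in> S" "a = mul \<AA> (star \<AA> r) r" unfolding positive_in_def by blast
  then have "positive_matrix_in \<AA> S (Suc 0) (\<lambda>_ _. a)"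
    unfolding positive_matrix_in_def by (intro exI[of _ "\<lambda>_ _. r"]) simp
  moreover have "\<forall>k T. positive_matrix_in \<AA> S k T \<longrightarrow> positive_matrix_in \<AA> S' k (\<lambda>i j. F (T i j))"
    using assms by (simp add: completely_positive_map_def)
  ultimately have "positive_matrix_in \<AA> S' (Suc 0) (\<lambda>i j. F ((\<lambda>_ _. a) i j))" by blast
  then show "positive_in \<AA> S' (F a)"
    unfolding positive_matrix_in_def positive_in_def by auto
qed (use assms in \<open>simp add: completely_positive_map_def\<close>)

lemma map_majorized_of_cp_map_majorized: "cp_map_majorized A B \<Longrightarrow> map_majorized A B"
  unfolding cp_map_majorized_def map_majorized_def
  using positive_map_of_completely_positive_map by blast

text \<open>The matrix at \<open>x\<close> is recovered from the images of the diagonal matrix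
  units: column q is the diagonal of \<open>\<Psi> x (E q)\<close>. Positivity gives nonnegative
  entries, unitality the row sums, trace preservation the column sums. Continuity in
  \<open>x\<close> is the well-definedness of the fibre map applied to constant functions.\<close>

lemma c_majorized_of_map_majorized:
  fixes A B :: "('x::topological_space \<Rightarrow>\<^sub>C (complex ^ 'n ^ 'n)) ^ 'm"
  assumes comp: "compact (UNIV :: 'x set)" and "map_majorized A B"
  shows "c_majorized A B"
proof -
  obtain \<Psi> U V where \<Psi>: "\<And>x. positive_map mat_alg diag_mats diag_mats (\<Psi> x)"
      "\<And>x. \<Psi> x (mat 1) = mat 1" "\<And>x T. T \<in> diag_mats \<Longrightarrow> norm_trace (\<Psi> x T) = norm_trace T"
    and wd: "fibre_map_well_defined \<Psi>"
    and U: "unitary_elem cont_alg U" and V: "unitary_elem cont_alg V"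
    and diag: "\<And>T. T \<in> cstar_gen cont_alg B \<Longrightarrow> U **\<^sub>C T **\<^sub>C cont_adj U \<in> cont_diag"
    and \<Phi>: "\<And>k. conj_fibre_map U V \<Psi> (B $ k) = A $ k"
    using assms(2) unfolding map_majorized_def by blast
  have add: "\<Psi> x (S + T) = \<Psi> x S + \<Psi> x T" if "S \<in> diag_mats" "T \<in> diag_mats" for x S T
    using \<Psi>(1)[of x] that unfolding positive_map_def linear_map_on_def by auto
  have scale: "\<Psi> x (mat_cscale c T) = mat_cscale c (\<Psi> x T)" and diag_\<Psi>: "\<Psi> x T \<in> diag_mats"
    if "T \<in> diag_mats" for x c T
    using \<Psi>(1)[of x] that unfolding positive_map_def linear_map_on_def by auto
  define E :: "'n \<Rightarrow> complex ^ 'n ^ 'n" where "E q = diag_mat (\<lambda>i. if i = q then 1 else 0)" for q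
  have E [simp]: "E q \<in> diag_mats" for q by (simp add: E_def)
  have \<Psi>_sum: "\<Psi> x (\<Sum>q\<in>S. mat_cscale (t q) (E q)) = (\<Sum>q\<in>S. mat_cscale (t q) (\<Psi> x (E q))) \<and>
      (\<Sum>q\<in>S. mat_cscale (t q) (E q)) \<in> diag_mats" if "finite S" for x t S
    using that
  proof induction
    case empty
    have zero: "mat_cscale 0 M = 0" for M :: "complex ^ 'n ^ 'n" by (simp add: mat_cscale_def vec_eq_iff)
    have "\<Psi> x (mat_cscale 0 (mat 1)) = mat_cscale 0 (\<Psi> x (mat 1))"
      by (rule scale) (simp add: diag_mats_closed)
    then show ?case by (simp add: zero) (simp add: diag_mats_def)
  next
    case (insert q S)
    then show ?case by (simp add: add scale diag_mats_closed)
  qed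
  have expand: "T = (\<Sum>q\<in>UNIV. mat_cscale (T $ q $ q) (E q))" if "T \<in> diag_mats" for T
  proof -
    have "(\<Sum>q\<in>UNIV. mat_cscale (T $ q $ q) (E q)) = diag_mat (\<lambda>i. \<Sum>q\<in>UNIV. if i = q then T $ q $ q else 0)"
      unfolding E_def diag_mat_cscale diag_mat_sum by (intro arg_cong[of _ _ diag_mat] ext sum.cong) auto
    also have "\<dots> = T" using diag_mats_eq[OF that] by simp
    finally show ?thesis by simp
  qed
  define Y where "Y = Bcontfun (\<lambda>x. (\<chi> p q. \<Psi> x (E q) $ p $ p) :: complex ^ 'n ^ 'n)"
  have Y: "Y x $ p $ q = \<Psi> x (E q) $ p $ p" for x p q
  proof -
    have "const_bcontfun (E q) \<in> cont_diag" for q by (simp add: cont_diag_def)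
    then have "continuous_on UNIV (\<lambda>x. \<Psi> x (E q))" for q
      using wd unfolding fibre_map_well_defined_def by fastforce
    then have "continuous_on UNIV (\<lambda>x. (\<chi> p q. \<Psi> x (E q) $ p $ p) :: complex ^ 'n ^ 'n)"
      by (intro continuous_intros)
    then show ?thesis by (simp add: Y_def apply_Bcontfun_compact[OF comp])
  qed
  have \<Psi>_Y: "\<Psi> x T $ p $ p = (\<Sum>q\<in>UNIV. Y x $ p $ q * T $ q $ q)" if "T \<in> diag_mats" for x T p
  proof -
    have "\<Psi> x T = (\<Sum>q\<in>UNIV. mat_cscale (T $ q $ q) (\<Psi> x (E q)))"
      using \<Psi>_sum[of UNIV x "\<lambda>q. T $ q $ q"] expand[OF that] by simp
    then show ?thesis by (simp add: Y mat_cscale_def mult.commute)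
  qed
  have "Y x \<in> doubly_stochastic" for x
    unfolding doubly_stochastic_def
  proof (intro CollectI conjI allI)
    fix p q
    have "positive_in mat_alg diag_mats (E q)"
      unfolding positive_in_def
      by (rule bexI[of _ "E q"])
        (simp_all add: E_def diag_mat_adj diag_mat_mult, rule arg_cong[of _ _ diag_mat], auto)
    then have "positive_in mat_alg diag_mats (\<Psi> x (E q))"
      using \<Psi>(1)[of x] unfolding positive_map_def by blast
    then obtain r where r: "r \<in> diag_mats" "\<Psi> x (E q) = mat_adj r ** r"
      unfolding positive_in_def mat_alg_simps by blast
    have "(mat_adj r ** r) $ p $ p = cnj (r $ p $ p) * r $ p $ p"
      by (rule diag_mats_adj_mult_nth[OF r(1) r(1)])
    also have "\<dots> = of_real ((cmod (r $ p $ p))\<^sup>2)"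
      by (simp only: complex_norm_square mult.commute)
    finally show "Y x $ p $ q \<in> \<real>\<^sub>\<ge>\<^sub>0"
      unfolding Y r(2) by (simp del: of_real_power)
  next
    fix p
    show "(\<Sum>q\<in>UNIV. Y x $ p $ q) = 1"
      using \<Psi>_Y[OF diag_mats_closed(1), of x p] \<Psi>(2)[of x] by (simp add: mat_def)
  next
    fix q
    have "trace (\<Psi> x (E q)) = trace (E q)" using \<Psi>(3)[OF E, of x q] by (simp add: norm_trace_def)
    also have "trace (E q) = 1" by (simp add: trace_def E_def diag_mat_nth)
    finally show "(\<Sum>p\<in>UNIV. Y x $ p $ q) = 1" by (simp add: Y trace_def)
  qed
  \<comment> \<open>In the map formulation \<open>U\<close> diagonalizes \<open>B\<close> and
    \<open>V\<close> diagonalizes \<open>A\<close>, the reverse of the order in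
    \<open>c_majorized\<close>.\<close>
  moreover define D where "D = (\<chi> j. V **\<^sub>C A $ j **\<^sub>C cont_adj V)"
  moreover define D' where "D' = (\<chi> j. U **\<^sub>C B $ j **\<^sub>C cont_adj U)"
  have D'_diag: "D' $ j \<in> cont_diag" for j
    unfolding D'_def using diag[OF generator_in_cstar_gen] by simp
  have D_eq: "(D $ j) x = \<Psi> x ((D' $ j) x)" for j x
    using unitary_cont[OF V, of x] D'_diag[of j]
    unfolding D_def D'_def
    by (simp add: apply_conj_fibre_map[OF comp wd] matrix_mul_assoc unitaryD unitary_cancel flip: \<Phi>)
  have D_diag: "D $ j \<in> cont_diag" for j
    unfolding cont_diag_def by (simp add: D_eq diag_\<Psi>[OF cont_diagD[OF D'_diag]])
  have "Y x ** diag_columns (family_at D' x) = diag_columns (family_at D x)" for x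
    by (simp add: vec_eq_iff mult_diag_columns_nth D_eq \<Psi>_Y[OF cont_diagD[OF D'_diag]])
      (simp add: diag_columns_def D_eq \<Psi>_Y[OF cont_diagD[OF D'_diag]])
  moreover have "B $ j = cont_adj U **\<^sub>C D' $ j **\<^sub>C U" "A $ j = cont_adj V **\<^sub>C D $ j **\<^sub>C V" for j
    using unitary_cont[OF U] unitary_cont[OF V]
    by (auto intro!: bcontfun_eqI simp: D_def D'_def matrix_mul_assoc unitaryD unitary_cancel)
  ultimately show ?thesis
    unfolding c_majorized_def using U V D_diag D'_diag
    by (intro exI[of _ V] exI[of _ U] exI[of _ D] exI[of _ D'] exI[of _ Y] conjI allI)
qed

text \<open>The fibre maps are the stochastic maps of \<open>X x\<close>, and all properties but
  complete positivity of \<open>\<Phi>\<close> are pointwise. For the latter, factors in the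
  generated algebra are made diagonal by \<open>V\<close>, replaced by a continuous square factor of
  the image, and moved to the frame of \<open>U\<close>.\<close>

lemma cp_map_majorized_of_c_majorized:
  fixes A B :: "('x::topological_space \<Rightarrow>\<^sub>C (complex ^ 'n ^ 'n)) ^ 'm"
  assumes comp: "compact (UNIV :: 'x set)" and "c_majorized A B"
  shows "cp_map_majorized A B"
proof -
  obtain U V D D' and X :: "'x \<Rightarrow>\<^sub>C (complex ^ 'n ^ 'n)"
    where U: "unitary_elem cont_alg U" and V: "unitary_elem cont_alg V"
    and D: "\<And>j. D $ j \<in> cont_diag" "\<And>j. A $ j = cont_adj U **\<^sub>C D $ j **\<^sub>C U"
    and D': "\<And>j. D' $ j \<in> cont_diag" "\<And>j. B $ j = cont_adj V **\<^sub>C D' $ j **\<^sub>C V"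
    and X: "\<And>x. X x \<in> doubly_stochastic"
      "\<And>x. X x ** diag_columns (family_at D' x) = diag_columns (family_at D x)"
    using assms(2) unfolding c_majorized_def by blast
  define \<Psi> where "\<Psi> x = stochastic_map (X x)" for x
  have wd: "fibre_map_well_defined \<Psi>"
    unfolding fibre_map_well_defined_def \<Psi>_def by (auto intro: continuous_on_stochastic_map)
  have uU: "unitary (U x)" and uV: "unitary (V x)" for x
    using U V by (auto intro: unitary_cont)
  have V_B: "V x ** (B $ j) x ** mat_adj (V x) = (D' $ j) x" for x j
    using uV by (simp add: D'(2) matrix_mul_assoc unitaryD unitary_cancel)
  have diag: "V x ** T x ** mat_adj (V x) \<in> diag_mats" if "T \<in> cstar_gen cont_alg B" for T x
    by (rule cont.cstar_gen_diagonalized[of "apply_bcontfun V", OF uV _ that])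
      (simp add: V_B cont_diagD D'(1))
  have cdiag: "V **\<^sub>C T **\<^sub>C cont_adj V \<in> cont_diag" if "T \<in> cstar_gen cont_alg B" for T
    using diag[OF that] by (simp add: cont_diag_def)
  define \<Phi> where "\<Phi> = conj_fibre_map V U \<Psi>"
  have \<Phi>: "\<Phi> T x = mat_adj (U x) ** stochastic_map (X x) (V x ** T x ** mat_adj (V x)) ** U x"
    if "T \<in> cstar_gen cont_alg B" for T x
    unfolding \<Phi>_def by (simp add: apply_conj_fibre_map[OF comp wd cdiag[OF that]] \<Psi>_def)
  have \<Phi>_B: "\<Phi> (B $ j) = A $ j" for j
  proof (rule bcontfun_eqI)
    fix x
    have "(D $ j) x $ p $ p = (\<Sum>q\<in>UNIV. X x $ p $ q * (D' $ j) x $ q $ q)" for p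
      using X(2)[of x] by (simp add: vec_eq_iff matrix_matrix_mult_def diag_columns_def)
    then have "stochastic_map (X x) ((D' $ j) x) = (D $ j) x"
      using diag_mats_eq[OF cont_diagD[OF D(1)], of j x] by (simp add: stochastic_map_def)
    then show "\<Phi> (B $ j) x = (A $ j) x"
      by (simp add: \<Phi>[OF generator_in_cstar_gen] V_B D(2))
  qed
  have \<Phi>_one: "\<Phi> (unity cont_alg) = unity cont_alg"
    by (rule bcontfun_eqI)
      (simp add: \<Phi>[OF cstar_gen_closed(1), simplified] unitaryD[OF uV] unitaryD[OF uU] stochastic_map_one[OF X(1)])
  have \<Phi>_trace: "\<tau> (\<Phi> T) = \<tau> T" if "tracial_state cont_alg \<tau>" "T \<in> cstar_gen cont_alg B" for \<tau> T
  proof (rule cont.tracial_state_eq_if_trace_eq[OF that(1)])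
    fix x
    show "norm_trace (\<Phi> T x) = norm_trace (T x)"
      using norm_trace_conj[OF unitary_adj[OF uV], of x "T x"]
      by (simp add: \<Phi>[OF that(2)] norm_trace_conj[OF uU] norm_trace_stochastic_map[OF X(1)])
  qed
  have "completely_positive_map cont_alg (cstar_gen cont_alg B) UNIV \<Phi>"
    unfolding completely_positive_map_def
  proof (intro conjI allI impI)
    show "linear_map_on cont_alg (cstar_gen cont_alg B) UNIV \<Phi>"
      unfolding linear_map_on_def
      by (auto intro!: bcontfun_eqI simp: \<Phi> cstar_gen_closed[where \<AA> = cont_alg, simplified]
          matrix_add_ldistrib matrix_add_rdistrib stochastic_map_add mat_cscale_mult_left
          mat_cscale_mult_right stochastic_map_cscale)
  next
    fix k T assume "positive_matrix_in cont_alg (cstar_gen cont_alg B) k T"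
    then obtain R where R: "\<And>i j. i < k \<Longrightarrow> j < k \<Longrightarrow> R i j \<in> cstar_gen cont_alg B"
      and T: "\<And>i j. i < k \<Longrightarrow> j < k \<Longrightarrow> T i j = (\<Sum>l<k. cont_adj (R l i) **\<^sub>C R l j)"
      unfolding positive_matrix_in_def cont_alg_simps by blast
    have T_gen: "T i j \<in> cstar_gen cont_alg B" if "i < k" "j < k" for i j
    proof -
      have zero: "0 \<in> cstar_gen cont_alg B"
      proof -
        have "cont_cscale 0 (B $ l) = 0" for l
          by (rule bcontfun_eqI) (simp add: mat_cscale_def vec_eq_iff)
        then show ?thesis
          using cstar_gen_closed(3)[OF generator_in_cstar_gen, where \<AA> = cont_alg and A = B and c = 0] by simp
      qed
      have "(\<Sum>l\<in>S. cont_adj (R l i) **\<^sub>C R l j) \<in> cstar_gen cont_alg B" if "S \<subseteq> {..<k}" for S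
        using finite_subset[OF that finite_lessThan] that
      proof induction
        case (insert l S)
        then show ?case
          using R \<open>i < k\<close> \<open>j < k\<close> cstar_gen_closed[where \<AA> = cont_alg and A = B] by simp
      qed (simp add: zero)
      then show ?thesis by (simp add: T that)
    qed
    define R' where "R' x l i = V x ** R l i x ** mat_adj (V x)" for x l i
    have R'_eq: "R' x l i = apply_bcontfun (V **\<^sub>C R l i **\<^sub>C cont_adj V) x" for x l i
      by (simp add: R'_def)
    define b where "b = (\<Sum>l<k. \<Sum>i<k. norm (V **\<^sub>C R l i **\<^sub>C cont_adj V))"
    have R'_diag: "R' x l i \<in> diag_mats" if "l < k" "i < k" for x l i
      unfolding R'_def by (rule diag[OF R[OF that]])
    have R'_cont: "continuous_on UNIV (\<lambda>x. R' x l i)" for l i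
      unfolding R'_eq by (rule continuous_on_apply_bcontfun)
    have R'_bound: "norm (R' x l i) \<le> b" if "l < k" "i < k" for x l i
    proof -
      have "norm (R' x l i) \<le> norm (V **\<^sub>C R l i **\<^sub>C cont_adj V)"
        unfolding R'_eq by (rule norm_bounded)
      also have "\<dots> \<le> (\<Sum>i<k. norm (V **\<^sub>C R l i **\<^sub>C cont_adj V))"
        using that by (intro member_le_sum) auto
      also have "\<dots> \<le> b"
        unfolding b_def using that by (intro member_le_sum) (auto intro: sum_nonneg)
      finally show ?thesis .
    qed
    obtain S :: "'x \<Rightarrow> nat \<Rightarrow> nat \<Rightarrow> complex ^ 'n ^ 'n"
      where "\<And>x l i. S x l i \<in> diag_mats"
        and S: "\<And>l i. l < k \<Longrightarrow> i < k \<Longrightarrow> continuous_on UNIV (\<lambda>x. S x l i)"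
        "\<And>x i j. i < k \<Longrightarrow> j < k \<Longrightarrow> (\<Sum>l<k. mat_adj (S x l i) ** S x l j)
          = stochastic_map (X x) (\<Sum>l<k. mat_adj (R' x l i) ** R' x l j)"
    proof (rule stochastic_map_gram_factor[where X = "apply_bcontfun X" and k = k and R = R' and b = b])
      show "norm (R' x l i) \<le> b" if "l < k" "i < k" for x l i
        by (rule R'_bound[OF that])
    qed (use X(1) R'_diag R'_cont in simp_all, blast)
    \<comment> \<open>Right multiplication by \<open>U\<close> absorbs the outer conjugation: U* S*
      S U = Q* Q for Q = S U.\<close>
    define Q where "Q l i = Bcontfun (\<lambda>x. S x l i) **\<^sub>C U" for l i
    have Q: "Q l i x = S x l i ** U x" if "l < k" "i < k" for l i x
      unfolding Q_def by (simp add: apply_Bcontfun_compact[OF comp S(1)[OF that]])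
    have "\<Phi> (T i j) = (\<Sum>l<k. cont_adj (Q l i) **\<^sub>C Q l j)" if ij: "i < k" "j < k" for i j
    proof (rule bcontfun_eqI)
      fix x
      have "V x ** T i j x ** mat_adj (V x) = (\<Sum>l<k. mat_adj (R' x l i) ** R' x l j)"
        using unitary_conj_mult[OF uV]
        by (simp add: T ij cont.ev_sum matrix_mult_sum_left matrix_mult_sum_right R'_def mat_adj_mult
            matrix_mul_assoc)
      then have "\<Phi> (T i j) x = mat_adj (U x) ** (\<Sum>l<k. mat_adj (S x l i) ** S x l j) ** U x"
        by (simp add: \<Phi>[OF T_gen[OF ij]] S(2)[OF ij])
      also have "\<dots> = (\<Sum>l<k. mat_adj (Q l i x) ** Q l j x)"
        unfolding matrix_mult_sum_left matrix_mult_sum_right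
        by (intro sum.cong refl) (simp add: Q ij mat_adj_mult matrix_mul_assoc)
      finally show "\<Phi> (T i j) x = (\<Sum>l<k. cont_adj (Q l i) **\<^sub>C Q l j) x"
        by (simp add: cont.ev_sum)
    qed
    then show "positive_matrix_in cont_alg UNIV k (\<lambda>i j. \<Phi> (T i j))"
      unfolding positive_matrix_in_def cont_alg_simps by (intro exI[of _ Q]) simp
  qed
  moreover have "completely_positive_map mat_alg diag_mats diag_mats (\<Psi> x)" "\<Psi> x (mat 1) = mat 1"
    "norm_trace (\<Psi> x T) = norm_trace T" for x T
    unfolding \<Psi>_def
    by (simp_all add: completely_positive_stochastic_map stochastic_map_one norm_trace_stochastic_map X(1))
  ultimately show ?thesis
    unfolding cp_map_majorized_def
    using wd U V cdiag \<Phi>_B \<Phi>_one \<Phi>_trace unfolding \<Phi>_def by blast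
qed

theorem proposition2p11:
  fixes A B :: "('x::t2_space \<Rightarrow>\<^sub>C (complex ^ 'n ^ 'n)) ^ 'm"
  assumes "compact (UNIV :: 'x set)"
    and "abelian_family cont_alg A" and "abelian_family cont_alg B"
  shows
    "(csd A \<and> csd B \<longrightarrow>
        (A \<in> convex hull (unitary_orbit cont_alg B) \<longrightarrow> c_majorized A B) \<and>
        (c_majorized A B \<longleftrightarrow> map_majorized A B) \<and>
        (c_majorized A B \<longleftrightarrow> cp_map_majorized A B) \<and>
        (map_majorized A B \<longrightarrow> pt_majorized A B) \<and>
        (cp_map_majorized A B \<longrightarrow> pt_majorized A B)) \<and>
     (A \<in> convex hull (unitary_orbit cont_alg B) \<longrightarrow>
        A \<in> closure (convex hull (unitary_orbit cont_alg B))) \<and>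
     (A \<in> closure (convex hull (unitary_orbit cont_alg B)) \<longrightarrow> pt_majorized A B) \<and>
     (pt_majorized A B \<longleftrightarrow> tr_pt_majorized A B) \<and>
     (tr_pt_majorized A B \<longleftrightarrow> tr_majorized cont_alg A B)"
proof -
  \<comment> \<open>Both equivalences come from one cycle: continuous majorization gives the strong
    map condition, which gives the weak one, which gives continuous majorization.\<close>
  have "c_majorized A B \<longleftrightarrow> map_majorized A B" "c_majorized A B \<longleftrightarrow> cp_map_majorized A B"
    using c_majorized_of_map_majorized[OF assms(1)] cp_map_majorized_of_c_majorized[OF assms(1)]
      map_majorized_of_cp_map_majorized by blast+
  moreover have "pt_majorized A B \<longleftrightarrow> tr_pt_majorized A B"
    unfolding pt_majorized_def tr_pt_majorized_def
    using majorized_iff_tr_majorized abelian_family_at assms(2,3) by blast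
  ultimately show ?thesis
    using c_majorized_of_convex_hull[OF assms(1)] pt_majorized_of_c_majorized
      pt_majorized_of_closure_convex_hull[OF assms(2,3)]
      tr_pt_majorized_iff_tr_majorized[OF assms] closure_subset by blast
qed

end
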